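(* Let $s\in(0,1)$, $p>1$, $N>ps$, and let $\Omega\subset\mathbb{R}^N$ be a bounded domain. Let $\varepsilon_n\downarrow 0$ and, for each $n$, let $u_n\in W^{s,p}_0(\Omega)$ be a weak solution of $$(-\Delta_p)^s u=|u|^{p^*-2-\varepsilon_n}u\ \text{ in }\Omega,\qquad u=0\ \text{ in }\mathbb{R}^N\setminus\Omega .$$ Suppose that $$I_{\varepsilon_n}(u_n)\to c\in\left]\frac sN\mathbb{S}^{\frac N{ps}},\ 2\frac sN\mathbb{S}^{\frac N{ps}}\right[ .$$ Then, up to subsequences, $u_n\rightharpoonup u$ weakly in $W^{s,p}_0(\Omega)$ for some $u$, and one of the following alternatives holds: 1. $u_n\to u$ strongly in $W^{s,p}_0(\Omega)$, and $u$ is a positive or negative (in $\Omega$) weak solution of the limit equation $(-\Delta_p)^su=|u|^{p^*-2}u$ in $\Omega$, $u=0$ in $\mathbb{R}^N\setminus\Omega$; 2. $u=0$ and there exists $\bar x\in\overline\Omega$ such that $|D^su_n|^p\rightharpoonup c\,\frac Ns\,\delta_{\bar x}$ weakly in the sense of measures.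
   Context: Notation: $p^*=Np/(N-ps)$; $[u]_{s,p}^p=\int_{\mathbb{R}^{2N}}\frac{|u(x)-u(y)|^p}{|x-y|^{N+ps}}\,dx\,dy$; $|u|_q$ is the $L^q(\mathbb{R}^N)$ norm; $W^{s,p}_0(\Omega)=\{u\in L^{p^*}(\mathbb{R}^N): u=0 \text{ in }\mathbb{R}^N\setminus\Omega,\ [u]_{s,p}<\infty\}$, normed by $[\cdot]_{s,p}$. The Sobolev constant is $\mathbb{S}=\inf\{[u]_{s,p}^p/|u|_{p^*}^p: u\in W^{s,p}_0(\mathbb{R}^N)\setminus\{0\}\}$. For $u\in W^{s,p}_0(\Omega)$, $|D^su|^p(x)=\int_{\mathbb{R}^N}\frac{|u(x)-u(y)|^p}{|x-y|^{N+ps}}\,dy$ for a.e. $x\in\mathbb{R}^N$. The operator $(-\Delta_p)^s$ is the differential of $u\mapsto\frac1p[u]_{s,p}^p$ on $W^{s,p}_0(\Omega)$, i.e. $\langle(-\Delta_p)^su,\varphi\rangle=\int_{\mathbb{R}^{2N}}\frac{|u(x)-u(y)|^{p-2}(u(x)-u(y))(\varphi(x)-\varphi(y))}{|x-y|^{N+ps}}\,dx\,dy$. For small $\varepsilon\ge0$ (so that $p<p^*-\varepsilon$), a weak solution of the problem with exponent $p^*-2-\varepsilon$ is a critical point of the $C^1$ functional $I_\varepsilon(u)=\frac1p[u]_{s,p}^p-\frac1{p^*-\varepsilon}\int_\Omega|u|^{p^*-\varepsilon}dx$ on $W^{s,p}_0(\Omega)$. Weak convergence in the sense of measures is convergence against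 test functions in $C_0(\mathbb{R}^N)$; $\delta_{\bar x}$ is the Dirac mass at $\bar x$. *)

theory Defs
  imports "HOL-Probability.Probability"
begin

text \<open>
  The ambient space is an arbitrary Euclidean space \<open>'a\<close>, with \<open>N = DIM('a)\<close>.  Elements of the
  function spaces are represented by Borel functions \<open>'a \<Rightarrow> real\<close> (every class modulo equality
  almost everywhere has such a representative); none of the notions below distinguishes functions
  that agree almost everywhere.
\<close>

definition crit_exp :: "real \<Rightarrow> real \<Rightarrow> real \<Rightarrow> real" where
  "crit_exp N s p = N * p / (N - p * s)"

text \<open>On the null set \<open>x = y\<close> the quotient below has the value \<open>0\<close>.\<close>

definition gagliardo_kernel :: "real \<Rightarrow> real \<Rightarrow> ('a::euclidean_space \<Rightarrow> real) \<Rightarrow> 'a \<Rightarrow> 'a \<Rightarrow> real" where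
  "gagliardo_kernel s p u x y =
     \<bar>u x - u y\<bar> powr p / norm (x - y) powr (real DIM('a) + p * s)"

text \<open>\<open>gagliardo_pow s p u\<close> is the power \<open>[u]\<^sup>p\<close>; it is only meaningful when the kernel is integrable,
  which is part of membership in \<open>W0\<close>.\<close>

definition gagliardo_pow :: "real \<Rightarrow> real \<Rightarrow> ('a::euclidean_space \<Rightarrow> real) \<Rightarrow> real" where
  "gagliardo_pow s p u =
     (LINT z|(lborel \<Otimes>\<^sub>M lborel). gagliardo_kernel s p u (fst z) (snd z))"

definition gagliardo :: "real \<Rightarrow> real \<Rightarrow> ('a::euclidean_space \<Rightarrow> real) \<Rightarrow> real" where
  "gagliardo s p u = gagliardo_pow s p u powr (1 / p)"

definition Lq_norm :: "real \<Rightarrow> ('a::euclidean_space \<Rightarrow> real) \<Rightarrow> real" where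
  "Lq_norm q u = (LINT x|lborel. \<bar>u x\<bar> powr q) powr (1 / q)"

definition W0 :: "real \<Rightarrow> real \<Rightarrow> 'a::euclidean_space set \<Rightarrow> ('a \<Rightarrow> real) set" where
  "W0 s p \<Omega> = {u. u \<in> borel_measurable lborel \<and>
      integrable lborel (\<lambda>x. \<bar>u x\<bar> powr crit_exp (real DIM('a)) s p) \<and>
      (AE x in lborel. x \<notin> \<Omega> \<longrightarrow> u x = 0) \<and>
      integrable (lborel \<Otimes>\<^sub>M lborel) (\<lambda>z. gagliardo_kernel s p u (fst z) (snd z))}"

definition sobolev_const :: "'a::euclidean_space itself \<Rightarrow> real \<Rightarrow> real \<Rightarrow> real" where
  "sobolev_const _ s p =
     Inf {gagliardo_pow s p u / Lq_norm (crit_exp (real DIM('a)) s p) u powr p | u :: 'a \<Rightarrow> real.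
            u \<in> W0 s p UNIV \<and> \<not> (AE x in lborel. u x = 0)}"

definition W0_bounded_linear ::
  "real \<Rightarrow> real \<Rightarrow> 'a::euclidean_space set \<Rightarrow> (('a \<Rightarrow> real) \<Rightarrow> real) \<Rightarrow> bool" where
  "W0_bounded_linear s p \<Omega> L \<longleftrightarrow>
     (\<forall>u\<in>W0 s p \<Omega>. \<forall>v\<in>W0 s p \<Omega>. L (\<lambda>x. u x + v x) = L u + L v) \<and>
     (\<forall>u\<in>W0 s p \<Omega>. \<forall>a. L (\<lambda>x. a * u x) = a * L u) \<and>
     (\<exists>C. \<forall>u\<in>W0 s p \<Omega>. \<bar>L u\<bar> \<le> C * gagliardo s p u)"

definition W0_tendsto ::
  "real \<Rightarrow> real \<Rightarrow> (nat \<Rightarrow> 'a::euclidean_space \<Rightarrow> real) \<Rightarrow> ('a \<Rightarrow> real) \<Rightarrow> bool" where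
  "W0_tendsto s p u v \<longleftrightarrow> (\<lambda>n. gagliardo s p (\<lambda>x. u n x - v x)) \<longlonglongrightarrow> 0"

definition W0_weak_tendsto ::
  "real \<Rightarrow> real \<Rightarrow> 'a::euclidean_space set \<Rightarrow> (nat \<Rightarrow> 'a \<Rightarrow> real) \<Rightarrow> ('a \<Rightarrow> real) \<Rightarrow> bool" where
  "W0_weak_tendsto s p \<Omega> u v \<longleftrightarrow>
     (\<forall>L. W0_bounded_linear s p \<Omega> L \<longrightarrow> (\<lambda>n. L (u n)) \<longlonglongrightarrow> L v)"

text \<open>Frechet differentiability on the normed space \<open>(W0 s p \<Omega>, gagliardo s p)\<close>.\<close>

definition W0_has_derivative ::
  "real \<Rightarrow> real \<Rightarrow> 'a::euclidean_space set \<Rightarrow> (('a \<Rightarrow> real) \<Rightarrow> real) \<Rightarrow>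
     (('a \<Rightarrow> real) \<Rightarrow> real) \<Rightarrow> ('a \<Rightarrow> real) \<Rightarrow> bool" where
  "W0_has_derivative s p \<Omega> J L u \<longleftrightarrow> W0_bounded_linear s p \<Omega> L \<and>
     (\<forall>e>0. \<exists>d>0. \<forall>v\<in>W0 s p \<Omega>. gagliardo s p v < d \<longrightarrow>
        \<bar>J (\<lambda>x. u x + v x) - J u - L v\<bar> \<le> e * gagliardo s p v)"

definition critical_point ::
  "real \<Rightarrow> real \<Rightarrow> 'a::euclidean_space set \<Rightarrow> (('a \<Rightarrow> real) \<Rightarrow> real) \<Rightarrow> ('a \<Rightarrow> real) \<Rightarrow> bool" where
  "critical_point s p \<Omega> J u \<longleftrightarrow> u \<in> W0 s p \<Omega> \<and> W0_has_derivative s p \<Omega> J (\<lambda>_. 0) u"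

definition energy ::
  "real \<Rightarrow> real \<Rightarrow> 'a::euclidean_space set \<Rightarrow> real \<Rightarrow> ('a \<Rightarrow> real) \<Rightarrow> real" where
  "energy s p \<Omega> \<epsilon> u = 1 / p * gagliardo_pow s p u
     - 1 / (crit_exp (real DIM('a)) s p - \<epsilon>) *
         (LINT x:\<Omega>|lborel. \<bar>u x\<bar> powr (crit_exp (real DIM('a)) s p - \<epsilon>))"

text \<open>Weak solutions of the Dirichlet problem in \<open>\<Omega>\<close> for the fractional \<open>p\<close>-Laplacian with right-hand
  side \<open>|u|^(p* - 2 - \<epsilon>) u\<close>; the case \<open>\<epsilon> = 0\<close> is the limit equation.\<close>

definition weak_solution ::
  "real \<Rightarrow> real \<Rightarrow> 'a::euclidean_space set \<Rightarrow> real \<Rightarrow> ('a \<Rightarrow> real) \<Rightarrow> bool" where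
  "weak_solution s p \<Omega> \<epsilon> u \<longleftrightarrow> critical_point s p \<Omega> (energy s p \<Omega> \<epsilon>) u"

text \<open>The function \<open>|D\<^sup>s u|\<^sup>p\<close>, with the value \<open>\<infinity>\<close> where the integral diverges (a null set for
  \<open>u\<close> in \<open>W0\<close>).\<close>

definition Ds_pow :: "real \<Rightarrow> real \<Rightarrow> ('a::euclidean_space \<Rightarrow> real) \<Rightarrow> 'a \<Rightarrow> ennreal" where
  "Ds_pow s p u x = (\<integral>\<^sup>+y. ennreal (gagliardo_kernel s p u x y) \<partial>lborel)"

text \<open>Weak convergence in the sense of measures, tested against the continuous functions that
  vanish at infinity.\<close>

definition measure_weak_tendsto ::
  "(nat \<Rightarrow> 'a::euclidean_space measure) \<Rightarrow> 'a measure \<Rightarrow> bool" where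
  "measure_weak_tendsto M \<mu> \<longleftrightarrow>
     (\<forall>\<phi> :: 'a \<Rightarrow> real. continuous_on UNIV \<phi> \<and> (\<phi> \<longlongrightarrow> 0) at_infinity \<longrightarrow>
        (\<lambda>n. LINT x|M n. \<phi> x) \<longlonglongrightarrow> (LINT x|\<mu>. \<phi> x))"

end

theory Submission
  imports Defs "HOL-Library.Diagonal_Subsequence"
begin

text \<open>
  Let \<open>E u\<close> denote the \<open>p\<close>-th power of the Gagliardo seminorm and \<open>kap = S powr (N / (p s))\<close>.
  Testing the equation of \<open>u\<^sub>n\<close> with \<open>u\<^sub>n\<close> itself turns the hypothesis on the energies into
  \<open>E u\<^sub>n = \<integral> |u\<^sub>n|^q\<^sub>n \<longlonglongrightarrow> M\<close> with \<open>M = c N / s\<close>, and the condition on \<open>c\<close> says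
  \<open>kap < M < 2 kap\<close>.  The proof rests on one principle: a part of a solution whose energy is bounded
  by its own critical mass either vanishes or has energy at least \<open>kap\<close>, by the Sobolev inequality
  (\<open>threshold\<close>).  Below \<open>2 kap\<close> there is room for only one such part.

  A bounded sequence in the Sobolev space has a subsequence that converges almost everywhere, because
  functions of bounded energy are close to their averages over small balls
  (\<open>compact_embedding_AE\<close>).  Almost everywhere convergence and bounded energy imply weak convergence
  by uniform convexity (\<open>bounded_linear_null_limit\<close>), and they suffice to pass to the limit in the
  equation (\<open>euler_lagrange_limit\<close>).  Let \<open>v\<close> be the limit.

  Suppose \<open>v \<noteq> 0\<close>.  If \<open>v\<close> changed sign, its positive and its negative part would each carry the mass
  \<open>kap\<close>, which is impossible (\<open>low_energy_sign\<close>); a strong maximum principle makes the sign strict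
  (\<open>strong_positivity\<close>).  Energy and mass both split according to the Brezis-Lieb lemma, so in the
  limit the energy \<open>M - E v < kap\<close> of \<open>u\<^sub>n - v\<close> again equals its mass, and therefore is \<open>0\<close>
  (\<open>strong_convergence\<close>).

  Suppose \<open>v = 0\<close>.  Then \<open>u\<^sub>n \<longlonglongrightarrow> 0\<close> in \<open>L\<^sup>p\<close>, so multiplication by a Lipschitz cut-off costs nothing in the
  limit, and the measures \<open>|D\<^sup>s u\<^sub>n|\<^sup>p dx\<close> and \<open>|u\<^sub>n|^q\<^sub>n dx\<close> are asymptotically equal
  (\<open>localized_identity\<close>).  The principle above localizes: a region with mass less than \<open>kap\<close> loses all
  its mass in the limit (\<open>small_mass_vanishes\<close>).  Of two separated regions at least one is of this kind,
  since \<open>M < 2 kap\<close>; hence all the mass gathers in a ball of arbitrarily small radius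
  (\<open>concentration\<close>), and its centres accumulate at a point of the closure of \<open>\<Omega>\<close>.
\<close>

section \<open>Inequalities for powers\<close>

lemma weighted_am_gm:
  fixes a b \<alpha> :: real
  assumes "0 \<le> a" "0 \<le> b" "0 < \<alpha>" "\<alpha> < 1"
  shows "a powr (1 - \<alpha>) * b powr \<alpha> \<le> (1 - \<alpha>) * a + \<alpha> * b"
proof (cases "a = 0 \<or> b = 0")
  case True
  then show ?thesis using assms by auto
next
  case False
  then show ?thesis using Youngs_inequality_0[of "1 - \<alpha>" \<alpha> a b] assms by auto
qed

text \<open>
  Bounding both factors by the larger one gives a form of Young's inequality without conjugate exponents.
\<close>
lemma powr_mult_le_add:
  fixes x y r :: real
  assumes "1 \<le> r" "0 \<le> x" "0 \<le> y"
  shows "x powr (r - 1) * y \<le> x powr r + y powr r"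
proof (cases "x = 0 \<or> y = 0")
  case True
  then show ?thesis by auto
next
  case False
  define m where "m = max x y"
  have m: "m > 0" using False assms by (auto simp: m_def)
  have "x powr (r - 1) * y \<le> m powr (r - 1) * m"
    using assms by (intro mult_mono powr_mono2) (auto simp: m_def)
  also have "\<dots> = m powr r" using m by (simp add: powr_mult_base mult.commute)
  also have "\<dots> \<le> x powr r + y powr r" by (auto simp: m_def max_def)
  finally show ?thesis .
qed

text \<open>
  Replacing \<open>x\<close> by a small multiple of \<open>x\<close> in \<open>powr_mult_le_add\<close> moves the large constant to the
  second term.
\<close>
lemma young_small:
  fixes r \<eta> :: real
  assumes "1 < r" "0 < \<eta>"
  shows "\<exists>C\<ge>0. \<forall>x\<ge>0. \<forall>y\<ge>0. x powr (r - 1) * y \<le> \<eta> * x powr r + C * y powr r"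
proof -
  define l where "l = \<eta> powr (1 / r)"
  have l: "l > 0" "l powr r = \<eta>" using assms by (auto simp: l_def powr_powr)
  show ?thesis
  proof (intro exI[of _ "(1 / l powr (r - 1)) powr r"] conjI allI impI)
    fix x y :: real assume xy: "0 \<le> x" "0 \<le> y"
    have "x powr (r - 1) * y = (l * x) powr (r - 1) * (1 / l powr (r - 1) * y)"
      using l xy by (simp add: powr_mult)
    also have "\<dots> \<le> (l * x) powr r + (1 / l powr (r - 1) * y) powr r"
      using assms l xy by (intro powr_mult_le_add) auto
    also have "\<dots> = \<eta> * x powr r + (1 / l powr (r - 1)) powr r * y powr r"
      using l xy by (subst (1 2) powr_mult) auto
    finally show "x powr (r - 1) * y \<le> \<eta> * x powr r + (1 / l powr (r - 1)) powr r * y powr r" .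
  qed auto
qed

lemma powr_mean_value:
  fixes a b r :: real
  assumes "1 < r" "0 \<le> a" "a < b"
  shows "\<exists>t. a < t \<and> t < b \<and> b powr r - a powr r = (b - a) * (r * t powr (r - 1))"
proof -
  have d: "((\<lambda>t. t powr r) has_real_derivative r * t powr (r - 1)) (at t)" if "t > 0" for t
    using that by (auto intro!: derivative_eq_intros)
  have c: "continuous_on {a..b} (\<lambda>t. t powr r)"
    using assms by (intro continuous_on_powr' continuous_intros) auto
  obtain l t where t: "a < t" "t < b" "DERIV (\<lambda>t. t powr r) t :> l" "b powr r - a powr r = (b - a) * l"
    using MVT[OF assms(3) c] d assms(2)
    by (metis (no_types, lifting) order_le_less_trans real_differentiable_def)
  have "l = r * t powr (r - 1)"
    using t(1,3) d[of t] assms(2) DERIV_unique by force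
  with t show ?thesis by auto
qed

text \<open>
  By the mean value theorem, since the derivative of the power is strictly increasing.
\<close>
lemma powr_tangent_strict:
  fixes x m r :: real
  assumes "1 < r" "0 \<le> x" "0 < m" "x \<noteq> m"
  shows "m powr r + r * m powr (r - 1) * (x - m) < x powr r"
proof (cases "x < m")
  case True
  obtain t where t: "x < t" "t < m" "m powr r - x powr r = (m - x) * (r * t powr (r - 1))"
    using powr_mean_value[of r x m] True assms by auto
  have "t powr (r - 1) < m powr (r - 1)" using t assms by (intro powr_less_mono2) auto
  then have "(m - x) * (r * t powr (r - 1)) < (m - x) * (r * m powr (r - 1))"
    using True assms by (intro mult_strict_left_mono) auto
  then show ?thesis using t(3) by (simp add: algebra_simps)
next
  case False
  then have "m < x" using assms by auto
  then obtain t where t: "m < t" "t < x" "x powr r - m powr r = (x - m) * (r * t powr (r - 1))"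
    using powr_mean_value[of r m x] assms by auto
  have "m powr (r - 1) < t powr (r - 1)" using t assms by (intro powr_less_mono2) auto
  then have "(x - m) * (r * m powr (r - 1)) < (x - m) * (r * t powr (r - 1))"
    using \<open>m < x\<close> assms by (intro mult_strict_left_mono) auto
  then show ?thesis using t(3) by (simp add: algebra_simps)
qed

lemma powr_midpoint_strict:
  fixes a b r :: real
  assumes "1 < r" "a \<noteq> b"
  shows "\<bar>(a + b) / 2\<bar> powr r < (\<bar>a\<bar> powr r + \<bar>b\<bar> powr r) / 2"
proof -
  define x y m where "x = \<bar>a\<bar>" and "y = \<bar>b\<bar>" and "m = (\<bar>a\<bar> + \<bar>b\<bar>) / 2"
  have xy: "x \<ge> 0" "y \<ge> 0" "m = (x + y) / 2" "m > 0" using assms by (auto simp: x_def y_def m_def)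
  show ?thesis
  proof (cases "x = y")
    case True
    then have "a = - b" using assms(2) by (auto simp: x_def y_def)
    then show ?thesis using assms by auto
  next
    case False
    have "x \<noteq> m" "y \<noteq> m" using False xy(3) by auto
    then have "m powr r + r * m powr (r - 1) * (x - m) < x powr r"
      "m powr r + r * m powr (r - 1) * (y - m) < y powr r"
      using xy assms by (auto intro!: powr_tangent_strict)
    then have "2 * m powr r + r * m powr (r - 1) * (x + y - 2 * m) < x powr r + y powr r"
      by (simp add: algebra_simps)
    moreover have "x + y - 2 * m = 0" using xy(3) by simp
    ultimately have "m powr r < (x powr r + y powr r) / 2" by simp
    moreover have "\<bar>(a + b) / 2\<bar> powr r \<le> m powr r"
      using assms by (intro powr_mono2) (auto simp: m_def)
    ultimately show ?thesis unfolding x_def y_def by linarith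
  qed
qed

text \<open>
  All terms are homogeneous of degree \<open>r\<close>, so it suffices to treat \<open>max \<bar>a\<bar> \<bar>b\<bar> = 1\<close>.  Among
  these pairs, those for which the inequality does not hold strictly with \<open>C = 0\<close> form a compact set
  that avoids the diagonal, and there the convexity gap has a positive minimum.  The argument does not distinguish \<open>r < 2\<close> from
  \<open>r \<ge> 2\<close>, as Clarkson's inequalities do.
\<close>
lemma uniform_convexity_pointwise:
  fixes r \<eta> :: real
  assumes "1 < r" "0 < \<eta>"
  shows "\<exists>C\<ge>0. \<forall>a b. \<bar>a - b\<bar> powr r \<le> \<eta> * (\<bar>a\<bar> powr r + \<bar>b\<bar> powr r)
      + C * ((\<bar>a\<bar> powr r + \<bar>b\<bar> powr r) / 2 - \<bar>(a + b) / 2\<bar> powr r)"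
proof -
  define F where "F z = (\<bar>fst z\<bar> powr r + \<bar>snd z\<bar> powr r) / 2 - \<bar>(fst z + snd z) / 2\<bar> powr r"
    for z :: "real \<times> real"
  define G where "G z = \<bar>fst z - snd z\<bar> powr r - \<eta> * (\<bar>fst z\<bar> powr r + \<bar>snd z\<bar> powr r)"
    for z :: "real \<times> real"
  have contF: "continuous_on UNIV F" and contG: "continuous_on UNIV G"
    unfolding F_def G_def using assms by (intro continuous_intros continuous_on_powr'; force)+
  have Fnn: "F z \<ge> 0" for z
    using powr_midpoint_strict[of r "fst z" "snd z"] assms by (cases "fst z = snd z") (auto simp: F_def)
  define K where "K = {z :: real \<times> real. max \<bar>fst z\<bar> \<bar>snd z\<bar> = 1 \<and> G z \<ge> 0}"
  have "compact K"
  proof -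
    have "closed K" unfolding K_def
      by (intro closed_Collect_conj closed_Collect_eq closed_Collect_le continuous_intros contG)
    moreover have "bounded K"
    proof (rule boundedI[of _ 2])
      fix z :: "real \<times> real" assume "z \<in> K"
      then have "\<bar>fst z\<bar> \<le> 1" "\<bar>snd z\<bar> \<le> 1" by (auto simp: K_def)
      then show "norm z \<le> 2" using norm_Pair_le[of "fst z" "snd z"] by auto
    qed
    ultimately show ?thesis by (simp add: compact_eq_bounded_closed)
  qed
  have norm_case: "\<exists>C\<ge>0. \<forall>z. max \<bar>fst z\<bar> \<bar>snd z\<bar> = 1 \<longrightarrow> G z \<le> C * F z"
  proof (cases "K = {}")
    case True
    then show ?thesis using Fnn by (intro exI[of _ 0]) (force simp: K_def)
  next
    case False
    obtain z0 where z0: "z0 \<in> K" "\<And>z. z \<in> K \<Longrightarrow> F z0 \<le> F z"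
      using continuous_attains_inf[OF \<open>compact K\<close> False] continuous_on_subset[OF contF] by blast
    have "fst z0 \<noteq> snd z0"
    proof
      assume eq: "fst z0 = snd z0"
      then have "\<bar>snd z0\<bar> = 1" "G z0 \<ge> 0" using z0(1) by (auto simp: K_def)
      then show False using assms eq by (auto simp: G_def)
    qed
    then have pos: "F z0 > 0"
      using powr_midpoint_strict[of r "fst z0" "snd z0"] assms by (auto simp: F_def)
    show ?thesis
    proof (intro exI[of _ "2 powr r / F z0"] conjI allI impI)
      show "0 \<le> 2 powr r / F z0" using pos by simp
      fix z :: "real \<times> real" assume z: "max \<bar>fst z\<bar> \<bar>snd z\<bar> = 1"
      show "G z \<le> 2 powr r / F z0 * F z"
      proof (cases "G z \<ge> 0")
        case True
        then have "F z0 \<le> F z" using z z0 by (auto simp: K_def)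
        then have "2 powr r * 1 \<le> 2 powr r * (F z / F z0)" using pos by (intro mult_left_mono) auto
        moreover have "\<bar>fst z - snd z\<bar> powr r \<le> 2 powr r" using z assms by (intro powr_mono2) auto
        then have "G z \<le> 2 powr r" using assms unfolding G_def
          by (smt (verit) mult_nonneg_nonneg powr_ge_zero)
        ultimately show ?thesis by simp
      next
        case False
        then show ?thesis using Fnn[of z] pos
          by (smt (verit) divide_nonneg_pos mult_nonneg_nonneg powr_ge_zero)
      qed
    qed
  qed
  then obtain C where C: "C \<ge> 0" "\<And>z. max \<bar>fst z\<bar> \<bar>snd z\<bar> = 1 \<Longrightarrow> G z \<le> C * F z" by blast
  have "G (a, b) \<le> C * F (a, b)" for a b
  proof (cases "a = 0 \<and> b = 0")
    case True
    then show ?thesis by (simp add: F_def G_def)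
  next
    case False
    define m where "m = max \<bar>a\<bar> \<bar>b\<bar>"
    have m: "m > 0" using False by (auto simp: m_def)
    have scale: "\<bar>m * t\<bar> powr r = m powr r * \<bar>t\<bar> powr r" for t
      using m by (simp add: abs_mult powr_mult)
    have "max \<bar>a / m\<bar> \<bar>b / m\<bar> = 1"
      using m by (auto simp: m_def max_def field_simps)
    then have "G (a / m, b / m) \<le> C * F (a / m, b / m)" using C by auto
    then have "m powr r * G (a / m, b / m) \<le> m powr r * (C * F (a / m, b / m))"
      by (intro mult_left_mono) auto
    moreover have "m powr r * G (a / m, b / m) = G (a, b)"
      using m scale[of "a / m"] scale[of "b / m"] scale[of "a / m - b / m"]
      by (simp add: G_def right_diff_distrib distrib_left mult.left_commute)
    moreover have "m powr r * F (a / m, b / m) = F (a, b)"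
      using m scale[of "a / m"] scale[of "b / m"] scale[of "(a / m + b / m) / 2"]
      by (simp add: F_def right_diff_distrib distrib_left add_divide_distrib mult.left_commute)
    ultimately show ?thesis by (simp add: mult.left_commute)
  qed
  then have "\<bar>a - b\<bar> powr r \<le> \<eta> * (\<bar>a\<bar> powr r + \<bar>b\<bar> powr r)
      + C * ((\<bar>a\<bar> powr r + \<bar>b\<bar> powr r) / 2 - \<bar>(a + b) / 2\<bar> powr r)" for a b
    unfolding F_def G_def fst_conv snd_conv by (metis diff_le_eq add.commute)
  then show ?thesis using C(1) by blast
qed

text \<open>
  If \<open>y \<le> t x\<close> for a small \<open>t\<close> the first term suffices, otherwise the second.  The constant serves all
  exponents up to \<open>Q\<close>, because the exponents of the equations vary along the sequence.
\<close>
lemma powr_add_le_uniform: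
  fixes Q \<eta> :: real
  assumes "0 < Q" "0 < \<eta>"
  shows "\<exists>C\<ge>0. \<forall>q x y. 0 < q \<and> q \<le> Q \<and> 0 \<le> x \<and> 0 \<le> y \<longrightarrow>
    (x + y) powr q \<le> (1 + \<eta>) * x powr q + C * y powr q"
proof -
  define t where "t = (1 + \<eta>) powr (1 / Q) - 1"
  have "(1 + \<eta>) powr (1 / Q) > (1 + \<eta>) powr 0" using assms by (intro powr_less_mono) auto
  then have t: "t > 0" using assms by (auto simp: t_def)
  have tQ: "(1 + t) powr Q = 1 + \<eta>" using assms by (simp add: t_def powr_powr)
  show ?thesis
  proof (intro exI[of _ "(1 + 1 / t) powr Q"] conjI allI impI; (elim conjE)?)
    fix q x y :: real assume *: "0 < q" "q \<le> Q" "0 \<le> x" "0 \<le> y"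
    show "(x + y) powr q \<le> (1 + \<eta>) * x powr q + (1 + 1 / t) powr Q * y powr q"
    proof (cases "y \<le> t * x")
      case True
      have "(x + y) powr q \<le> ((1 + t) * x) powr q"
        using * True by (intro powr_mono2) (auto simp: algebra_simps)
      also have "\<dots> = (1 + t) powr q * x powr q" using * t by (simp add: powr_mult)
      also have "\<dots> \<le> (1 + t) powr Q * x powr q"
        using * t by (intro mult_right_mono powr_mono) auto
      finally show ?thesis using tQ by (smt (verit) mult_nonneg_nonneg powr_ge_zero)
    next
      case False
      then have "x \<le> y / t" using t by (simp add: field_simps)
      then have "(x + y) powr q \<le> ((1 + 1 / t) * y) powr q"
        using * by (intro powr_mono2) (auto simp: algebra_simps)
      also have "\<dots> = (1 + 1 / t) powr q * y powr q" using * t by (simp add: powr_mult)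
      also have "\<dots> \<le> (1 + 1 / t) powr Q * y powr q"
        using * t by (intro mult_right_mono powr_mono) auto
      finally show ?thesis using assms by (smt (verit) mult_nonneg_nonneg powr_ge_zero)
    qed
  qed auto
qed

lemma powr_add_le:
  fixes q x y :: real
  assumes "0 < q" "0 \<le> x" "0 \<le> y"
  shows "(x + y) powr q \<le> 2 powr q * (x powr q + y powr q)"
proof -
  have "(x + y) powr q \<le> (2 * max x y) powr q" using assms by (intro powr_mono2) auto
  also have "\<dots> = 2 powr q * max x y powr q" using assms by (simp add: powr_mult)
  also have "max x y powr q \<le> x powr q + y powr q" by (auto simp: max_def)
  finally show ?thesis by simp
qed

lemma abs_powr_add_le:
  fixes q a b :: real
  assumes "0 < q"
  shows "\<bar>a + b\<bar> powr q \<le> 2 powr q * (\<bar>a\<bar> powr q + \<bar>b\<bar> powr q)"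
proof -
  have "\<bar>a + b\<bar> powr q \<le> (\<bar>a\<bar> + \<bar>b\<bar>) powr q" using assms by (intro powr_mono2) auto
  also have "\<dots> \<le> 2 powr q * (\<bar>a\<bar> powr q + \<bar>b\<bar> powr q)" using assms by (intro powr_add_le) auto
  finally show ?thesis .
qed

text \<open>
  The preceding inequality bounds \<open>a + b\<close> in terms of \<open>a\<close>, and \<open>a = (a + b) - b\<close> in terms of \<open>a + b\<close>.
\<close>
lemma brezis_lieb_pointwise:
  fixes Q \<eta> :: real
  assumes "0 < Q" "0 < \<eta>"
  shows "\<exists>C\<ge>0. \<forall>q a b. 0 < q \<and> q \<le> Q \<longrightarrow>
    \<bar>\<bar>a + b\<bar> powr q - \<bar>a\<bar> powr q\<bar> \<le> \<eta> * \<bar>a\<bar> powr q + C * \<bar>b\<bar> powr q"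
proof -
  define e where "e = min 1 \<eta> / 2"
  have e: "0 < e" "e \<le> \<eta>" "e * (1 + e) \<le> \<eta>" "e \<le> 1"
  proof -
    show "0 < e" "e \<le> \<eta>" "e \<le> 1" using assms by (auto simp: e_def)
    then have "e * (1 + e) \<le> e * 2" by (intro mult_left_mono) auto
    then show "e * (1 + e) \<le> \<eta>" by (auto simp: e_def)
  qed
  obtain C where C: "C \<ge> 0" "\<And>q x y. 0 < q \<Longrightarrow> q \<le> Q \<Longrightarrow> 0 \<le> x \<Longrightarrow> 0 \<le> y \<Longrightarrow>
      (x + y) powr q \<le> (1 + e) * x powr q + C * y powr q"
    using powr_add_le_uniform[OF assms(1) e(1)] by blast
  show ?thesis
  proof (intro exI[of _ "2 * C"] conjI allI impI; (elim conjE)?)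
    show "0 \<le> 2 * C" using C by simp
    fix q a b :: real assume q: "0 < q" "q \<le> Q"
    have "\<bar>a + b\<bar> powr q \<le> (\<bar>a\<bar> + \<bar>b\<bar>) powr q" using q by (intro powr_mono2) auto
    also have "\<dots> \<le> (1 + e) * \<bar>a\<bar> powr q + C * \<bar>b\<bar> powr q" using C q by auto
    finally have up: "\<bar>a + b\<bar> powr q \<le> (1 + e) * \<bar>a\<bar> powr q + C * \<bar>b\<bar> powr q" .
    have "\<bar>a\<bar> powr q \<le> (\<bar>a + b\<bar> + \<bar>b\<bar>) powr q" using q by (intro powr_mono2) auto
    also have "\<dots> \<le> (1 + e) * \<bar>a + b\<bar> powr q + C * \<bar>b\<bar> powr q" using C q by auto
    finally have "\<bar>a\<bar> powr q - \<bar>a + b\<bar> powr q \<le> e * \<bar>a + b\<bar> powr q + C * \<bar>b\<bar> powr q"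
      by (simp add: algebra_simps)
    also have "\<dots> \<le> e * ((1 + e) * \<bar>a\<bar> powr q + C * \<bar>b\<bar> powr q) + C * \<bar>b\<bar> powr q"
      using up e by (intro add_right_mono mult_left_mono) auto
    also have "\<dots> = (e * (1 + e)) * \<bar>a\<bar> powr q + e * (C * \<bar>b\<bar> powr q) + C * \<bar>b\<bar> powr q"
      by (simp add: algebra_simps)
    also have "\<dots> \<le> \<eta> * \<bar>a\<bar> powr q + 1 * (C * \<bar>b\<bar> powr q) + C * \<bar>b\<bar> powr q"
      using e C by (intro add_right_mono add_mono mult_right_mono) auto
    finally have low: "\<bar>a\<bar> powr q - \<bar>a + b\<bar> powr q \<le> \<eta> * \<bar>a\<bar> powr q + 2 * C * \<bar>b\<bar> powr q" by simp
    have "e * \<bar>a\<bar> powr q \<le> \<eta> * \<bar>a\<bar> powr q" "0 \<le> C * \<bar>b\<bar> powr q"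
      using e C by (auto intro: mult_right_mono)
    then show "\<bar>\<bar>a + b\<bar> powr q - \<bar>a\<bar> powr q\<bar> \<le> \<eta> * \<bar>a\<bar> powr q + 2 * C * \<bar>b\<bar> powr q"
      using up low by (auto simp: algebra_simps abs_le_iff)
  qed
qed

text \<open>
  \<open>spow (r - 1) a\<close> is \<open>|a|^(r - 2) a\<close>, in a form that is also meaningful for \<open>a = 0\<close> and \<open>r < 2\<close>.
\<close>
definition spow :: "real \<Rightarrow> real \<Rightarrow> real" where
  "spow e a = sgn a * \<bar>a\<bar> powr e"

lemma abs_spow: "\<bar>spow e a\<bar> = \<bar>a\<bar> powr e"
  by (auto simp: spow_def abs_mult sgn_if)

lemma spow_mult_self: "spow (r - 1) a * a = \<bar>a\<bar> powr r"
proof -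
  have "spow (r - 1) a * a = \<bar>a\<bar> * \<bar>a\<bar> powr (r - 1)"
    by (simp add: spow_def abs_sgn mult.commute mult.left_commute)
  then show ?thesis by (simp add: powr_mult_base)
qed

lemma spow_minus: "spow e (- a) = - spow e a"
  by (simp add: spow_def)

lemma borel_measurable_spow[measurable (raw)]:
  "f \<in> borel_measurable M \<Longrightarrow> (\<lambda>x. spow e (f x)) \<in> borel_measurable M"
  unfolding spow_def
  by (intro borel_measurable_times measurable_compose[OF _ borel_measurable_sgn] powr_real_measurable
      borel_measurable_abs) auto

lemma tendsto_spow:
  fixes a :: real
  assumes a: "(f \<longlongrightarrow> a) F" and e: "(g \<longlongrightarrow> e) F" and "0 < e"
  shows "((\<lambda>n. spow (g n) (f n)) \<longlongrightarrow> spow e a) F"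
proof -
  have abs: "((\<lambda>n. \<bar>f n\<bar> powr g n) \<longlongrightarrow> \<bar>a\<bar> powr e) F"
    using assms by (intro tendsto_powr' tendsto_rabs) auto
  show ?thesis
  proof (cases "a = 0")
    case True
    then have "((\<lambda>n. \<bar>spow (g n) (f n)\<bar>) \<longlongrightarrow> 0) F" using abs by (simp add: abs_spow)
    then show ?thesis using True by (simp add: tendsto_rabs_zero_iff spow_def)
  next
    case False
    have "((\<lambda>n. sgn (f n)) \<longlongrightarrow> sgn a) F" using a False by (intro tendsto_sgn) auto
    then show ?thesis unfolding spow_def using abs by (intro tendsto_mult)
  qed
qed

text \<open>
  With \<open>t = b / a\<close> the left-hand side is \<open>\<bar>a\<bar> powr r\<close> times the absolute value of
  \<open>|1 + t|^r - 1 - r t\<close>, which is \<open>o(t)\<close> at \<open>0\<close> and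
  \<open>O(|t|^r)\<close> away from \<open>0\<close>.  After integration both terms on the right are small compared with the
  norm of the increment, for every \<open>r > 1\<close>.
\<close>
lemma powr_first_order:
  fixes r \<eta> :: real
  assumes r: "1 < r" and \<eta>: "0 < \<eta>"
  shows "\<exists>C\<ge>0. \<forall>a b. \<bar>\<bar>a + b\<bar> powr r - \<bar>a\<bar> powr r - r * spow (r - 1) a * b\<bar>
    \<le> \<eta> * (\<bar>a\<bar> powr (r - 1) * \<bar>b\<bar>) + C * \<bar>b\<bar> powr r"
proof -
  have "((\<lambda>t. (1 + t) powr r) has_real_derivative r) (at 0)"
    by (auto intro!: derivative_eq_intros)
  then have "((\<lambda>t. ((1 + t) powr r - 1) / t) \<longlongrightarrow> r) (at 0)"
    by (simp add: DERIV_def del: has_field_derivative_def)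
  then have "eventually (\<lambda>t. dist (((1 + t) powr r - 1) / t) r < \<eta>) (at 0)"
    using \<eta> by (auto simp: tendsto_iff)
  then obtain d0 where d0: "d0 > 0"
    "\<And>t. t \<noteq> 0 \<Longrightarrow> \<bar>t\<bar> < d0 \<Longrightarrow> \<bar>((1 + t) powr r - 1) / t - r\<bar> < \<eta>"
    by (auto simp: eventually_at dist_real_def)
  define d where "d = min d0 1"
  have d: "d > 0" "d \<le> 1" "d \<le> d0" using d0 by (auto simp: d_def)
  define C where "C = (1 + 1 / d) powr r + (1 / d) powr r + r * (1 / d) powr (r - 1)"
  have C: "C \<ge> 1" 
  proof -
    have "(1 + 1 / d) powr r \<ge> 1" using d r by (intro ge_one_powr_ge_zero) auto
    then show ?thesis using r unfolding C_def by (smt (verit) mult_nonneg_nonneg powr_ge_zero)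
  qed
  have one: "\<bar>\<bar>1 + t\<bar> powr r - 1 - r * t\<bar> \<le> \<eta> * \<bar>t\<bar> + C * \<bar>t\<bar> powr r" for t
  proof (cases "\<bar>t\<bar> < d")
    case True
    show ?thesis
    proof (cases "t = 0")
      case False
      have "\<bar>((1 + t) powr r - 1) / t - r\<bar> * \<bar>t\<bar> \<le> \<eta> * \<bar>t\<bar>"
        using d0(2)[of t] True False d by (intro mult_right_mono) auto
      also have "\<bar>((1 + t) powr r - 1) / t - r\<bar> * \<bar>t\<bar> = \<bar>(1 + t) powr r - 1 - r * t\<bar>"
        using False by (simp add: abs_mult[symmetric] left_diff_distrib diff_divide_distrib)
      also have "(1 + t) powr r = \<bar>1 + t\<bar> powr r" using True d by auto
      finally show ?thesis using C by (smt (verit) mult_nonneg_nonneg powr_ge_zero)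
    qed auto
  next
    case False
    then have t: "1 \<le> \<bar>t\<bar> / d" using d by (simp add: field_simps)
    have "\<bar>1 + t\<bar> powr r \<le> ((1 + 1 / d) * \<bar>t\<bar>) powr r"
      using t r by (intro powr_mono2) (auto simp: algebra_simps abs_le_iff)
    then have 1: "\<bar>1 + t\<bar> powr r \<le> (1 + 1 / d) powr r * \<bar>t\<bar> powr r" using d by (simp add: powr_mult)
    have "1 \<le> (1 / d * \<bar>t\<bar>) powr r" using t r by (intro ge_one_powr_ge_zero) auto
    then have 2: "1 \<le> (1 / d) powr r * \<bar>t\<bar> powr r" using d by (subst (asm) powr_mult) auto
    have "1 \<le> (1 / d * \<bar>t\<bar>) powr (r - 1)" using t r by (intro ge_one_powr_ge_zero) auto
    then have "1 * \<bar>t\<bar> \<le> (1 / d * \<bar>t\<bar>) powr (r - 1) * \<bar>t\<bar>" by (intro mult_right_mono) auto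
    also have "\<dots> = (1 / d) powr (r - 1) * (\<bar>t\<bar> * \<bar>t\<bar> powr (r - 1))"
      using d by (subst powr_mult) auto
    also have "\<bar>t\<bar> * \<bar>t\<bar> powr (r - 1) = \<bar>t\<bar> powr r" using False d by (simp add: powr_mult_base)
    finally have "r * \<bar>t\<bar> \<le> r * ((1 / d) powr (r - 1) * \<bar>t\<bar> powr r)" using r by (intro mult_left_mono) auto
    then have 3: "\<bar>r * t\<bar> \<le> r * (1 / d) powr (r - 1) * \<bar>t\<bar> powr r" using r by (simp add: abs_mult)
    have "\<bar>\<bar>1 + t\<bar> powr r - 1 - r * t\<bar> \<le> \<bar>1 + t\<bar> powr r + 1 + \<bar>r * t\<bar>"
      using powr_ge_zero[of "\<bar>1 + t\<bar>" r] by linarith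
    also have "\<dots> \<le> C * \<bar>t\<bar> powr r" using 1 2 3 unfolding C_def distrib_right by linarith
    finally show ?thesis using \<eta> by (smt (verit) mult_nonneg_nonneg)
  qed
  show ?thesis
  proof (intro exI[of _ C] conjI allI)
    show "0 \<le> C" using C by simp
    fix a b :: real
    show "\<bar>\<bar>a + b\<bar> powr r - \<bar>a\<bar> powr r - r * spow (r - 1) a * b\<bar>
      \<le> \<eta> * (\<bar>a\<bar> powr (r - 1) * \<bar>b\<bar>) + C * \<bar>b\<bar> powr r"
    proof (cases "a = 0")
      case True
      then show ?thesis using C by (simp add: spow_def mult_right_mono[of 1 C "\<bar>b\<bar> powr r", simplified])
    next
      case False
      define t where "t = b / a"
      have b: "b = a * t" using False by (simp add: t_def)
      have 1: "\<bar>a + b\<bar> powr r = \<bar>a\<bar> powr r * \<bar>1 + t\<bar> powr r"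
        by (simp add: b powr_mult[symmetric] abs_mult[symmetric] distrib_left)
      have 2: "r * spow (r - 1) a * b = \<bar>a\<bar> powr r * (r * t)"
        using spow_mult_self[of r a] by (simp add: b algebra_simps)
      have 3: "\<bar>a\<bar> powr (r - 1) * \<bar>b\<bar> = \<bar>a\<bar> powr r * \<bar>t\<bar>"
        using powr_mult_base[of "\<bar>a\<bar>" "r - 1"] by (simp add: b abs_mult mult.commute)
      have 4: "\<bar>b\<bar> powr r = \<bar>a\<bar> powr r * \<bar>t\<bar> powr r" by (simp add: b abs_mult powr_mult)
      have "\<bar>\<bar>a + b\<bar> powr r - \<bar>a\<bar> powr r - r * spow (r - 1) a * b\<bar>
        = \<bar>a\<bar> powr r * \<bar>\<bar>1 + t\<bar> powr r - 1 - r * t\<bar>"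
        unfolding 1 2 using abs_mult[of "\<bar>a\<bar> powr r" "\<bar>1 + t\<bar> powr r - 1 - r * t"]
        by (simp add: right_diff_distrib)
      also have "\<dots> \<le> \<bar>a\<bar> powr r * (\<eta> * \<bar>t\<bar> + C * \<bar>t\<bar> powr r)"
        using one by (intro mult_left_mono) auto
      finally show ?thesis unfolding 3 4 by (simp add: algebra_simps)
    qed
  qed
qed

lemma powr_lipschitz_unit:
  fixes a b r :: real
  assumes "1 < r" "0 \<le> a" "a \<le> 1" "0 \<le> b" "b \<le> 1"
  shows "\<bar>a powr r - b powr r\<bar> \<le> r * \<bar>a - b\<bar>"
proof -
  have *: "\<bar>b powr r - a powr r\<bar> \<le> r * \<bar>b - a\<bar>" if ab: "a < b" "0 \<le> a" "b \<le> 1" for a b :: real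
  proof -
    obtain t where t: "a < t" "t < b" "b powr r - a powr r = (b - a) * (r * t powr (r - 1))"
      using powr_mean_value[of r a b] ab assms(1) by auto
    have "t powr (r - 1) \<le> 1 powr (r - 1)" using t ab assms by (intro powr_mono2) auto
    then have "(b - a) * (r * t powr (r - 1)) \<le> (b - a) * (r * 1)"
      using ab assms by (intro mult_left_mono) auto
    moreover have "0 \<le> (b - a) * (r * t powr (r - 1))" using ab assms by auto
    ultimately show ?thesis using t(3) ab by (simp add: mult.commute)
  qed
  show ?thesis using *[of a b] *[of b a] assms by (cases a b rule: linorder_cases) (auto simp: abs_minus_commute)
qed

text \<open>
  Truncation is monotone and 1-Lipschitz.  This is what makes the positive part an admissible test
  function that sees only its own energy.
\<close>
lemma spow_diff_pos_part:
  fixes a b r :: real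
  assumes "1 < r"
  shows "\<bar>max a 0 - max b 0\<bar> powr r \<le> spow (r - 1) (a - b) * (max a 0 - max b 0)"
proof -
  have *: "\<bar>max a 0 - max b 0\<bar> powr r \<le> spow (r - 1) (a - b) * (max a 0 - max b 0)" if "b < a" for a b :: real
  proof -
    define d where "d = max a 0 - max b 0"
    have d: "0 \<le> d" "d \<le> a - b" using that by (auto simp: d_def)
    have "\<bar>d\<bar> powr r = d powr (r - 1) * d" using d powr_mult_base[of d "r - 1"] by (simp add: mult.commute)
    also have "\<dots> \<le> (a - b) powr (r - 1) * d" using d assms by (intro mult_right_mono powr_mono2) auto
    also have "(a - b) powr (r - 1) = spow (r - 1) (a - b)" using that by (simp add: spow_def)
    finally show ?thesis by (simp add: d_def)
  qed
  show ?thesis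
  proof (cases a b rule: linorder_cases)
    case less
    have "spow (r - 1) (a - b) * (max a 0 - max b 0) = spow (r - 1) (b - a) * (max b 0 - max a 0)"
      using spow_minus[of "r - 1" "b - a"] by (simp add: algebra_simps)
    then show ?thesis using *[OF less] by (simp add: abs_minus_commute)
  qed (use * in auto)
qed

section \<open>Power integrals and Lebesgue spaces\<close>

definition Lr :: "'b measure \<Rightarrow> real \<Rightarrow> ('b \<Rightarrow> real) set" where
  "Lr M r = {f \<in> borel_measurable M. integrable M (\<lambda>x. \<bar>f x\<bar> powr r)}"

text \<open>
  The \<open>r\<close>-th power of the norm of \<open>L\<^sup>r\<close>.
\<close>
definition modular :: "'b measure \<Rightarrow> real \<Rightarrow> ('b \<Rightarrow> real) \<Rightarrow> real" where
  "modular M r f = (LINT x|M. \<bar>f x\<bar> powr r)"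

lemma Lr_measurable[measurable_dest]: "f \<in> Lr M r \<Longrightarrow> f \<in> borel_measurable M"
  by (simp add: Lr_def)

lemma Lr_integrable: "f \<in> Lr M r \<Longrightarrow> integrable M (\<lambda>x. \<bar>f x\<bar> powr r)"
  by (simp add: Lr_def)

lemma modular_nonneg [simp]: "0 \<le> modular M r f"
  by (simp add: modular_def)

lemma Lr_bound:
  assumes "g \<in> Lr M r" "f \<in> borel_measurable M" "AE x in M. \<bar>f x\<bar> \<le> \<bar>g x\<bar>" "0 \<le> r"
  shows "f \<in> Lr M r" "modular M r f \<le> modular M r g"
proof -
  have ae: "AE x in M. \<bar>f x\<bar> powr r \<le> \<bar>g x\<bar> powr r"
    using assms(3) by eventually_elim (use assms(4) in \<open>auto intro: powr_mono2\<close>)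
  have "integrable M (\<lambda>x. \<bar>f x\<bar> powr r)"
    by (rule Bochner_Integration.integrable_bound[OF Lr_integrable[OF assms(1)]]) (use assms(2) ae in auto)
  then show "f \<in> Lr M r" using assms(2) by (simp add: Lr_def)
  then show "modular M r f \<le> modular M r g"
    unfolding modular_def using ae assms(1) by (intro integral_mono_AE Lr_integrable) auto
qed

lemma Lr_add:
  assumes "f \<in> Lr M r" "g \<in> Lr M r" "0 < r"
  shows "(\<lambda>x. f x + g x) \<in> Lr M r"
    "modular M r (\<lambda>x. f x + g x) \<le> 2 powr r * (modular M r f + modular M r g)"
proof -
  note [measurable] = assms(1,2)[THEN Lr_measurable]
  note [simp] = assms(1,2)[THEN Lr_integrable]
  have "integrable M (\<lambda>x. \<bar>f x + g x\<bar> powr r)"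
    by (rule Bochner_Integration.integrable_bound[of _ "\<lambda>x. 2 powr r * (\<bar>f x\<bar> powr r + \<bar>g x\<bar> powr r)"])
      (use abs_powr_add_le[OF assms(3)] in auto)
  then show *: "(\<lambda>x. f x + g x) \<in> Lr M r" by (simp add: Lr_def)
  have "modular M r (\<lambda>x. f x + g x) \<le> (LINT x|M. 2 powr r * (\<bar>f x\<bar> powr r + \<bar>g x\<bar> powr r))"
    unfolding modular_def using abs_powr_add_le[OF assms(3)] *
    by (intro integral_mono Lr_integrable) auto
  then show "modular M r (\<lambda>x. f x + g x) \<le> 2 powr r * (modular M r f + modular M r g)"
    by (simp add: modular_def)
qed

lemma Lr_scale:
  assumes "f \<in> Lr M r"
  shows "(\<lambda>x. a * f x) \<in> Lr M r" "modular M r (\<lambda>x. a * f x) = \<bar>a\<bar> powr r * modular M r f"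
proof -
  have [measurable]: "f \<in> borel_measurable M" using assms by (rule Lr_measurable)
  show "(\<lambda>x. a * f x) \<in> Lr M r" "modular M r (\<lambda>x. a * f x) = \<bar>a\<bar> powr r * modular M r f"
    using Lr_integrable[OF assms] by (auto simp: Lr_def modular_def abs_mult powr_mult)
qed

lemma Lr_diff:
  assumes "f \<in> Lr M r" "g \<in> Lr M r" "0 < r"
  shows "(\<lambda>x. f x - g x) \<in> Lr M r"
    "modular M r (\<lambda>x. f x - g x) \<le> 2 powr r * (modular M r f + modular M r g)"
  using Lr_add[OF assms(1) Lr_scale(1)[OF assms(2)] assms(3), of "-1"] Lr_scale(2)[OF assms(2), of "-1"]
  by auto

lemma modular_eq_0_iff:
  assumes "f \<in> Lr M r"
  shows "modular M r f = 0 \<longleftrightarrow> (AE x in M. f x = 0)"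
  using integral_nonneg_eq_0_iff_AE[OF Lr_integrable[OF assms]] by (auto simp: modular_def)

lemma integrable_bounded_mult:
  fixes f g :: "'b \<Rightarrow> real"
  assumes f: "integrable M f" and [measurable]: "g \<in> borel_measurable M" and B: "\<And>x. \<bar>g x\<bar> \<le> B"
  shows "integrable M (\<lambda>x. g x * f x)"
proof (rule Bochner_Integration.integrable_bound[of _ "\<lambda>x. B * f x"])
  have "\<bar>g x\<bar> * \<bar>f x\<bar> \<le> \<bar>B\<bar> * \<bar>f x\<bar>" for x
    using B[of x] by (intro mult_right_mono) auto
  then show "AE x in M. norm (g x * f x) \<le> norm (B * f x)" by (simp add: abs_mult)
qed (use f in auto)

text \<open>
  Integrate the weighted arithmetic-geometric mean inequality for \<open>f\<close> and \<open>g\<close> divided by their integrals.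
\<close>
lemma holder_interpolation:
  fixes f g :: "'b \<Rightarrow> real" and \<alpha> :: real
  assumes f: "integrable M f" "\<And>x. 0 \<le> f x" and g: "integrable M g" "\<And>x. 0 \<le> g x"
    and \<alpha>: "0 < \<alpha>" "\<alpha> < 1"
  shows "integrable M (\<lambda>x. f x powr (1 - \<alpha>) * g x powr \<alpha>)"
    "(LINT x|M. f x powr (1 - \<alpha>) * g x powr \<alpha>) \<le> (LINT x|M. f x) powr (1 - \<alpha>) * (LINT x|M. g x) powr \<alpha>"
proof -
  have [measurable]: "f \<in> borel_measurable M" "g \<in> borel_measurable M" using f g by auto
  show int: "integrable M (\<lambda>x. f x powr (1 - \<alpha>) * g x powr \<alpha>)"
    by (rule Bochner_Integration.integrable_bound[of _ "\<lambda>x. (1 - \<alpha>) * f x + \<alpha> * g x"])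
      (use weighted_am_gm[OF f(2) g(2) \<alpha>] f g \<alpha> in \<open>auto simp: abs_mult intro!: order_trans[OF _ abs_ge_self]\<close>)
  define F G where "F = (LINT x|M. f x)" and "G = (LINT x|M. g x)"
  have FG: "F \<ge> 0" "G \<ge> 0" using f g by (auto simp: F_def G_def)
  show "(LINT x|M. f x powr (1 - \<alpha>) * g x powr \<alpha>) \<le> F powr (1 - \<alpha>) * G powr \<alpha>"
  proof (cases "F = 0 \<or> G = 0")
    case True
    then have "(AE x in M. f x = 0) \<or> (AE x in M. g x = 0)"
      using integral_nonneg_eq_0_iff_AE[OF f(1)] integral_nonneg_eq_0_iff_AE[OF g(1)] f g
      by (auto simp: F_def G_def)
    then have "AE x in M. f x powr (1 - \<alpha>) * g x powr \<alpha> = 0" by (auto elim: eventually_mono)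
    then have "(LINT x|M. f x powr (1 - \<alpha>) * g x powr \<alpha>) = 0" by (rule integral_eq_zero_AE)
    then show ?thesis by simp
  next
    case False
    then have pos: "F > 0" "G > 0" using FG by auto
    have "f x powr (1 - \<alpha>) * g x powr \<alpha>
      \<le> F powr (1 - \<alpha>) * G powr \<alpha> * ((1 - \<alpha>) * (f x / F) + \<alpha> * (g x / G))" for x
    proof -
      have "(f x / F) powr (1 - \<alpha>) * (g x / G) powr \<alpha> \<le> (1 - \<alpha>) * (f x / F) + \<alpha> * (g x / G)"
        using f g pos \<alpha> by (intro weighted_am_gm) auto
      then have "F powr (1 - \<alpha>) * G powr \<alpha> * ((f x / F) powr (1 - \<alpha>) * (g x / G) powr \<alpha>)
        \<le> F powr (1 - \<alpha>) * G powr \<alpha> * ((1 - \<alpha>) * (f x / F) + \<alpha> * (g x / G))"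
        by (intro mult_left_mono) auto
      then show ?thesis using f(2)[of x] g(2)[of x] pos by (simp add: powr_divide)
    qed
    then have "(LINT x|M. f x powr (1 - \<alpha>) * g x powr \<alpha>)
      \<le> (LINT x|M. F powr (1 - \<alpha>) * G powr \<alpha> * ((1 - \<alpha>) * (f x / F) + \<alpha> * (g x / G)))"
      using int f g by (intro integral_mono) auto
    also have "\<dots> = F powr (1 - \<alpha>) * G powr \<alpha> * ((1 - \<alpha>) * (F / F) + \<alpha> * (G / G))"
      using f g by (simp add: F_def G_def)
    also have "\<dots> = F powr (1 - \<alpha>) * G powr \<alpha>" using pos by simp
    finally show ?thesis .
  qed
qed

lemma holder_dual:
  assumes f: "f \<in> Lr M r" and g: "g \<in> Lr M r" and r: "1 < r"
  shows "integrable M (\<lambda>x. \<bar>f x\<bar> powr (r - 1) * \<bar>g x\<bar>)"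
    "(LINT x|M. \<bar>f x\<bar> powr (r - 1) * \<bar>g x\<bar>) \<le> modular M r f powr (1 - 1 / r) * modular M r g powr (1 / r)"
proof -
  have eq: "(\<lambda>x. \<bar>f x\<bar> powr (r - 1) * \<bar>g x\<bar>) =
      (\<lambda>x. (\<bar>f x\<bar> powr r) powr (1 - 1 / r) * (\<bar>g x\<bar> powr r) powr (1 / r))"
    using r by (simp add: powr_powr right_diff_distrib)
  show "integrable M (\<lambda>x. \<bar>f x\<bar> powr (r - 1) * \<bar>g x\<bar>)"
    unfolding eq using r by (intro holder_interpolation Lr_integrable f g) auto
  show "(LINT x|M. \<bar>f x\<bar> powr (r - 1) * \<bar>g x\<bar>) \<le> modular M r f powr (1 - 1 / r) * modular M r g powr (1 / r)"
    unfolding eq modular_def using r by (intro holder_interpolation(2) Lr_integrable f g) auto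
qed

lemma integrable_spow_mult:
  assumes "f \<in> Lr M r" "g \<in> Lr M r" "1 < r"
  shows "integrable M (\<lambda>x. spow (r - 1) (f x) * g x)"
proof -
  have [measurable]: "f \<in> borel_measurable M" "g \<in> borel_measurable M"
    using assms by (auto intro: Lr_measurable)
  show ?thesis
    by (rule Bochner_Integration.integrable_bound[OF holder_dual(1)[OF assms]]) (auto simp: abs_mult abs_spow)
qed

text \<open>
  Dominated convergence up to a small multiple of a sequence that is merely bounded in \<open>L\<^sup>1\<close>: the
  excess of \<open>f n\<close> over \<open>\<eta> * A n\<close> is dominated by \<open>G\<close>, so at most \<open>\<eta> * K\<close> survives in the limit.  The
  limits below involve sequences bounded in some \<open>L\<^sup>r\<close> without a common integrable majorant.
\<close>
lemma vanishing_integral: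
  fixes f :: "nat \<Rightarrow> 'b \<Rightarrow> real"
  assumes [measurable]: "\<And>n. f n \<in> borel_measurable M"
    and nn: "\<And>n x. 0 \<le> f n x"
    and lim: "AE x in M. (\<lambda>n. f n x) \<longlonglongrightarrow> 0"
    and A: "\<And>n. integrable M (A n)" "\<And>n x. 0 \<le> A n x" "\<And>n. (LINT x|M. A n x) \<le> K"
    and dom: "\<And>\<eta>. \<eta> > 0 \<Longrightarrow> \<exists>G. integrable M G \<and> (\<forall>n. AE x in M. f n x \<le> \<eta> * A n x + G x)"
  shows "(\<lambda>n. LINT x|M. f n x) \<longlonglongrightarrow> 0"
proof (rule LIMSEQ_I)
  fix e :: real assume e: "e > 0"
  have "0 \<le> (LINT x|M. A 0 x)" using A(2) by (intro integral_nonneg_AE) auto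
  with A(3)[of 0] have K: "0 \<le> K" by linarith
  define \<eta> where "\<eta> = e / (2 * (K + 1))"
  have \<eta>: "\<eta> > 0" "\<eta> * K \<le> e / 2"
    using e K by (auto simp: \<eta>_def field_simps)
  obtain G where G: "integrable M G" "\<And>n. AE x in M. f n x \<le> \<eta> * A n x + G x"
    using dom[OF \<eta>(1)] by blast
  have [measurable]: "G \<in> borel_measurable M" "A n \<in> borel_measurable M" for n using G A by auto
  define h where "h n x = max 0 (f n x - \<eta> * A n x)" for n x
  have [measurable]: "h n \<in> borel_measurable M" for n unfolding h_def by measurable
  have hG: "AE x in M. norm (h n x) \<le> \<bar>G x\<bar>" for n
    using G(2)[of n] by eventually_elim (auto simp: h_def)
  have hlim: "AE x in M. (\<lambda>n. h n x) \<longlonglongrightarrow> 0"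
    using lim
  proof eventually_elim
    case (elim x)
    show ?case
      by (rule tendsto_sandwich[OF _ _ tendsto_const elim])
        (use nn A(2) \<eta>(1) in \<open>auto simp: h_def\<close>)
  qed
  have "(\<lambda>n. LINT x|M. h n x) \<longlonglongrightarrow> (LINT x|M. 0)"
    by (rule integral_dominated_convergence[of _ _ _ "\<lambda>x. \<bar>G x\<bar>"]) (use G(1) hG hlim in auto)
  then have "\<forall>\<^sub>F n in sequentially. (LINT x|M. h n x) < e / 2"
    using e by (intro order_tendstoD(2)[of _ 0]) auto
  then obtain N where N: "\<And>n. n \<ge> N \<Longrightarrow> (LINT x|M. h n x) < e / 2"
    by (auto simp: eventually_sequentially)
  have hint: "integrable M (h n)" for n
    by (rule Bochner_Integration.integrable_bound[of _ "\<lambda>x. \<bar>G x\<bar>"]) (use G(1) hG[of n] in auto)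
  have le: "(LINT x|M. f n x) \<le> (LINT x|M. h n x) + e / 2" for n
  proof -
    have fle: "f n x \<le> h n x + \<eta> * A n x" for x by (simp add: h_def)
    have "integrable M (f n)"
      by (rule Bochner_Integration.integrable_bound[of _ "\<lambda>x. h n x + \<eta> * A n x"])
        (use fle nn hint A(1) in \<open>auto intro!: order_trans[OF _ abs_ge_self]\<close>)
    then have "(LINT x|M. f n x) \<le> (LINT x|M. h n x + \<eta> * A n x)"
      using hint A(1) fle by (intro integral_mono) auto
    also have "\<dots> = (LINT x|M. h n x) + \<eta> * (LINT x|M. A n x)" using hint A(1) by simp
    also have "\<eta> * (LINT x|M. A n x) \<le> \<eta> * K" using \<eta> A(3) by (intro mult_left_mono) auto
    finally show ?thesis using \<eta>(2) by linarith
  qed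
  have "norm ((LINT x|M. f n x) - 0) < e" if "n \<ge> N" for n
    using le[of n] N[OF that] integral_nonneg_AE[of "f n" M] nn by auto
  then show "\<exists>no. \<forall>n\<ge>no. norm ((LINT x|M. f n x) - 0) < e" by blast
qed

text \<open>
  Young's inequality with a small constant splits the product into a small multiple of the bounded
  sequence \<open>\<bar>f n\<bar> powr r\<close> and a fixed integrable function.
\<close>
lemma integral_tendsto_holder_dominated:
  fixes F :: "nat \<Rightarrow> 'b \<Rightarrow> real"
  assumes [measurable]: "\<And>n. F n \<in> borel_measurable M"
    and L: "integrable M L" and lim: "AE x in M. (\<lambda>n. F n x) \<longlonglongrightarrow> L x"
    and f: "\<And>n. f n \<in> Lr M r" "\<And>n. modular M r (f n) \<le> K" and g: "g \<in> Lr M r" and r: "1 < r"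
    and G: "integrable M G" "\<And>x. 0 \<le> G x"
    and dom: "\<And>n. AE x in M. \<bar>F n x\<bar> \<le> \<bar>f n x\<bar> powr (r - 1) * \<bar>g x\<bar> + G x"
  shows "(\<lambda>n. LINT x|M. F n x) \<longlonglongrightarrow> (LINT x|M. L x)"
proof -
  have [measurable]: "L \<in> borel_measurable M" "g \<in> borel_measurable M" "G \<in> borel_measurable M" 
     "f n \<in> borel_measurable M" for n
    using L g G f by (auto intro: Lr_measurable)
  have Fint: "integrable M (F n)" for n
    by (rule Bochner_Integration.integrable_bound[of _ "\<lambda>x. \<bar>f n x\<bar> powr (r - 1) * \<bar>g x\<bar> + G x"])
      (use holder_dual(1)[OF f(1)[of n] g r] G dom[of n] in \<open>auto elim!: eventually_mono\<close>)
  have "(\<lambda>n. LINT x|M. \<bar>F n x - L x\<bar>) \<longlonglongrightarrow> 0"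
  proof (rule vanishing_integral[where A = "\<lambda>n x. \<bar>f n x\<bar> powr r" and K = K])
    show "AE x in M. (\<lambda>n. \<bar>F n x - L x\<bar>) \<longlonglongrightarrow> 0"
      using lim by eventually_elim (simp add: LIM_zero tendsto_rabs_zero)
    show "(LINT x|M. \<bar>f n x\<bar> powr r) \<le> K" for n using f(2)[of n] by (simp add: modular_def)
    fix \<eta> :: real assume \<eta>: "\<eta> > 0"
    obtain C where C: "C \<ge> 0" "\<And>x y. 0 \<le> x \<Longrightarrow> 0 \<le> y \<Longrightarrow> x powr (r - 1) * y \<le> \<eta> * x powr r + C * y powr r"
      using young_small[OF r \<eta>] by blast
    show "\<exists>G'. integrable M G' \<and> (\<forall>n. AE x in M. \<bar>F n x - L x\<bar> \<le> \<eta> * \<bar>f n x\<bar> powr r + G' x)"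
    proof (intro exI[of _ "\<lambda>x. C * \<bar>g x\<bar> powr r + G x + \<bar>L x\<bar>"] conjI allI)
      show "integrable M (\<lambda>x. C * \<bar>g x\<bar> powr r + G x + \<bar>L x\<bar>)"
        using Lr_integrable[OF g] G L by auto
      fix n
      show "AE x in M. \<bar>F n x - L x\<bar> \<le> \<eta> * \<bar>f n x\<bar> powr r + (C * \<bar>g x\<bar> powr r + G x + \<bar>L x\<bar>)"
        using dom[of n]
      proof eventually_elim
        case (elim x)
        then show ?case using C(2)[of "\<bar>f n x\<bar>" "\<bar>g x\<bar>"] by linarith
      qed
    qed
  qed (use Lr_integrable[OF f(1)] in auto)
  moreover have "\<bar>(LINT x|M. F n x) - (LINT x|M. L x)\<bar> \<le> (LINT x|M. \<bar>F n x - L x\<bar>)" for n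
    using integral_abs_bound[of M "\<lambda>x. F n x - L x"] Fint L by simp
  ultimately have "(\<lambda>n. (LINT x|M. F n x) - (LINT x|M. L x)) \<longlonglongrightarrow> 0"
    by (auto intro: Lim_null_comparison[rotated])
  then show ?thesis by (simp add: LIM_zero_cancel)
qed

lemma Lr_fatou:
  fixes f :: "nat \<Rightarrow> 'b \<Rightarrow> real"
  assumes f: "\<And>n. f n \<in> Lr M r" "\<forall>\<^sub>F n in sequentially. modular M r (f n) \<le> K"
    and [measurable]: "g \<in> borel_measurable M"
    and lim: "AE x in M. (\<lambda>n. f n x) \<longlonglongrightarrow> g x" and r: "0 < r"
  shows "g \<in> Lr M r" "modular M r g \<le> K"
proof -
  have [measurable]: "f n \<in> borel_measurable M" for n using f(1) by (rule Lr_measurable)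
  have "\<forall>\<^sub>F n in sequentially. 0 \<le> K"
    using f(2) by eventually_elim (rule order_trans[OF modular_nonneg])
  then have K: "0 \<le> K" by simp
  have "(\<integral>\<^sup>+x. ennreal (\<bar>g x\<bar> powr r) \<partial>M) = (\<integral>\<^sup>+x. liminf (\<lambda>n. ennreal (\<bar>f n x\<bar> powr r)) \<partial>M)"
  proof (rule nn_integral_cong_AE)
    show "AE x in M. ennreal (\<bar>g x\<bar> powr r) = liminf (\<lambda>n. ennreal (\<bar>f n x\<bar> powr r))"
      using lim
    proof eventually_elim
      case (elim x)
      have "(\<lambda>n. ennreal (\<bar>f n x\<bar> powr r)) \<longlonglongrightarrow> ennreal (\<bar>g x\<bar> powr r)"
        using elim r by (intro tendsto_ennrealI tendsto_powr' tendsto_rabs tendsto_const) auto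
      then show ?case by (rule lim_imp_Liminf[symmetric, rotated]) simp
    qed
  qed
  also have "\<dots> \<le> liminf (\<lambda>n. \<integral>\<^sup>+x. ennreal (\<bar>f n x\<bar> powr r) \<partial>M)"
    by (rule nn_integral_liminf) simp
  also have "\<dots> = liminf (\<lambda>n. ennreal (modular M r (f n)))"
    using Lr_integrable[OF f(1)] by (simp add: modular_def nn_integral_eq_integral)
  also have "\<dots> \<le> ennreal K"
  proof -
    have "liminf (\<lambda>n. ennreal (modular M r (f n))) \<le> liminf (\<lambda>n. ennreal K)"
      by (rule Liminf_mono) (use f(2) in \<open>auto elim: eventually_mono intro: ennreal_leI\<close>)
    then show ?thesis by (simp add: Liminf_const)
  qed
  finally have fin: "(\<integral>\<^sup>+x. ennreal (\<bar>g x\<bar> powr r) \<partial>M) \<le> ennreal K" .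
  have "integrable M (\<lambda>x. \<bar>g x\<bar> powr r)"
    by (rule integrableI_bounded) (use fin in \<open>auto simp: less_top[symmetric] top_unique\<close>)
  then show "g \<in> Lr M r" by (simp add: Lr_def)
  then have "ennreal (modular M r g) \<le> ennreal K"
    using fin nn_integral_eq_integral[OF Lr_integrable[of g M r]] by (simp add: modular_def)
  then show "modular M r g \<le> K" using K by simp
qed

text \<open>
  The constant \<open>C\<close> is the same for all \<open>f\<close> and \<open>g\<close>, so the expansion yields directional derivatives (by
  scaling \<open>g\<close>) as well as Frechet derivatives.
\<close>
lemma modular_first_order:
  fixes M :: "'b measure"
  assumes "1 < r" "0 < \<eta>"
  shows "\<exists>C\<ge>0. \<forall>f\<in>Lr M r. \<forall>g\<in>Lr M r.
    \<bar>modular M r (\<lambda>x. f x + g x) - modular M r f - r * (LINT x|M. spow (r - 1) (f x) * g x)\<bar>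
     \<le> \<eta> * (modular M r f powr (1 - 1 / r) * modular M r g powr (1 / r)) + C * modular M r g"
proof -
  obtain C where C: "C \<ge> 0" "\<And>a b. \<bar>\<bar>a + b\<bar> powr r - \<bar>a\<bar> powr r - r * spow (r - 1) a * b\<bar>
    \<le> \<eta> * (\<bar>a\<bar> powr (r - 1) * \<bar>b\<bar>) + C * \<bar>b\<bar> powr r"
    using powr_first_order[OF assms] by blast
  show ?thesis
  proof (intro exI[of _ C] conjI ballI C(1))
    fix f g assume fg: "f \<in> Lr M r" "g \<in> Lr M r"
    have int: "integrable M (\<lambda>x. \<bar>f x + g x\<bar> powr r)" "integrable M (\<lambda>x. \<bar>f x\<bar> powr r)"
      "integrable M (\<lambda>x. \<bar>g x\<bar> powr r)" "integrable M (\<lambda>x. spow (r - 1) (f x) * g x)"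
      "integrable M (\<lambda>x. \<bar>f x\<bar> powr (r - 1) * \<bar>g x\<bar>)"
      using fg Lr_add(1)[OF fg] assms integrable_spow_mult[OF fg] holder_dual(1)[OF fg] by (auto dest: Lr_integrable)
    have eq: "modular M r (\<lambda>x. f x + g x) - modular M r f - r * (LINT x|M. spow (r - 1) (f x) * g x)
      = (LINT x|M. \<bar>f x + g x\<bar> powr r - \<bar>f x\<bar> powr r - r * (spow (r - 1) (f x) * g x))"
      using int by (simp add: modular_def)
    have "\<bar>modular M r (\<lambda>x. f x + g x) - modular M r f - r * (LINT x|M. spow (r - 1) (f x) * g x)\<bar> \<le> (LINT x|M. \<bar>\<bar>f x + g x\<bar> powr r - \<bar>f x\<bar> powr r - r * (spow (r - 1) (f x) * g x)\<bar>)"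
      unfolding eq by (rule integral_abs_bound)
    also have "\<dots> \<le> (LINT x|M. \<eta> * (\<bar>f x\<bar> powr (r - 1) * \<bar>g x\<bar>) + C * \<bar>g x\<bar> powr r)"
      using int C(2) by (intro integral_mono) (auto simp: mult.assoc)
    also have "\<dots> = \<eta> * (LINT x|M. \<bar>f x\<bar> powr (r - 1) * \<bar>g x\<bar>) + C * modular M r g"
      using int by (simp add: modular_def)
    also have "\<dots> \<le> \<eta> * (modular M r f powr (1 - 1 / r) * modular M r g powr (1 / r)) + C * modular M r g"
      using holder_dual(2)[OF fg] assms by (intro add_right_mono mult_left_mono) auto
    finally show "\<bar>modular M r (\<lambda>x. f x + g x) - modular M r f - r * (LINT x|M. spow (r - 1) (f x) * g x)\<bar>
     \<le> \<eta> * (modular M r f powr (1 - 1 / r) * modular M r g powr (1 / r)) + C * modular M r g" .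
  qed
qed

text \<open>
  The defect \<open>|f|^q - |f - g|^q - |g|^q\<close> tends to \<open>0\<close> almost everywhere, and by the pointwise inequality
  it is dominated up to a small multiple of \<open>|f - g|^q\<close>.  The exponent may vary with \<open>n\<close>.
\<close>
lemma brezis_lieb:
  fixes f :: "nat \<Rightarrow> 'b \<Rightarrow> real" and q :: "nat \<Rightarrow> real"
  assumes q: "\<And>n. 0 < q n" "\<And>n. q n \<le> Q" "q \<longlonglongrightarrow> q0" "0 < q0"
    and f: "\<And>n. f n \<in> Lr M (q n)" and g: "\<And>n. g \<in> Lr M (q n)"
    and lim: "AE x in M. (\<lambda>n. f n x) \<longlonglongrightarrow> g x"
    and K: "\<And>n. modular M (q n) (\<lambda>x. f n x - g x) \<le> K"
    and G: "integrable M G" "\<And>n x. \<bar>g x\<bar> powr q n \<le> G x"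
  shows "(\<lambda>n. modular M (q n) (f n) - modular M (q n) (\<lambda>x. f n x - g x) - modular M (q n) g) \<longlonglongrightarrow> 0"
proof -
  have Q: "0 < Q" using q(1,2)[of 0] by linarith
  have [measurable]: "g \<in> borel_measurable M" "f n \<in> borel_measurable M" for n
    using f g by (auto intro: Lr_measurable)
  have w: "(\<lambda>x. f n x - g x) \<in> Lr M (q n)" for n using Lr_diff(1)[OF f g q(1)] by simp
  define h where "h n x = \<bar>f n x\<bar> powr q n - \<bar>f n x - g x\<bar> powr q n - \<bar>g x\<bar> powr q n" for n x
  have hint: "integrable M (h n)" for n
    unfolding h_def using Lr_integrable[OF f[of n]] Lr_integrable[OF g[of n]] Lr_integrable[OF w[of n]] by auto
  have "(\<lambda>n. LINT x|M. \<bar>h n x\<bar>) \<longlonglongrightarrow> 0"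
  proof (rule vanishing_integral[where A = "\<lambda>n x. \<bar>f n x - g x\<bar> powr q n" and K = K])
    show "(LINT x|M. \<bar>f n x - g x\<bar> powr q n) \<le> K" for n using K[of n] by (simp add: modular_def)
    show "AE x in M. (\<lambda>n. \<bar>h n x\<bar>) \<longlonglongrightarrow> 0"
      using lim
    proof eventually_elim
      case (elim x)
      have 1: "(\<lambda>n. \<bar>f n x\<bar> powr q n) \<longlonglongrightarrow> \<bar>g x\<bar> powr q0"
        using elim q by (intro tendsto_powr' tendsto_rabs) auto
      have 2: "(\<lambda>n. \<bar>g x\<bar> powr q n) \<longlonglongrightarrow> \<bar>g x\<bar> powr q0"
        using elim q by (intro tendsto_powr' tendsto_const) auto
      have 3: "(\<lambda>n. \<bar>f n x - g x\<bar> powr q n) \<longlonglongrightarrow> 0 powr q0"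
        using elim q by (intro tendsto_powr' tendsto_rabs_zero LIM_zero) auto
      show ?case unfolding h_def using tendsto_rabs[OF tendsto_diff[OF tendsto_diff[OF 1 3] 2]] by simp
    qed
    fix \<eta> :: real assume \<eta>: "\<eta> > 0"
    obtain C where C: "C \<ge> 0" "\<And>q a b. 0 < q \<Longrightarrow> q \<le> Q \<Longrightarrow>
      \<bar>\<bar>a + b\<bar> powr q - \<bar>a\<bar> powr q\<bar> \<le> \<eta> * \<bar>a\<bar> powr q + C * \<bar>b\<bar> powr q"
      using brezis_lieb_pointwise[OF Q \<eta>] by blast
    show "\<exists>G. integrable M G \<and> (\<forall>n. AE x in M. \<bar>h n x\<bar> \<le> \<eta> * \<bar>f n x - g x\<bar> powr q n + G x)"
    proof (intro exI[of _ "\<lambda>x. (C + 1) * G x"] conjI allI AE_I2)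
      show "integrable M (\<lambda>x. (C + 1) * G x)" using G by simp
      fix n x
      have "\<bar>\<bar>f n x\<bar> powr q n - \<bar>f n x - g x\<bar> powr q n\<bar>
        \<le> \<eta> * \<bar>f n x - g x\<bar> powr q n + C * \<bar>g x\<bar> powr q n"
        using C(2)[OF q(1)[of n] q(2)[of n], of "f n x - g x" "g x"] by simp
      then have "\<bar>h n x\<bar> \<le> \<eta> * \<bar>f n x - g x\<bar> powr q n + (C + 1) * \<bar>g x\<bar> powr q n"
        unfolding h_def distrib_right using powr_ge_zero[of "\<bar>g x\<bar>" "q n"] by linarith
      also have "(C + 1) * \<bar>g x\<bar> powr q n \<le> (C + 1) * G x" using C G by (intro mult_left_mono) auto
      finally show "\<bar>h n x\<bar> \<le> \<eta> * \<bar>f n x - g x\<bar> powr q n + (C + 1) * G x" by simp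
    qed
  qed (use Lr_integrable[OF w] in \<open>auto simp: h_def\<close>)
  then have "(\<lambda>n. LINT x|M. h n x) \<longlonglongrightarrow> 0"
    by (rule Lim_null_comparison[rotated]) (use integral_abs_bound[of M] in \<open>auto intro!: always_eventually\<close>)
  moreover have "(LINT x|M. h n x) = modular M (q n) (f n) - modular M (q n) (\<lambda>x. f n x - g x) - modular M (q n) g" for n
    unfolding h_def modular_def using Lr_integrable[OF f[of n]] Lr_integrable[OF g[of n]] Lr_integrable[OF w[of n]] by simp
  ultimately show ?thesis by simp
qed

lemma modular_uniform_convexity:
  fixes M :: "'b measure"
  assumes "1 < r" "0 < \<eta>"
  shows "\<exists>C\<ge>0. \<forall>f\<in>Lr M r. \<forall>g\<in>Lr M r. modular M r (\<lambda>x. f x - g x) \<le> \<eta> * (modular M r f + modular M r g)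
    + C * ((modular M r f + modular M r g) / 2 - modular M r (\<lambda>x. (f x + g x) / 2))"
proof -
  obtain C where C: "C \<ge> 0" "\<And>a b. \<bar>a - b\<bar> powr r \<le> \<eta> * (\<bar>a\<bar> powr r + \<bar>b\<bar> powr r)
      + C * ((\<bar>a\<bar> powr r + \<bar>b\<bar> powr r) / 2 - \<bar>(a + b) / 2\<bar> powr r)"
    using uniform_convexity_pointwise[OF assms] by blast
  show ?thesis
  proof (intro exI[of _ C] conjI ballI C(1))
    fix f g assume fg: "f \<in> Lr M r" "g \<in> Lr M r"
    have "(\<lambda>x. 1 / 2 * (f x + g x)) \<in> Lr M r" using fg assms by (intro Lr_scale Lr_add) auto
    then have m: "(\<lambda>x. (f x + g x) / 2) \<in> Lr M r" by simp
    have int: "integrable M (\<lambda>x. \<bar>f x - g x\<bar> powr r)" "integrable M (\<lambda>x. \<bar>f x\<bar> powr r)"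
      "integrable M (\<lambda>x. \<bar>g x\<bar> powr r)" "integrable M (\<lambda>x. \<bar>(f x + g x) / 2\<bar> powr r)"
      using fg Lr_diff(1)[OF fg] assms Lr_integrable[OF m] by (auto dest: Lr_integrable)
    have "modular M r (\<lambda>x. f x - g x) \<le> (LINT x|M. \<eta> * (\<bar>f x\<bar> powr r + \<bar>g x\<bar> powr r)
      + C * ((\<bar>f x\<bar> powr r + \<bar>g x\<bar> powr r) / 2 - \<bar>(f x + g x) / 2\<bar> powr r))"
      unfolding modular_def using int C(2) by (intro integral_mono) auto
    also have "\<dots> = \<eta> * (modular M r f + modular M r g)
    + C * ((modular M r f + modular M r g) / 2 - modular M r (\<lambda>x. (f x + g x) / 2))"
      unfolding modular_def using int by simp
    finally show "modular M r (\<lambda>x. f x - g x) \<le> \<eta> * (modular M r f + modular M r g)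
    + C * ((modular M r f + modular M r g) / 2 - modular M r (\<lambda>x. (f x + g x) / 2))" .
  qed
qed

section \<open>The fractional Sobolev space and Lipschitz cut-offs\<close>

text \<open>
  This difference quotient is linear in \<open>u\<close>, and the \<open>p\<close>-th power of its absolute value is the Gagliardo
  kernel.  It embeds the Sobolev space into \<open>L\<^sup>p\<close> of the product space, to which the results on power
  integrals apply.
\<close>
definition hquot :: "real \<Rightarrow> real \<Rightarrow> ('a::euclidean_space \<Rightarrow> real) \<Rightarrow> 'a \<times> 'a \<Rightarrow> real" where
  "hquot s p u z = (u (fst z) - u (snd z)) / norm (fst z - snd z) powr ((real DIM('a) + p * s) / p)"

abbreviation pairs :: "('a::euclidean_space \<times> 'a) measure" where
  "pairs \<equiv> lborel \<Otimes>\<^sub>M lborel"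

abbreviation energy_pow :: "real \<Rightarrow> real \<Rightarrow> ('a::euclidean_space \<Rightarrow> real) \<Rightarrow> real" where
  "energy_pow s p u \<equiv> modular pairs p (hquot s p u)"

lemma borel_measurable_hquot[measurable]:
  fixes u :: "'a::euclidean_space \<Rightarrow> real"
  assumes [measurable]: "u \<in> borel_measurable lborel"
  shows "hquot s p u \<in> borel_measurable pairs"
  unfolding hquot_def by measurable

lemma gagliardo_kernel_eq_hquot:
  assumes "0 < p"
  shows "gagliardo_kernel s p u x y = \<bar>hquot s p u (x, y)\<bar> powr p"
  using assms by (simp add: gagliardo_kernel_def hquot_def abs_divide powr_divide powr_powr)

lemma gagliardo_pow_eq_energy_pow:
  assumes "0 < p"
  shows "gagliardo_pow s p u = energy_pow s p u"
  using assms by (simp add: gagliardo_pow_def modular_def gagliardo_kernel_eq_hquot)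

lemma hquot_add: "hquot s p (\<lambda>x. u x + v x) = (\<lambda>z. hquot s p u z + hquot s p v z)"
  and hquot_diff: "hquot s p (\<lambda>x. u x - v x) = (\<lambda>z. hquot s p u z - hquot s p v z)"
  and hquot_scale: "hquot s p (\<lambda>x. a * u x) = (\<lambda>z. a * hquot s p u z)"
  by (auto simp: hquot_def fun_eq_iff add_divide_distrib[symmetric] diff_divide_distrib[symmetric]
      right_diff_distrib[symmetric])

text \<open>
  Leibniz rule.  The second term is the commutator with the cut-off.
\<close>
lemma hquot_mult:
  "hquot s p (\<lambda>x. \<eta> x * u x) z = \<eta> (fst z) * hquot s p u z + u (snd z) * hquot s p \<eta> z"
  unfolding hquot_def by (simp add: add_divide_distrib[symmetric] algebra_simps)

lemma abs_hquot_mono: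
  assumes "\<bar>u (fst z) - u (snd z)\<bar> \<le> \<bar>v (fst z) - v (snd z)\<bar>"
  shows "\<bar>hquot s p u z\<bar> \<le> \<bar>hquot s p v z\<bar>"
  using assms by (simp add: hquot_def abs_divide divide_right_mono)

lemma AE_pairs_fst_snd:
  assumes "AE x in lborel. Q (x :: 'a::euclidean_space)"
  shows "AE z in pairs. Q (fst z)" "AE z in pairs. Q (snd z)"
proof -
  obtain A where A: "{x \<in> space lborel. \<not> Q x} \<subseteq> A" "emeasure lborel A = 0" "A \<in> sets lborel"
    using assms by (rule AE_E)
  have 1: "A \<times> UNIV \<in> null_sets (pairs :: ('a \<times> 'a) measure)"
    using A by (auto simp: null_sets_def lborel.emeasure_pair_measure_Times
        simp del: emeasure_lborel_UNIV intro!: pair_measureI)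
  have 2: "UNIV \<times> A \<in> null_sets (pairs :: ('a \<times> 'a) measure)"
    using A by (auto simp: null_sets_def lborel.emeasure_pair_measure_Times
        simp del: emeasure_lborel_UNIV intro!: pair_measureI)
  show "AE z in pairs. Q (fst z)" by (rule AE_I'[OF 1]) (use A in auto)
  show "AE z in pairs. Q (snd z)" by (rule AE_I'[OF 2]) (use A in auto)
qed

lemma AE_hquot_tendsto:
  fixes u :: "nat \<Rightarrow> 'a::euclidean_space \<Rightarrow> real"
  assumes "AE x in lborel. (\<lambda>n. u n x) \<longlonglongrightarrow> v x"
  shows "AE z in pairs. (\<lambda>n. hquot s p (u n) z) \<longlonglongrightarrow> hquot s p v z"
  using AE_pairs_fst_snd[OF assms]
proof eventually_elim
  case (elim z)
  show ?case
  proof (cases "fst z = snd z")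
    case True
    then show ?thesis by (simp add: hquot_def)
  next
    case False
    then show ?thesis unfolding hquot_def by (intro tendsto_divide tendsto_diff tendsto_const elim) auto
  qed
qed

lemma ball_series_integral_finite:
  fixes a r :: "nat \<Rightarrow> real"
  assumes a: "\<And>k. 0 \<le> a k" and r: "\<And>k. 0 \<le> r k" and \<rho>: "0 \<le> \<rho>" "\<rho> < 1"
    and eq: "\<And>k. a k * r k ^ DIM('a) \<le> C * \<rho> ^ k"
  shows "(\<integral>\<^sup>+z. (\<Sum>k. ennreal (a k) * indicator (ball 0 (r k)) (z :: 'a::euclidean_space)) \<partial>lborel) < \<infinity>"
proof -
  define V where "V = measure lborel (ball (0 :: 'a) 1)"
  have ind: "(indicator (ball 0 (r k)) :: 'a \<Rightarrow> ennreal) \<in> borel_measurable lborel" for k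
    by (rule borel_measurable_indicator) simp
  have "0 \<le> a 0 * r 0 ^ DIM('a)" using a r by simp
  with eq[of 0] have C: "0 \<le> C" by simp
  have "(\<integral>\<^sup>+z. (\<Sum>k. ennreal (a k) * indicator (ball 0 (r k)) (z :: 'a)) \<partial>lborel)
    = (\<Sum>k. \<integral>\<^sup>+z. ennreal (a k) * indicator (ball 0 (r k)) (z :: 'a) \<partial>lborel)"
    by (intro nn_integral_suminf borel_measurable_times_ennreal borel_measurable_const ind)
  also have "\<dots> = (\<Sum>k. ennreal (a k) * emeasure lborel (ball (0::'a) (r k)))"
    using ind by (simp add: nn_integral_cmult)
  also have "\<dots> \<le> (\<Sum>k. ennreal (V * (C * \<rho> ^ k)))"
  proof (intro suminf_le)
    fix k
    have "emeasure lborel (ball (0::'a) (r k)) = ennreal (r k ^ DIM('a) * V)"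
      using content_ball_conv_unit_ball[OF r[of k], of "0::'a"] emeasure_lborel_ball_finite[of "0::'a" "r k"]
      by (simp add: emeasure_eq_ennreal_measure V_def less_top)
    then have "ennreal (a k) * emeasure lborel (ball (0::'a) (r k)) = ennreal (V * (a k * r k ^ DIM('a)))"
      using a r by (simp add: ennreal_mult[symmetric] V_def mult_ac)
    also have "\<dots> \<le> ennreal (V * (C * \<rho> ^ k))"
      using eq[of k] by (intro ennreal_leI mult_left_mono) (auto simp: V_def)
    finally show "ennreal (a k) * emeasure lborel (ball (0::'a) (r k)) \<le> ennreal (V * (C * \<rho> ^ k))" .
  qed auto
  also have "\<dots> = ennreal (V * (C * (1 / (1 - \<rho>))))"
    using C \<rho> by (intro suminf_ennreal_eq sums_mult geometric_sums) (auto simp: V_def)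
  also have "\<dots> < \<infinity>" by simp
  finally show ?thesis .
qed

lemma dyadic_bracket:
  fixes t :: real
  assumes "1 \<le> t"
  shows "\<exists>k::nat. 2 ^ k \<le> t \<and> t < 2 ^ Suc k"
proof -
  obtain n where n: "t < 2 ^ n" using real_arch_pow[of 2 t] by auto
  define m where "m = (LEAST n. t < 2 ^ n)"
  have m: "t < 2 ^ m" unfolding m_def using n by (rule LeastI)
  then obtain k where k: "m = Suc k" using assms by (cases m) auto
  have "\<not> t < 2 ^ k" using not_less_Least[of k "\<lambda>n. t < 2 ^ n"] k unfolding m_def by auto
  then show ?thesis using m k by (intro exI[of _ k]) auto
qed

text \<open>
  The annulus \<open>|z| \<sim> 2^(-k)\<close> contributes at most a multiple of \<open>2^(- k p (1 - s))\<close>, the annulus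
  \<open>|z| \<sim> 2^k\<close> a multiple of \<open>2^(- k p s)\<close>.  Both geometric series converge because \<open>0 < s < 1\<close>.
\<close>
lemma singular_kernel_integrable:
  assumes s: "0 < s" "s < 1" and p: "1 < p"
  shows "(\<integral>\<^sup>+z. ennreal (min 1 (norm z) powr p / norm z powr (real DIM('a) + p * s))
    \<partial>(lborel :: 'a::euclidean_space measure)) < \<infinity>"
proof -
  define N where "N = real DIM('a)"
  define a where "a k = (1/2 :: real) powr (real k * p) * 2 powr ((real k + 1) * (N + p * s))" for k :: nat
  define b where "b k = (1/2 :: real) powr (real k * (N + p * s))" for k :: nat
  have ps: "0 < p * s" "p * s < p" using s p by auto
  define R1 R2 where "R1 k = 2 * (1/2 :: real) ^ k" and "R2 k = 2 * (2::real) ^ k" for k :: nat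
  have powN: "x ^ DIM('a) = x powr N" if "x > 0" for x :: real using that by (simp add: N_def powr_realpow)
  have half: "(1/2 :: real) powr x = 2 powr - x" for x using powr_minus_divide[of 2 x] powr_divide[of 1 2 x] by simp
  have R1: "R1 k = 2 powr (1 - real k)" and R2: "R2 k = 2 powr (1 + real k)" for k
    by (auto simp: R1_def R2_def powr_diff powr_add powr_realpow power_divide)
  have fin1: "(\<integral>\<^sup>+z. (\<Sum>k. ennreal (a k) * indicator (ball 0 (R1 k)) (z :: 'a)) \<partial>lborel) < \<infinity>"
  proof (rule ball_series_integral_finite[where \<rho> = "2 powr (p * s - p)" and C = "2 powr (2 * N + p * s)"])
    show "2 powr (p * s - p) < 1" using ps powr_less_mono[of "p * s - p" 0 2] by simp
    fix k
    have "a k * R1 k ^ DIM('a) = 2 powr (- (real k * p)) * 2 powr ((real k + 1) * (N + p * s)) * 2 powr ((1 - real k) * N)"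
      by (subst powN) (auto simp: R1 a_def half powr_powr)
    also have "\<dots> = 2 powr (2 * N + p * s + real k * (p * s - p))"
      by (simp add: powr_add[symmetric] algebra_simps)
    also have "\<dots> = 2 powr (2 * N + p * s) * (2 powr (p * s - p)) ^ k"
      by (simp add: powr_add powr_realpow[symmetric] powr_powr mult.commute)
    finally show "a k * R1 k ^ DIM('a) \<le> 2 powr (2 * N + p * s) * (2 powr (p * s - p)) ^ k" by simp
  qed (auto simp: a_def R1)
  have fin2: "(\<integral>\<^sup>+z. (\<Sum>k. ennreal (b k) * indicator (ball 0 (R2 k)) (z :: 'a)) \<partial>lborel) < \<infinity>"
  proof (rule ball_series_integral_finite[where \<rho> = "2 powr (- p * s)" and C = "2 powr N"])
    show "2 powr (- p * s) < 1" using ps powr_less_mono[of "- p * s" 0 2] by simp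
    fix k
    have "b k * R2 k ^ DIM('a) = 2 powr (- (real k * (N + p * s))) * 2 powr ((1 + real k) * N)"
      by (subst powN) (auto simp: R2 b_def half powr_powr)
    also have "\<dots> = 2 powr (N + real k * (- p * s))"
      by (simp add: powr_add[symmetric] algebra_simps)
    also have "\<dots> = 2 powr N * 2 powr (real k * (- p * s))" by (rule powr_add)
    also have "2 powr (real k * (- p * s)) = (2 powr (- p * s)) ^ k"
      by (simp add: powr_realpow[symmetric] powr_powr mult.commute)
    finally show "b k * R2 k ^ DIM('a) \<le> 2 powr N * (2 powr (- p * s)) ^ k" by simp
  qed (auto simp: b_def R2)
  have meas: "(\<lambda>z :: 'a. \<Sum>k. ennreal (c k) * indicator (ball 0 (R k)) z) \<in> borel_measurable borel" for c R
    by (intro borel_measurable_suminf_order borel_measurable_times_ennreal borel_measurable_const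
        borel_measurable_indicator) simp
  have single: "f k \<le> (\<Sum>k. f k)" for f :: "nat \<Rightarrow> ennreal" and k
    using sum_le_suminf[of f "{k}"] by auto
  have "(\<integral>\<^sup>+z. ennreal (min 1 (norm z) powr p / norm z powr (N + p * s)) \<partial>(lborel :: 'a measure))
    \<le> (\<integral>\<^sup>+z. (\<Sum>k. ennreal (a k) * indicator (ball 0 (R1 k)) (z :: 'a))
        + (\<Sum>k. ennreal (b k) * indicator (ball 0 (R2 k)) (z :: 'a)) \<partial>lborel)"
  proof (intro nn_integral_mono)
    fix z :: 'a
    let ?h = "min 1 (norm z) powr p / norm z powr (N + p * s)"
    consider "z = 0" | "0 < norm z" "norm z < 1" | "1 \<le> norm z" by (cases "z = 0") force+
    then show "ennreal ?h \<le> (\<Sum>k. ennreal (a k) * indicator (ball 0 (R1 k)) z)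
        + (\<Sum>k. ennreal (b k) * indicator (ball 0 (R2 k)) z)"
    proof cases
      case 1
      then show ?thesis by simp
    next
      case 2
      then obtain k where k: "2 ^ k \<le> 1 / norm z" "1 / norm z < 2 ^ Suc k"
        using dyadic_bracket[of "1 / norm z"] by auto
      have up: "norm z \<le> 2 powr (- real k)"
        using k(1) 2 by (simp add: powr_minus powr_realpow field_simps)
      have lo: "2 powr (- (real k + 1)) \<le> norm z"
      proof -
        have "2 powr (real k + 1) = 2 ^ Suc k" by (simp add: powr_add powr_realpow)
        then have "1 < norm z * 2 powr (real k + 1)" using k(2) 2 by (simp add: field_simps)
        then show ?thesis unfolding powr_minus by (simp add: field_simps)
      qed
      have "min 1 (norm z) powr p \<le> (2 powr (- real k)) powr p" using up p by (intro powr_mono2) auto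
      moreover have "(2 powr (- (real k + 1))) powr (N + p * s) \<le> norm z powr (N + p * s)"
        using lo ps by (intro powr_mono2) (auto simp: N_def)
      ultimately have "?h \<le> (2 powr (- real k)) powr p / (2 powr (- (real k + 1))) powr (N + p * s)"
        by (intro frac_le) auto
      also have "\<dots> = a k" by (simp add: a_def half powr_powr divide_powr_uminus algebra_simps powr_add[symmetric])
      finally have "ennreal ?h \<le> ennreal (a k) * indicator (ball 0 (R1 k)) z"
      proof -
        assume "?h \<le> a k"
        moreover have "norm z < R1 k"
        proof -
          have "2 powr (- real k) < 2 powr (1 - real k)" by simp
          then show ?thesis using up R1[of k] by (simp only: order_le_less_trans)
        qed
        ultimately show ?thesis by (simp add: ennreal_leI)
      qed
      also have "\<dots> \<le> (\<Sum>k. ennreal (a k) * indicator (ball 0 (R1 k)) z)" by (rule single)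
      finally show ?thesis by (rule order_trans) simp
    next
      case 3
      then obtain k where k: "2 ^ k \<le> norm z" "norm z < 2 ^ Suc k" using dyadic_bracket by blast
      have "(2 powr real k) powr (N + p * s) \<le> norm z powr (N + p * s)"
        using k(1) ps by (intro powr_mono2) (auto simp: N_def powr_realpow)
      then have "?h \<le> 1 / (2 powr real k) powr (N + p * s)"
        using 3 by (intro frac_le) auto
      also have "\<dots> = b k" using powr_minus_divide[of 2 "real k * (N + p * s)"] by (simp add: b_def half powr_powr)
      finally have "ennreal ?h \<le> ennreal (b k) * indicator (ball 0 (R2 k)) z"
        using k(2) by (simp add: R2_def ennreal_leI)
      also have "\<dots> \<le> (\<Sum>k. ennreal (b k) * indicator (ball 0 (R2 k)) z)" by (rule single)
      finally show ?thesis by (rule order_trans) simp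
    qed
  qed
  also have "\<dots> = (\<integral>\<^sup>+z. (\<Sum>k. ennreal (a k) * indicator (ball 0 (R1 k)) (z :: 'a)) \<partial>lborel)
      + (\<integral>\<^sup>+z. (\<Sum>k. ennreal (b k) * indicator (ball 0 (R2 k)) (z :: 'a)) \<partial>lborel)"
    by (intro nn_integral_add; simp add: meas)
  also have "\<dots> < \<infinity>" using fin1 fin2 by (simp add: less_top)
  finally show ?thesis by (simp add: N_def)
qed

lemma nn_integral_lborel_translate:
  fixes f :: "'a::euclidean_space \<Rightarrow> ennreal"
  assumes [measurable]: "f \<in> borel_measurable borel"
  shows "(\<integral>\<^sup>+x. f (x - y) \<partial>lborel) = (\<integral>\<^sup>+x. f x \<partial>lborel)"
proof -
  have "(\<integral>\<^sup>+x. f x \<partial>lborel) = (\<integral>\<^sup>+x. f x \<partial>distr lborel borel ((+) (- y)))"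
    by (simp add: lborel_distr_plus)
  also have "\<dots> = (\<integral>\<^sup>+x. f (- y + x) \<partial>lborel)" by (rule nn_integral_distr) auto
  finally show ?thesis by simp
qed

text \<open>
  A bounded Lipschitz function satisfies \<open>|\<eta> x - \<eta> y| \<le> D min 1 |x - y|\<close>, so the integral over \<open>x\<close>
  is bounded by that of the translated kernel of \<open>singular_kernel_integrable\<close>, uniformly in \<open>y\<close>.
\<close>
lemma cutoff_commutator:
  fixes \<eta> :: "'a::euclidean_space \<Rightarrow> real"
  assumes s: "0 < s" "s < 1" and p: "1 < p"
    and L: "\<And>x y. \<bar>\<eta> x - \<eta> y\<bar> \<le> L * norm (x - y)" and B: "\<And>x. \<bar>\<eta> x\<bar> \<le> B"
    and [measurable]: "\<eta> \<in> borel_measurable lborel"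
  shows "\<exists>K\<ge>0. \<forall>u\<in>Lr lborel p. (\<lambda>z. u (snd z) * hquot s p \<eta> z) \<in> Lr pairs p \<and>
    modular pairs p (\<lambda>z. u (snd z) * hquot s p \<eta> z) \<le> K * modular lborel p u"
proof -
  \<comment> \<open>\<open>L * norm (x - y)\<close> is used for close points and the bound \<open>2 * B\<close> for distant ones.\<close>
  define D where "D = L + 2 * B"
  have "0 \<le> B" using B[of 0] by linarith
  obtain b :: 'a where "norm b = 1" using vector_choose_size[of 1] by auto
  then have "0 \<le> L" using L[of b 0] by simp
  have D: "0 \<le> D" using \<open>0 \<le> B\<close> \<open>0 \<le> L\<close> by (simp add: D_def)
  define h where "h z = min 1 (norm z) powr p / norm z powr (real DIM('a) + p * s)" for z :: 'a
  have [measurable]: "h \<in> borel_measurable borel" unfolding h_def by measurable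
  have hnn: "0 \<le> h z" for z by (simp add: h_def)
  define I where "I = enn2real (\<integral>\<^sup>+z. ennreal (h z) \<partial>lborel)"
  have I: "(\<integral>\<^sup>+z. ennreal (h z) \<partial>lborel) = ennreal I" "0 \<le> I"
    using singular_kernel_integrable[OF s p, where 'a='a] by (auto simp: I_def h_def less_top)
  have bound: "\<bar>hquot s p \<eta> (x, y)\<bar> powr p \<le> D powr p * h (x - y)" for x y
  proof -
    have "\<bar>\<eta> x - \<eta> y\<bar> \<le> D * min 1 (norm (x - y))"
    proof (cases "norm (x - y) \<le> 1")
      case True
      then have "L * norm (x - y) \<le> D * norm (x - y)" using \<open>0 \<le> B\<close> by (intro mult_right_mono) (auto simp: D_def)
      then show ?thesis using L[of x y] True by simp
    next
      case False
      then show ?thesis using B[of x] B[of y] \<open>0 \<le> L\<close> by (auto simp: D_def)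
    qed
    then have "\<bar>\<eta> x - \<eta> y\<bar> powr p \<le> (D * min 1 (norm (x - y))) powr p" using p by (intro powr_mono2) auto
    also have "\<dots> = D powr p * min 1 (norm (x - y)) powr p" using D by (subst powr_mult) auto
    finally have "\<bar>\<eta> x - \<eta> y\<bar> powr p / norm (x - y) powr (real DIM('a) + p * s)
      \<le> D powr p * min 1 (norm (x - y)) powr p / norm (x - y) powr (real DIM('a) + p * s)"
      by (intro divide_right_mono) auto
    then show ?thesis using gagliardo_kernel_eq_hquot[of p s \<eta> x y] p
      by (simp add: gagliardo_kernel_def h_def)
  qed
  show ?thesis
  proof (intro exI[of _ "D powr p * I"] conjI ballI)
    show "0 \<le> D powr p * I" using I by simp
    fix u :: "'a \<Rightarrow> real" assume u: "u \<in> Lr lborel p"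
    note [measurable] = Lr_measurable[OF u]
    let ?w = "\<lambda>z. u (snd z) * hquot s p \<eta> z"
    have "(\<integral>\<^sup>+z. ennreal (\<bar>?w z\<bar> powr p) \<partial>pairs) = (\<integral>\<^sup>+y. \<integral>\<^sup>+x. ennreal (\<bar>?w (x, y)\<bar> powr p) \<partial>lborel \<partial>lborel)"
      by (subst lborel_pair.nn_integral_snd[symmetric]) auto
    also have "\<dots> \<le> (\<integral>\<^sup>+y. \<integral>\<^sup>+x. ennreal (\<bar>u y\<bar> powr p * D powr p) * ennreal (h (x - y)) \<partial>lborel \<partial>lborel)"
    proof (intro nn_integral_mono)
      fix x y
      have "\<bar>?w (x, y)\<bar> powr p = \<bar>u y\<bar> powr p * \<bar>hquot s p \<eta> (x, y)\<bar> powr p"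
        by (simp add: abs_mult powr_mult)
      also have "\<dots> \<le> \<bar>u y\<bar> powr p * (D powr p * h (x - y))" using bound by (intro mult_left_mono) auto
      finally show "ennreal (\<bar>?w (x, y)\<bar> powr p) \<le> ennreal (\<bar>u y\<bar> powr p * D powr p) * ennreal (h (x - y))"
        using hnn by (simp add: ennreal_mult[symmetric] mult.assoc ennreal_leI)
    qed
    also have "\<dots> = (\<integral>\<^sup>+y. ennreal (\<bar>u y\<bar> powr p * D powr p) * ennreal I \<partial>lborel)"
      by (simp add: nn_integral_cmult nn_integral_lborel_translate[of "\<lambda>x. ennreal (h x)"] I)
    also have "\<dots> = (\<integral>\<^sup>+y. ennreal (D powr p * I * \<bar>u y\<bar> powr p) \<partial>lborel)"
      using I by (intro nn_integral_cong) (simp add: ennreal_mult[symmetric] mult_ac)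
    also have "\<dots> = ennreal (D powr p * I * modular lborel p u)"
      using Lr_integrable[OF u] I by (subst nn_integral_eq_integral) (auto simp: modular_def)
    finally have le: "(\<integral>\<^sup>+z. ennreal (\<bar>?w z\<bar> powr p) \<partial>pairs) \<le> ennreal (D powr p * I * modular lborel p u)" .
    have int: "integrable pairs (\<lambda>z. \<bar>?w z\<bar> powr p)"
      by (rule integrableI_bounded) (use le in \<open>auto simp: less_top[symmetric] top_unique\<close>)
    then show "?w \<in> Lr pairs p" by (simp add: Lr_def)
    have "ennreal (modular pairs p ?w) \<le> ennreal (D powr p * I * modular lborel p u)"
      using le nn_integral_eq_integral[OF int] by (simp add: modular_def)
    then show "modular pairs p ?w \<le> D powr p * I * modular lborel p u" using I by simp
  qed
qed

locale frac_sobolev =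
  fixes s p :: real and \<Omega> :: "'a::euclidean_space set"
  assumes s0: "0 < s" and s1: "s < 1" and p1: "1 < p" and psN: "p * s < real DIM('a)"
    and \<Omega>_open: "open \<Omega>" and \<Omega>_bounded: "bounded \<Omega>"
begin

abbreviation "W \<equiv> W0 s p \<Omega>"
abbreviation "hq \<equiv> hquot s p :: ('a \<Rightarrow> real) \<Rightarrow> _"
abbreviation "E \<equiv> (\<lambda>u :: 'a \<Rightarrow> real. modular pairs p (hquot s p u))"
abbreviation "L \<equiv> (lborel :: 'a measure)"

definition pst :: real where "pst = crit_exp (real DIM('a)) s p"
text \<open>
  The summand \<open>1\<close> makes the base positive, so that \<open>vol powr (1 - q / pst)\<close> is \<open>1\<close> for \<open>q = pst\<close>.
\<close>
definition vol :: real where "vol = measure L \<Omega> + 1"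
definition S :: real where "S = sobolev_const TYPE('a) s p"
text \<open>
  The least energy that a nonzero solution of the limit equation can have, by \<open>threshold\<close>.
\<close>
definition kap :: real where "kap = S powr (real DIM('a) / (p * s))"

lemma pst_gt_p: "p < pst" and pst_inverse: "1 / p - 1 / pst = s / real DIM('a)"
  and pst_ratio: "pst / p = real DIM('a) / (real DIM('a) - p * s)"
proof -
  have N: "0 < real DIM('a) - p * s" "0 < p * s" "0 < real DIM('a)" using psN s0 p1 by auto
  have "p * (real DIM('a) - p * s) < p * real DIM('a)" using N p1 by (intro mult_strict_left_mono) auto
  then show "p < pst" using N by (simp add: pst_def crit_exp_def pos_less_divide_eq mult.commute)
  show "1 / p - 1 / pst = s / real DIM('a)"
    using N p1 unfolding pst_def crit_exp_def by (simp add: divide_simps)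
  show "pst / p = real DIM('a) / (real DIM('a) - p * s)"
    using p1 by (simp add: pst_def crit_exp_def)
qed

lemma vol_pos: "1 \<le> vol" by (simp add: vol_def)

lemma \<Omega>_sets[measurable]: "\<Omega> \<in> sets borel" using \<Omega>_open by simp

lemma \<Omega>_emeasure: "emeasure L \<Omega> < \<infinity>"
  using emeasure_bounded_finite[OF \<Omega>_bounded] by simp

lemma W_iff: "u \<in> W \<longleftrightarrow> u \<in> Lr L pst \<and> (AE x in L. x \<notin> \<Omega> \<longrightarrow> u x = 0) \<and> hq u \<in> Lr pairs p"
proof -
  have "(\<lambda>z. gagliardo_kernel s p u (fst z) (snd z)) = (\<lambda>z. \<bar>hq u z\<bar> powr p)"
    using p1 by (auto simp: gagliardo_kernel_eq_hquot)
  then show ?thesis using borel_measurable_hquot[of u s p] unfolding W0_def Lr_def pst_def[symmetric] by auto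
qed

lemma W_D:
  assumes "u \<in> W"
  shows "u \<in> Lr L pst" "AE x in L. x \<notin> \<Omega> \<longrightarrow> u x = 0" "hq u \<in> Lr pairs p"
    "u \<in> borel_measurable L"
  using assms Lr_measurable[of u L pst] by (auto simp: W_iff)

lemma W_add: "u \<in> W \<Longrightarrow> v \<in> W \<Longrightarrow> (\<lambda>x. u x + v x) \<in> W"
  and W_diff: "u \<in> W \<Longrightarrow> v \<in> W \<Longrightarrow> (\<lambda>x. u x - v x) \<in> W"
  and W_scale: "u \<in> W \<Longrightarrow> (\<lambda>x. a * u x) \<in> W"
  using pst_gt_p p1 by (auto simp: W_iff hquot_add hquot_diff hquot_scale intro!: Lr_add Lr_diff Lr_scale)

lemma gagliardo_eq: "gagliardo s p u = E u powr (1 / p)" for u :: "'a \<Rightarrow> real"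
  using p1 by (simp add: gagliardo_def gagliardo_pow_eq_energy_pow)

lemma E_scale: "u \<in> W \<Longrightarrow> E (\<lambda>x. a * u x) = \<bar>a\<bar> powr p * E u"
  using Lr_scale(2)[OF W_D(3)] by (simp add: hquot_scale)

lemma sobolev:
  assumes "u \<in> W"
  shows "S * modular L pst u powr (p / pst) \<le> E u"
proof (cases "AE x in L. u x = 0")
  case True
  then have "modular L pst u = 0" using W_D(1)[OF assms] by (simp add: modular_eq_0_iff)
  then show ?thesis by simp
next
  case False
  have q: "Lq_norm (crit_exp (real DIM('a)) s p) v powr p = modular L pst v powr (p / pst)" for v :: "'a \<Rightarrow> real"
    by (simp add: Lq_norm_def modular_def powr_powr pst_def)
  have mem: "u \<in> W0 s p UNIV" using assms by (auto simp: W0_def)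
  let ?X = "{gagliardo_pow s p u / Lq_norm (crit_exp (real DIM('a)) s p) u powr p | u :: 'a \<Rightarrow> real.
            u \<in> W0 s p UNIV \<and> \<not> (AE x in lborel. u x = 0)}"
  have "bdd_below ?X"
    using p1 by (intro bdd_belowI[of _ 0]) (auto simp: gagliardo_pow_eq_energy_pow)
  then have "S \<le> gagliardo_pow s p u / Lq_norm (crit_exp (real DIM('a)) s p) u powr p"
    unfolding S_def sobolev_const_def using mem False by (intro cInf_lower) blast+
  then have "S \<le> E u / modular L pst u powr (p / pst)" using p1 by (simp add: q gagliardo_pow_eq_energy_pow)
  moreover have "0 < modular L pst u"
    using False modular_eq_0_iff[OF W_D(1)[OF assms]] by (metis modular_nonneg order_le_imp_less_or_eq)
  ultimately show ?thesis by (simp add: pos_le_divide_eq)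
qed

text \<open>
  Hoelder's inequality with the indicator of \<open>\<Omega>\<close>.  The constant tends to \<open>1\<close> as \<open>q\<close> tends to the critical
  exponent, so that the limits can be compared with \<open>kap\<close> itself.
\<close>
lemma Lr_subcritical:
  assumes u: "u \<in> Lr L pst" "AE x in L. x \<notin> \<Omega> \<longrightarrow> u x = 0" and q: "0 < q" "q \<le> pst"
  shows "u \<in> Lr L q" "modular L q u \<le> vol powr (1 - q / pst) * modular L pst u powr (q / pst)"
proof -
  have [measurable]: "u \<in> borel_measurable L" using u(1) by (rule Lr_measurable)
  have "u \<in> Lr L q \<and> modular L q u \<le> vol powr (1 - q / pst) * modular L pst u powr (q / pst)"
  proof (cases "q = pst")
    case True
    then show ?thesis using u vol_pos q by simp
  next
    case False
    define \<alpha> where "\<alpha> = q / pst"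
    have \<alpha>: "0 < \<alpha>" "\<alpha> < 1" using False q by (auto simp: \<alpha>_def)
    have ind: "integrable L (indicator \<Omega> :: 'a \<Rightarrow> real)" using \<Omega>_emeasure by simp
    note h = holder_interpolation[OF ind _ Lr_integrable[OF u(1)] _ \<alpha>]
    have ae: "AE x in L. indicator \<Omega> x powr (1 - \<alpha>) * (\<bar>u x\<bar> powr pst) powr \<alpha> = \<bar>u x\<bar> powr q"
      using u(2) by eventually_elim (use q in \<open>auto simp: indicator_def powr_powr \<alpha>_def\<close>)
    have "integrable L (\<lambda>x. \<bar>u x\<bar> powr q)"
      using integrable_cong_AE[THEN iffD1, OF _ _ ae h(1)] by auto
    then have 1: "u \<in> Lr L q" by (simp add: Lr_def)
    have "modular L q u = (LINT x|L. indicator \<Omega> x powr (1 - \<alpha>) * (\<bar>u x\<bar> powr pst) powr \<alpha>)"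
      unfolding modular_def using ae by (intro integral_cong_AE) auto
    also have "\<dots> \<le> (LINT x|L. indicator \<Omega> x) powr (1 - \<alpha>) * modular L pst u powr \<alpha>"
      unfolding modular_def by (rule h(2)) auto
    also have "\<dots> \<le> vol powr (1 - \<alpha>) * modular L pst u powr \<alpha>"
      using \<alpha> by (intro mult_right_mono powr_mono2) (auto simp: vol_def)
    finally show ?thesis using 1 by (simp add: \<alpha>_def)
  qed
  then show "u \<in> Lr L q" "modular L q u \<le> vol powr (1 - q / pst) * modular L pst u powr (q / pst)" by auto
qed

lemma W_Lr: "u \<in> W \<Longrightarrow> 0 < q \<Longrightarrow> q \<le> pst \<Longrightarrow> u \<in> Lr L q"
  using Lr_subcritical(1) W_D by blast

lemma subcritical_sobolev:
  assumes u: "u \<in> W" and q: "0 < q" "q \<le> pst" and "0 < S"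
  shows "modular L q u \<le> vol powr (1 - q / pst) * (E u / S) powr (q / p)"
proof -
  have "modular L pst u powr (p / pst) \<le> E u / S" using sobolev[OF u] \<open>0 < S\<close> by (simp add: field_simps)
  then have "(modular L pst u powr (p / pst)) powr (q / p) \<le> (E u / S) powr (q / p)"
    using q p1 by (intro powr_mono2) auto
  then have "modular L pst u powr (q / pst) \<le> (E u / S) powr (q / p)" using p1 by (simp add: powr_powr)
  then have "vol powr (1 - q / pst) * modular L pst u powr (q / pst) \<le> vol powr (1 - q / pst) * (E u / S) powr (q / p)"
    by (intro mult_left_mono) auto
  then show ?thesis using Lr_subcritical(2)[OF W_D(1,2)[OF u] q] by linarith
qed

lemma cutoff_mult_W:
  assumes u: "u \<in> W" and L: "\<And>x y. \<bar>\<eta> x - \<eta> y\<bar> \<le> K * norm (x - y)" and B: "\<And>x. \<bar>\<eta> x\<bar> \<le> B"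
    and [measurable]: "\<eta> \<in> borel_measurable lborel"
  shows "(\<lambda>x. \<eta> x * u x) \<in> W"
proof -
  have [measurable]: "u \<in> borel_measurable L" using u by (rule W_D)
  have B0: "0 \<le> B" using B[of 0] by linarith
  have up: "u \<in> Lr L p" using W_Lr[OF u] p1 pst_gt_p by auto
  have bnd: "\<bar>\<eta> x * t\<bar> \<le> \<bar>B * t\<bar>" for x t using B[of x] B0 by (auto simp: abs_mult intro: mult_right_mono)
  have "(\<lambda>x. \<eta> x * u x) \<in> Lr L pst"
    by (rule Lr_bound[OF Lr_scale(1)[OF W_D(1)[OF u], of B]]) (use bnd p1 pst_gt_p in auto)
  moreover have "(\<lambda>z. \<eta> (fst z) * hq u z) \<in> Lr pairs p"
    by (rule Lr_bound[OF Lr_scale(1)[OF W_D(3)[OF u], of B]]) (use bnd p1 in auto)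
  then have "hq (\<lambda>x. \<eta> x * u x) \<in> Lr pairs p"
    using cutoff_commutator[OF s0 s1 p1 L B] up Lr_add(1)[of _ pairs p] p1 unfolding hquot_mult[abs_def] by auto
  moreover have "AE x in L. x \<notin> \<Omega> \<longrightarrow> \<eta> x * u x = 0"
    using W_D(2)[OF u] by eventually_elim auto
  ultimately show ?thesis by (simp add: W_iff)
qed

text \<open>
  A pair of points contributes to the energy only if one of them lies in \<open>\<Omega>\<close>.  Hence the energy is
  bounded by the commutators of \<open>\<eta>\<close> with the indicator of \<open>\<Omega>\<close> in either variable.
\<close>
lemma lipschitz_W:
  assumes L: "\<And>x y. \<bar>\<eta> x - \<eta> y\<bar> \<le> K * norm (x - y)" and B: "\<And>x. \<bar>\<eta> x\<bar> \<le> B"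
    and [measurable]: "\<eta> \<in> borel_measurable lborel" and z: "\<And>x. x \<notin> \<Omega> \<Longrightarrow> \<eta> x = 0"
  shows "\<eta> \<in> W"
proof -
  define i where "i = (indicator \<Omega> :: 'a \<Rightarrow> real)"
  have [measurable]: "i \<in> borel_measurable borel" unfolding i_def by measurable
  have iLr: "i \<in> Lr L r" if "0 < r" for r
  proof -
    have "(\<lambda>x. \<bar>i x\<bar> powr r) = i" using that by (auto simp: i_def indicator_def fun_eq_iff)
    moreover have "integrable L i" using \<Omega>_emeasure by (simp add: i_def)
    ultimately show ?thesis by (simp add: Lr_def)
  qed
  have "\<eta> \<in> Lr L pst"
    by (rule Lr_bound[OF Lr_scale(1)[OF iLr, of pst B]])
      (use z order_trans[OF B abs_ge_self] p1 pst_gt_p in \<open>auto simp: i_def indicator_def abs_mult\<close>)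
  moreover have s1': "(\<lambda>z. i (snd z) * hq \<eta> z) \<in> Lr pairs p"
    using cutoff_commutator[OF s0 s1 p1 L B] iLr[of p] p1 by auto
  moreover have "(\<lambda>z. i (fst z) * hq \<eta> z) \<in> Lr pairs p"
  proof -
    have "integrable pairs (\<lambda>(x, y). \<bar>i (snd (y, x)) * hq \<eta> (y, x)\<bar> powr p)"
      using lborel_pair.integrable_product_swap[OF Lr_integrable[OF s1']] by simp
    moreover have "\<bar>hq \<eta> (y, x)\<bar> = \<bar>hq \<eta> (x, y)\<bar>" for x y
      by (simp add: hquot_def abs_divide norm_minus_commute abs_minus_commute)
    ultimately have "integrable pairs (\<lambda>z. \<bar>i (fst z) * hq \<eta> z\<bar> powr p)"
      by (simp add: abs_mult case_prod_unfold)
    then show ?thesis by (simp add: Lr_def)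
  qed
  ultimately have sum: "(\<lambda>z. i (fst z) * hq \<eta> z + i (snd z) * hq \<eta> z) \<in> Lr pairs p"
    using p1 by (intro Lr_add) auto
  have "hq \<eta> \<in> Lr pairs p"
  proof (rule Lr_bound[OF sum])
    have "\<bar>hq \<eta> z\<bar> \<le> \<bar>i (fst z) * hq \<eta> z + i (snd z) * hq \<eta> z\<bar>" for z
    proof (cases "fst z \<in> \<Omega> \<or> snd z \<in> \<Omega>")
      case True
      then have "1 \<le> i (fst z) + i (snd z)" by (auto simp: i_def)
      then have "1 * \<bar>hq \<eta> z\<bar> \<le> \<bar>i (fst z) + i (snd z)\<bar> * \<bar>hq \<eta> z\<bar>" by (intro mult_right_mono) auto
      then show ?thesis by (simp add: abs_mult[symmetric] distrib_right)
    next
      case False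
      then show ?thesis using assms(4) by (simp add: hquot_def)
    qed
    then show "AE z in pairs. \<bar>hq \<eta> z\<bar> \<le> \<bar>i (fst z) * hq \<eta> z + i (snd z) * hq \<eta> z\<bar>" by simp
  qed (use p1 in auto)
  then show ?thesis using \<open>\<eta> \<in> Lr L pst\<close> z by (simp add: W_iff)
qed

end

section \<open>Compact embedding and weak convergence\<close>

lemma pointwise_convergent_subsequence:
  fixes f :: "nat \<Rightarrow> nat \<Rightarrow> real"
  assumes "\<And>n k. \<bar>f n k\<bar> \<le> B"
  shows "\<exists>r. strict_mono r \<and> (\<forall>k. convergent (\<lambda>n. f (r n) k))"
proof -
  interpret subseqs "\<lambda>k r. convergent (\<lambda>n. f (r n) k)"
  proof
    fix k :: nat and r :: "nat \<Rightarrow> nat" assume "strict_mono r"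
    have "bounded (range (\<lambda>n. f (r n) k))" using assms by (intro boundedI[of _ B]) auto
    then obtain l r' where "strict_mono r'" "((\<lambda>n. f (r n) k) \<circ> r') \<longlonglongrightarrow> l"
      using bounded_imp_convergent_subsequence by metis
    then show "\<exists>r'. strict_mono r' \<and> convergent (\<lambda>n. f ((r \<circ> r') n) k)"
      by (auto simp: o_def convergent_def)
  qed
  have "convergent (\<lambda>n. f (diagseq n) k)" for k
  proof -
    have "convergent (\<lambda>n. f ((diagseq \<circ> ((+) (Suc k))) n) k)"
    proof (rule diagseq_holds)
      fix r s :: "nat \<Rightarrow> nat" and n
      assume "strict_mono r" "convergent (\<lambda>m. f (s m) n)"
      then show "convergent (\<lambda>m. f ((s \<circ> r) m) n)"
        using convergent_subseq_convergent[of "\<lambda>m. f (s m) n" r] by (simp add: o_def)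
    qed
    then obtain l where "(\<lambda>n. f (diagseq (n + Suc k)) k) \<longlonglongrightarrow> l"
      by (auto simp: convergent_def o_def add.commute)
    then have "(\<lambda>n. f (diagseq n) k) \<longlonglongrightarrow> l" by (rule LIMSEQ_offset)
    then show ?thesis by (auto simp: convergent_def)
  qed
  then show ?thesis using subseq_diagseq by blast
qed

lemma diagonal_eventually:
  fixes P :: "nat \<Rightarrow> nat \<Rightarrow> bool"
  assumes "\<And>k. \<forall>\<^sub>F n in sequentially. P k n"
  shows "\<exists>r. strict_mono r \<and> (\<forall>k. P k (r k))"
proof -
  have "\<exists>r. \<forall>k. P k (r k) \<and> r k < r (Suc k)"
  proof (rule dependent_nat_choice)
    show "\<exists>n. P 0 n" using assms[of 0] by (auto simp: eventually_sequentially)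
    fix n k
    obtain N where "\<And>m. m \<ge> N \<Longrightarrow> P (Suc k) m" using assms[of "Suc k"] by (auto simp: eventually_sequentially)
    then show "\<exists>m. P (Suc k) m \<and> n < m" by (intro exI[of _ "max N (Suc n)"]) auto
  qed
  then show ?thesis by (auto simp: strict_mono_Suc_iff)
qed

context frac_sobolev
begin

lemma W_integrable:
  assumes "u \<in> W"
  shows "integrable L u"
proof (rule integrable_abs_cancel)
  show "integrable L (\<lambda>x. \<bar>u x\<bar>)"
    using Lr_integrable[OF W_Lr[OF assms, of 1]] pst_gt_p p1 by simp
qed (rule W_D(4)[OF assms])

lemma integral_Ds_pow:
  assumes "u \<in> W"
  shows "(\<integral>\<^sup>+x. Ds_pow s p u x \<partial>L) = ennreal (E u)"
proof -
  have [measurable]: "u \<in> borel_measurable L" using assms by (rule W_D)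
  have "(\<integral>\<^sup>+x. Ds_pow s p u x \<partial>L) = (\<integral>\<^sup>+x. \<integral>\<^sup>+y. ennreal (\<bar>hq u (x, y)\<bar> powr p) \<partial>L \<partial>L)"
    using p1 by (simp add: Ds_pow_def gagliardo_kernel_eq_hquot)
  also have "\<dots> = (\<integral>\<^sup>+z. ennreal (\<bar>hq u z\<bar> powr p) \<partial>pairs)"
    by (rule lborel.nn_integral_fst) simp
  also have "\<dots> = ennreal (E u)"
    using Lr_integrable[OF W_D(3)[OF assms]] by (simp add: nn_integral_eq_integral modular_def)
  finally show ?thesis .
qed

lemma borel_measurable_Ds_pow[measurable]:
  fixes u :: "'a \<Rightarrow> real"
  assumes [measurable]: "u \<in> borel_measurable L"
  shows "Ds_pow s p u \<in> borel_measurable L"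
proof -
  have "(\<lambda>x. \<integral>\<^sup>+y. ennreal (\<bar>hq u (x, y)\<bar> powr p) \<partial>L) \<in> borel_measurable L" by measurable
  moreover have "Ds_pow s p u = (\<lambda>x. \<integral>\<^sup>+y. ennreal (\<bar>hq u (x, y)\<bar> powr p) \<partial>L)"
    using p1 by (simp add: Ds_pow_def[abs_def] gagliardo_kernel_eq_hquot)
  ultimately show ?thesis by simp
qed

definition ball_avg :: "('a \<Rightarrow> real) \<Rightarrow> 'a \<Rightarrow> real \<Rightarrow> real" where
  "ball_avg u c \<delta> = (LINT y|L. indicator (ball c \<delta>) y * u y) / measure L (ball c \<delta>)"

text \<open>
  The factor of the energy in the \<open>L\<^sup>1\<close> distance of a function from its averages at the scale \<open>\<delta>\<close>.
  For fixed \<open>\<theta>\<close> it is a multiple of \<open>\<delta> powr (p * s)\<close>.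
\<close>
definition avg_const :: "real \<Rightarrow> real \<Rightarrow> real" where
  "avg_const \<theta> \<delta> = \<theta> powr (1 - p) * (2 * \<delta>) powr (real DIM('a) + p * s) / (\<delta> ^ DIM('a) * measure L (ball (0::'a) 1))"

text \<open>
  The average deviates from \<open>u x\<close> by at most the mean of \<open>|u x - u y|\<close>, where \<open>|x - y| \<le> 2 \<delta>\<close>.  Each
  difference is at most \<open>\<theta>\<close> plus \<open>\<theta> powr (1 - p)\<close> times its \<open>p\<close>-th power, and the \<open>p\<close>-th power is at most
  \<open>(2 \<delta>)^(N + p s)\<close> times the kernel.  The ball need not be centred at \<open>x\<close>, so countably many centres
  serve all points.
\<close>
lemma ball_avg_error:
  assumes u: "integrable L u" and \<delta>: "0 < \<delta>" and c: "dist c x < \<delta>" and \<theta>: "0 < \<theta>"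
  shows "ennreal \<bar>u x - ball_avg u c \<delta>\<bar> \<le> ennreal \<theta> + ennreal (avg_const \<theta> \<delta>) * Ds_pow s p u x"
proof -
  define V where "V = measure L (ball c \<delta>)"
  define Bl where "Bl = ball c \<delta>"
  define G where "G = \<theta> powr (1 - p) * (2 * \<delta>) powr (real DIM('a) + p * s)"
  have V: "0 < V" using \<delta> unfolding V_def by (simp add: content_ball_pos)
  have emB: "emeasure L Bl = ennreal V" unfolding Bl_def V_def
    using emeasure_lborel_ball_finite[of c \<delta>] by (simp add: emeasure_eq_ennreal_measure less_top)
  have [measurable]: "u \<in> borel_measurable L" "Bl \<in> sets borel" using u by (auto simp: Bl_def)
  have iB: "integrable L (indicator Bl :: 'a \<Rightarrow> real)" using emB by simp
  have iu: "integrable L (\<lambda>y. indicator Bl y * u y)"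
    using integrable_mult_indicator[OF _ u, of Bl] by simp
  have int: "integrable L (\<lambda>y. indicator Bl y * (u x - u y))"
    using iB iu by (simp add: right_diff_distrib)
  have "u x - ball_avg u c \<delta> = (LINT y|L. indicator Bl y * (u x - u y)) / V"
    using iB iu V emB by (simp add: ball_avg_def right_diff_distrib Bl_def[symmetric] V_def[symmetric]
        diff_divide_distrib) (simp add: measure_def)
  then have "\<bar>u x - ball_avg u c \<delta>\<bar> = \<bar>LINT y|L. indicator Bl y * (u x - u y)\<bar> / V" using V by simp
  also have "\<dots> \<le> (LINT y|L. \<bar>indicator Bl y * (u x - u y)\<bar>) / V"
    using V by (intro divide_right_mono integral_abs_bound) auto
  finally have "ennreal \<bar>u x - ball_avg u c \<delta>\<bar> \<le> ennreal (1 / V * (LINT y|L. \<bar>indicator Bl y * (u x - u y)\<bar>))"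
    by (intro ennreal_leI) simp
  also have "\<dots> = ennreal (1 / V) * (\<integral>\<^sup>+y. ennreal \<bar>indicator Bl y * (u x - u y)\<bar> \<partial>L)"
    using int V by (subst nn_integral_eq_integral) (auto simp: ennreal_mult[symmetric])
  also have "\<dots> \<le> ennreal (1 / V) * (\<integral>\<^sup>+y. ennreal \<theta> * indicator Bl y + ennreal G * ennreal (gagliardo_kernel s p u x y) \<partial>L)"
  proof (intro mult_left_mono nn_integral_mono)
    fix y
    show "ennreal \<bar>indicator Bl y * (u x - u y)\<bar> \<le> ennreal \<theta> * indicator Bl y + ennreal G * ennreal (gagliardo_kernel s p u x y)"
    proof (cases "y \<in> Bl")
      case True
      then have "dist x y \<le> 2 * \<delta>"
        using c dist_triangle[of x y c] by (auto simp: Bl_def dist_commute)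
      then have n: "norm (x - y) \<le> 2 * \<delta>" by (simp add: dist_norm)
      define t where "t = \<bar>u x - u y\<bar>"
      have "t / \<theta> \<le> 1 + (t / \<theta>) powr p"
        using powr_mult_le_add[of p 1 "t / \<theta>"] p1 \<theta> by (auto simp: t_def)
      then have "\<theta> * (t / \<theta>) \<le> \<theta> * (1 + (t / \<theta>) powr p)" using \<theta> by (intro mult_left_mono) auto
      then have "t \<le> \<theta> + \<theta> * (t powr p / \<theta> powr p)" using \<theta> by (simp add: distrib_left t_def powr_divide)
      also have "\<theta> * (t powr p / \<theta> powr p) = \<theta> powr (1 - p) * t powr p" using \<theta> by (simp add: powr_diff)
      also have "t powr p \<le> (2 * \<delta>) powr (real DIM('a) + p * s) * gagliardo_kernel s p u x y"
      proof (cases "x = y")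
        case False
        then have "1 \<le> (2 * \<delta>) powr (real DIM('a) + p * s) / norm (x - y) powr (real DIM('a) + p * s)"
          using n s0 p1 by (simp add: powr_mono2)
        then have "1 * t powr p \<le> (2 * \<delta>) powr (real DIM('a) + p * s) / norm (x - y) powr (real DIM('a) + p * s) * t powr p"
          by (intro mult_right_mono) auto
        then show ?thesis by (simp add: gagliardo_kernel_def t_def)
      qed (simp add: t_def gagliardo_kernel_def)
      finally have "t \<le> \<theta> + G * gagliardo_kernel s p u x y"
        by (simp add: G_def mult.assoc mult_left_mono)
      then show ?thesis using True \<theta>
        by (auto simp: t_def G_def gagliardo_kernel_def ennreal_mult[symmetric] ennreal_plus[symmetric]
            simp del: ennreal_plus intro!: ennreal_leI)
    qed auto
  qed auto
  also have "(\<integral>\<^sup>+y. ennreal \<theta> * indicator Bl y + ennreal G * ennreal (gagliardo_kernel s p u x y) \<partial>L)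
    = ennreal \<theta> * ennreal V + ennreal G * Ds_pow s p u x"
  proof -
    have [measurable]: "(\<lambda>y. gagliardo_kernel s p u x y) \<in> borel_measurable L"
      unfolding gagliardo_kernel_def by measurable
    show ?thesis
      by (subst nn_integral_add) (auto simp: nn_integral_cmult emB Ds_pow_def)
  qed
  also have "ennreal (1 / V) * \<dots> = ennreal (1 / V) * (ennreal \<theta> * ennreal V) + ennreal (1 / V) * (ennreal G * Ds_pow s p u x)"
    by (rule distrib_left)
  also have "ennreal (1 / V) * (ennreal \<theta> * ennreal V) = ennreal \<theta>"
    using V \<theta> by (simp add: ennreal_mult[symmetric])
  also have "ennreal (1 / V) * (ennreal G * Ds_pow s p u x) = ennreal (G / V) * Ds_pow s p u x"
    using V by (simp add: mult.assoc[symmetric] ennreal_mult[symmetric] G_def)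
  also have "G / V = avg_const \<theta> \<delta>"
    using content_ball_conv_unit_ball[of \<delta> c] \<delta> by (simp add: G_def V_def avg_const_def)
  finally show ?thesis .
qed

text \<open>
  Integrating \<open>ball_avg_error\<close> over \<open>\<Omega>\<close>; the index \<open>i x\<close> selects a ball near \<open>x\<close> from a countable
  family.
\<close>
lemma L1_le_averages:
  assumes w: "w \<in> W" and \<delta>: "0 < \<delta>" and \<theta>: "0 < \<theta>"
    and [measurable]: "i \<in> measurable borel (count_space UNIV)"
    and d: "\<And>x. dist (d (i x :: nat)) x < \<delta>"
    and bnd: "\<And>k. \<bar>ball_avg w (d k) \<delta>\<bar> \<le> B"
  shows "(LINT x|L. \<bar>w x\<bar>) \<le> \<theta> * vol + avg_const \<theta> \<delta> * E w
     + (LINT x|L. indicator \<Omega> x * \<bar>ball_avg w (d (i x)) \<delta>\<bar>)"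
proof -
  have [measurable]: "w \<in> borel_measurable L" using w by (rule W_D)
  have w1: "integrable L w" by (rule W_integrable[OF w])
  define G where "G = avg_const \<theta> \<delta>"
  have G0: "0 \<le> G" unfolding G_def avg_const_def using \<delta> by simp
  define A where "A x = ball_avg w (d (i x)) \<delta>" for x
  have Am[measurable]: "A \<in> borel_measurable borel"
  proof -
    have "(\<lambda>k. ball_avg w (d k) \<delta>) \<in> measurable (count_space UNIV) borel" by simp
    then show ?thesis unfolding A_def using assms(4) by (rule measurable_compose[rotated])
  qed
  have intA: "integrable L (\<lambda>x. indicator \<Omega> x * \<bar>A x\<bar>)"
  proof (rule Bochner_Integration.integrable_bound[of _ "\<lambda>x. B * indicator \<Omega> x"])
    show "AE x in L. norm (indicator \<Omega> x * \<bar>A x\<bar>) \<le> norm (B * indicator \<Omega> x :: real)"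
      using bnd by (intro AE_I2) (auto simp: indicator_def A_def intro: order_trans[OF _ abs_ge_self])
  qed (use \<Omega>_emeasure in auto)
  have e: "ennreal \<bar>w x - A x\<bar> \<le> ennreal \<theta> + ennreal G * Ds_pow s p w x" for x
    using ball_avg_error[OF w1 \<delta> d[of x] \<theta>] by (simp add: A_def G_def)
  have "ennreal (LINT x|L. \<bar>w x\<bar>) = (\<integral>\<^sup>+x. ennreal \<bar>w x\<bar> \<partial>L)"
    using w1 by (subst nn_integral_eq_integral) auto
  also have "\<dots> \<le> (\<integral>\<^sup>+x. ennreal \<theta> * indicator \<Omega> x + ennreal G * Ds_pow s p w x + ennreal (indicator \<Omega> x * \<bar>A x\<bar>) \<partial>L)"
  proof (rule nn_integral_mono_AE)
    show "AE x in L. ennreal \<bar>w x\<bar> \<le> ennreal \<theta> * indicator \<Omega> x + ennreal G * Ds_pow s p w x + ennreal (indicator \<Omega> x * \<bar>A x\<bar>)"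
      using W_D(2)[OF w]
    proof eventually_elim
      case (elim x)
      show ?case
      proof (cases "x \<in> \<Omega>")
        case True
        have "ennreal \<bar>w x\<bar> \<le> ennreal (\<bar>w x - A x\<bar> + \<bar>A x\<bar>)" by (intro ennreal_leI) auto
        also have "\<dots> = ennreal \<bar>w x - A x\<bar> + ennreal \<bar>A x\<bar>" by simp
        also have "\<dots> \<le> (ennreal \<theta> + ennreal G * Ds_pow s p w x) + ennreal \<bar>A x\<bar>"
          using e by (rule add_right_mono)
        finally show ?thesis using True by simp
      qed (use elim in auto)
    qed
  qed
  also have "\<dots> = ennreal \<theta> * emeasure L \<Omega> + ennreal G * (\<integral>\<^sup>+x. Ds_pow s p w x \<partial>L)
      + (\<integral>\<^sup>+x. ennreal (indicator \<Omega> x * \<bar>A x\<bar>) \<partial>L)"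
    by (simp add: nn_integral_add nn_integral_cmult)
  also have "(\<integral>\<^sup>+x. ennreal (indicator \<Omega> x * \<bar>A x\<bar>) \<partial>L) = ennreal (LINT x|L. indicator \<Omega> x * \<bar>A x\<bar>)"
    using intA by (intro nn_integral_eq_integral) auto
  also have "(\<integral>\<^sup>+x. Ds_pow s p w x \<partial>L) = ennreal (E w)" by (rule integral_Ds_pow[OF w])
  also have "emeasure L \<Omega> = ennreal (measure L \<Omega>)" using \<Omega>_emeasure by (simp add: emeasure_eq_ennreal_measure less_top)
  also have "ennreal \<theta> * ennreal (measure L \<Omega>) + ennreal G * ennreal (E w) + ennreal (LINT x|L. indicator \<Omega> x * \<bar>A x\<bar>)
    = ennreal (\<theta> * measure L \<Omega> + G * E w + (LINT x|L. indicator \<Omega> x * \<bar>A x\<bar>))"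
    using \<theta> G0 by (simp add: ennreal_mult)
  finally have "(LINT x|L. \<bar>w x\<bar>) \<le> \<theta> * measure L \<Omega> + G * E w + (LINT x|L. indicator \<Omega> x * \<bar>A x\<bar>)"
    using \<theta> G0 by (subst (asm) ennreal_le_iff) auto
  also have "\<theta> * measure L \<Omega> \<le> \<theta> * vol" using \<theta> by (intro mult_left_mono) (auto simp: vol_def)
  finally show ?thesis by (simp add: G_def A_def)
qed

lemma small_L1_parameters:
  assumes "0 < e" "0 \<le> K"
  shows "\<exists>\<theta>>0. \<exists>k::nat. \<theta> * vol + avg_const \<theta> (inverse (real (Suc k))) * K < e"
proof -
  define V where "V = measure L (ball (0::'a) 1)"
  have V: "0 < V" by (simp add: V_def content_ball_pos)
  define \<theta> where "\<theta> = e / (2 * vol)"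
  have \<theta>: "0 < \<theta>" "\<theta> * vol = e / 2" using assms vol_pos by (auto simp: \<theta>_def)
  define g where "g \<delta> = \<theta> powr (1 - p) * 2 powr (real DIM('a) + p * s) / V * K * \<delta> powr (p * s)" for \<delta> :: real
  have eq: "avg_const \<theta> \<delta> * K = g \<delta>" if "\<delta> > 0" for \<delta>
    using that V by (simp add: avg_const_def V_def[symmetric] g_def powr_mult powr_add powr_realpow field_simps)
  have "(\<lambda>k. g (inverse (real (Suc k)))) \<longlonglongrightarrow> g 0"
    unfolding g_def using s0 p1 LIMSEQ_inverse_real_of_nat
    by (intro tendsto_mult tendsto_const tendsto_powr') auto
  then have "\<forall>\<^sub>F k in sequentially. g (inverse (real (Suc k))) < e / 2"
    using assms by (intro order_tendstoD) (auto simp: g_def)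
  then obtain k where "g (inverse (real (Suc k))) < e / 2" by (auto simp: eventually_sequentially)
  then have "\<theta> * vol + g (inverse (real (Suc k))) < e" using \<theta> by simp
  then show ?thesis using \<theta>(1) eq[of "inverse (real (Suc k))"] by (intro exI[of _ \<theta>] conjI exI[of _ k]) auto
qed

text \<open>
  Along a diagonal subsequence the averages over all balls with centres in a countable dense set and
  radii \<open>1 / (k + 1)\<close> converge.  The distance to the averages is small uniformly in \<open>n\<close> by
  \<open>L1_le_averages\<close>, so the subsequence is Cauchy in \<open>L\<^sup>1\<close>.
\<close>
lemma compact_embedding_AE:
  fixes f :: "nat \<Rightarrow> 'a \<Rightarrow> real" and K :: real
  assumes f: "\<And>n. f n \<in> W" and K: "\<And>n. E (f n) \<le> K" "\<And>n. modular L pst (f n) \<le> K"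
  shows "\<exists>r v. strict_mono r \<and> v \<in> W \<and> (AE x in L. (\<lambda>n. f (r n) x) \<longlonglongrightarrow> v x)"
proof -
  have fm[measurable]: "f n \<in> borel_measurable L" for n using f by (rule W_D)
  have fint: "integrable L (f n)" for n by (rule W_integrable[OF f])
  have K0: "0 \<le> K" using K(2)[of 0] modular_nonneg[of L pst "f 0"] by linarith
  define B1 where "B1 = vol powr (1 - 1 / pst) * K powr (1 / pst)"
  have L1: "(LINT x|L. \<bar>f n x\<bar>) \<le> B1" for n
  proof -
    have "(LINT x|L. \<bar>f n x\<bar>) \<le> vol powr (1 - 1 / pst) * modular L pst (f n) powr (1 / pst)"
      using Lr_subcritical(2)[OF W_D(1,2)[OF f], of 1 n] pst_gt_p p1 by (simp add: modular_def)
    also have "\<dots> \<le> B1" unfolding B1_def using K(2) pst_gt_p p1 by (intro mult_left_mono powr_mono2) auto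
    finally show ?thesis .
  qed
  obtain D :: "'a set" where D: "countable D" "\<And>X. open X \<Longrightarrow> X \<noteq> {} \<Longrightarrow> \<exists>d\<in>D. d \<in> X"
    using countable_dense_setE by blast
  have "D \<noteq> {}" using D(2)[of UNIV] by auto
  define d where "d = from_nat_into D"
  have dense: "\<exists>k. dist (d k) x < \<delta>" if "0 < \<delta>" for x and \<delta> :: real
  proof -
    have "x \<in> ball x \<delta>" using that by simp
    then have "ball x \<delta> \<noteq> {}" by blast
    obtain z where "z \<in> D" "dist x z < \<delta>" using D(2)[of "ball x \<delta>"] \<open>0 < \<delta>\<close> by force
    then show ?thesis using from_nat_into_surj[OF D(1), of z] by (auto simp: d_def dist_commute)
  qed
  \<comment> \<open>A measurable choice of a centre near \<open>x\<close>.\<close>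
  define i where "i \<delta> x = (LEAST k. dist (d k) x < \<delta>)" for \<delta> x
  have i: "dist (d (i \<delta> x)) x < \<delta>" if "0 < \<delta>" for \<delta> x
    unfolding i_def using dense[OF that] by (rule LeastI_ex)
  have im[measurable]: "i \<delta> \<in> measurable borel (count_space UNIV)" for \<delta>
    unfolding i_def by measurable
  define dl where "dl k = inverse (real (Suc k))" for k
  have dl: "0 < dl k" for k by (simp add: dl_def)
  define I where "I n c \<delta> = (LINT y|L. indicator (ball c \<delta>) y * f n y)" for n c \<delta>
  have Iint: "integrable L (\<lambda>y. indicator (ball c \<delta>) y * f n y)" for n c \<delta>
    using integrable_mult_indicator[OF _ fint[of n], of "ball c \<delta>"] by simp
  have Ibound: "\<bar>I n c \<delta>\<bar> \<le> B1" for n c \<delta>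
  proof -
    have "\<bar>I n c \<delta>\<bar> \<le> (LINT y|L. \<bar>indicator (ball c \<delta>) y * f n y\<bar>)" unfolding I_def by (rule integral_abs_bound)
    also have "\<dots> \<le> (LINT y|L. \<bar>f n y\<bar>)"
      using Iint fint by (intro integral_mono) (auto simp: indicator_def)
    finally show ?thesis using L1[of n] by linarith
  qed
  obtain r where r: "strict_mono r" "\<And>k. convergent (\<lambda>n. I (r n) (d (snd (prod_decode k))) (dl (fst (prod_decode k))))"
    using pointwise_convergent_subsequence[of "\<lambda>n k. I n (d (snd (prod_decode k))) (dl (fst (prod_decode k)))" B1] Ibound by blast
  have conv: "convergent (\<lambda>n. I (r n) (d j) (dl k))" for j k
    using r(2)[of "prod_encode (k, j)"] by simp
  have avg: "ball_avg (\<lambda>x. f n x - f m x) c \<delta> = (I n c \<delta> - I m c \<delta>) / measure L (ball c \<delta>)" for n m c \<delta>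
    using Iint by (simp add: ball_avg_def I_def right_diff_distrib)
  have cauchy: "\<exists>N. \<forall>n\<ge>N. \<forall>m\<ge>N. (LINT x|L. norm (f (r n) x - f (r m) x)) < e" if "0 < e" for e
  proof -
    define K2 where "K2 = 2 powr p * (K + K)"
    obtain \<theta> k where \<theta>: "0 < \<theta>" and lk: "\<theta> * vol + avg_const \<theta> (dl k) * K2 < e / 2"
      using small_L1_parameters[of "e / 2" K2] \<open>0 < e\<close> K0 by (auto simp: K2_def dl_def)
    define V where "V = measure L (ball (0::'a) (dl k))"
    have V: "0 < V" using dl by (simp add: V_def content_ball_pos)
    have VV: "measure L (ball (d j) (dl k)) = V" for j
      using content_ball_conv_unit_ball[of "dl k" "d j"] content_ball_conv_unit_ball[of "dl k" "0::'a"] dl[of k]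
      by (simp add: V_def less_imp_le)
    define l where "l j = lim (\<lambda>n. I (r n) (d j) (dl k))" for j
    have l: "(\<lambda>n. I (r n) (d j) (dl k)) \<longlonglongrightarrow> l j" for j
      using conv[of j k] by (simp add: l_def convergent_LIMSEQ_iff)
    have lB: "\<bar>l j\<bar> \<le> B1" for j
      by (rule LIMSEQ_le_const2[OF tendsto_rabs[OF l]]) (use Ibound in auto)
    define dev where "dev n x = indicator \<Omega> x * \<bar>I (r n) (d (i (dl k) x)) (dl k) - l (i (dl k) x)\<bar>" for n x
    define T where "T n = (LINT x|L. dev n x)" for n
    have mm: "(\<lambda>x. h (i (dl k) x)) \<in> borel_measurable borel" for h :: "nat \<Rightarrow> real"
      by (rule measurable_compose[OF im]) simp
    have [measurable]: "(\<lambda>x. I n (d (i (dl k) x)) (dl k) - l (i (dl k) x)) \<in> borel_measurable borel" for n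
      using mm[of "\<lambda>j. I n (d j) (dl k) - l j"] .
    have [measurable]: "dev n \<in> borel_measurable L" for n unfolding dev_def by measurable
    have Tdom: "\<bar>dev n x\<bar> \<le> 2 * B1 * indicator \<Omega> x" for n x
      using Ibound[of "r n" "d (i (dl k) x)" "dl k"] lB[of "i (dl k) x"] by (auto simp: dev_def indicator_def)
    have iO: "integrable L (\<lambda>x. 2 * B1 * indicator \<Omega> x :: real)" using \<Omega>_emeasure by simp
    have "T \<longlonglongrightarrow> (LINT x|L. 0)" unfolding T_def
    proof (rule integral_dominated_convergence[OF _ _ iO])
      show "AE x in L. (\<lambda>n. dev n x) \<longlonglongrightarrow> 0"
        unfolding dev_def using l by (intro AE_I2 tendsto_mult_right_zero tendsto_rabs_zero LIM_zero)
    qed (use Tdom in auto)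
    then have "\<forall>\<^sub>F n in sequentially. T n < e * V / 4"
      using \<open>0 < e\<close> V by (intro order_tendstoD) auto
    then obtain N where N: "\<And>n. n \<ge> N \<Longrightarrow> T n < e * V / 4" by (auto simp: eventually_sequentially)
    have Tint: "integrable L (\<lambda>x. dev n x)" for n
      by (rule Bochner_Integration.integrable_bound[OF iO]) (use Tdom in \<open>auto intro: order_trans[OF _ abs_ge_self]\<close>)
    have "(LINT x|L. norm (f (r n) x - f (r m) x)) < e" if nm: "n \<ge> N" "m \<ge> N" for n m
    proof -
      let ?w = "\<lambda>x. f (r n) x - f (r m) x"
      have w: "?w \<in> W" using f by (intro W_diff)
      have "E ?w \<le> 2 powr p * (E (f (r n)) + E (f (r m)))"
        using Lr_diff(2)[OF W_D(3)[OF f] W_D(3)[OF f]] p1 by (simp add: hquot_diff)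
      also have "\<dots> \<le> K2" unfolding K2_def using K by (intro mult_left_mono add_mono) auto
      finally have Ew: "E ?w \<le> K2" .
      have ab: "\<bar>ball_avg ?w (d j) (dl k)\<bar> \<le> 2 * B1 / V" for j
        unfolding avg VV using V Ibound[of "r n" "d j" "dl k"] Ibound[of "r m" "d j" "dl k"]
        by (simp add: divide_right_mono)
      have "(LINT x|L. norm (?w x)) \<le> \<theta> * vol + avg_const \<theta> (dl k) * E ?w
       + (LINT x|L. indicator \<Omega> x * \<bar>ball_avg ?w (d (i (dl k) x)) (dl k)\<bar>)"
        using L1_le_averages[OF w dl \<theta> im i ab] dl by simp
      also have "avg_const \<theta> (dl k) * E ?w \<le> avg_const \<theta> (dl k) * K2"
        using Ew dl[of k] by (intro mult_left_mono) (auto simp: avg_const_def)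
      also have "(LINT x|L. indicator \<Omega> x * \<bar>ball_avg ?w (d (i (dl k) x)) (dl k)\<bar>) \<le>
        (LINT x|L. 1 / V * (dev n x + dev m x))"
      proof (rule integral_mono')
        show "integrable L (\<lambda>x. 1 / V * (dev n x + dev m x))"
          using Tint by (intro integrable_mult_right Bochner_Integration.integrable_add) auto
        fix x
        have "\<bar>I (r n) (d (i (dl k) x)) (dl k) - I (r m) (d (i (dl k) x)) (dl k)\<bar> / V
          \<le> (\<bar>I (r n) (d (i (dl k) x)) (dl k) - l (i (dl k) x)\<bar> + \<bar>I (r m) (d (i (dl k) x)) (dl k) - l (i (dl k) x)\<bar>) / V"
          using V by (intro divide_right_mono) auto
        then show "indicator \<Omega> x * \<bar>ball_avg ?w (d (i (dl k) x)) (dl k)\<bar> \<le> 1 / V * (dev n x + dev m x)"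
          unfolding avg VV dev_def using V by (auto simp: indicator_def)
        show "0 \<le> 1 / V * (dev n x + dev m x)"
          using V by (auto simp: dev_def indicator_def)
      qed
      also have "(LINT x|L. 1 / V * (dev n x + dev m x)) = (T n + T m) / V"
        using Tint by (simp add: T_def)
      also have "(T n + T m) / V \<le> e / 2" using N nm V by (simp add: field_simps) (smt (verit))
      finally show ?thesis using lk by linarith
    qed
    then show ?thesis by blast
  qed
  obtain r' where r': "strict_mono r'" "AE x in L. Cauchy (\<lambda>n. f (r (r' n)) x)"
    using cauchy_L1_AE_cauchy_subseq[of L "\<lambda>n. f (r n)"] fint cauchy by auto
  define v where "v x = lim (\<lambda>n. f (r (r' n)) x)" for x
  have vm: "v \<in> borel_measurable L" unfolding v_def by measurable
  have lim: "AE x in L. (\<lambda>n. f (r (r' n)) x) \<longlonglongrightarrow> v x"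
    using r'(2) by eventually_elim (simp add: v_def Cauchy_convergent_iff convergent_LIMSEQ_iff)
  have "v \<in> W"
  proof -
    have "v \<in> Lr L pst"
      by (rule Lr_fatou(1)[where K = K, OF _ _ vm lim]) (use W_D(1)[OF f] K(2) p1 pst_gt_p in auto)
    moreover have "hq v \<in> Lr pairs p"
      by (rule Lr_fatou(1)[where K = K, OF _ _ _ AE_hquot_tendsto[OF lim]]) (use W_D(3)[OF f] K(1) p1 vm in auto)
    moreover have "AE x in L. x \<notin> \<Omega> \<longrightarrow> v x = 0"
    proof -
      have "AE x in L. \<forall>n. x \<notin> \<Omega> \<longrightarrow> f n x = 0" unfolding AE_all_countable using W_D(2)[OF f] by blast
      with lim show ?thesis by eventually_elim (auto simp: LIMSEQ_const_iff)
    qed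
    ultimately show ?thesis by (simp add: W_iff)
  qed
  moreover have "strict_mono (r \<circ> r')" using r(1) r'(1) by (rule strict_mono_o)
  ultimately show ?thesis using lim by (intro exI[of _ "r \<circ> r'"] exI[of _ v]) auto
qed

text \<open>
  The closure of the functions \<open>f n\<close>, \<open>n \<in> I\<close>, under midpoints, in place of their convex hull: uniform
  convexity speaks of midpoints only, and the relevant properties follow by rule induction.
\<close>
inductive_set midhull :: "(nat \<Rightarrow> 'a \<Rightarrow> real) \<Rightarrow> nat set \<Rightarrow> ('a \<Rightarrow> real) set" for f I where
  base: "n \<in> I \<Longrightarrow> f n \<in> midhull f I"
| mid: "y \<in> midhull f I \<Longrightarrow> z \<in> midhull f I \<Longrightarrow> (\<lambda>x. 1 / 2 * (y x + z x)) \<in> midhull f I"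

lemma midhull_mono: "y \<in> midhull f I \<Longrightarrow> I \<subseteq> J \<Longrightarrow> y \<in> midhull f J"
  by (induction rule: midhull.induct) (blast intro: midhull.intros)+

lemma midhull_bound: "y \<in> midhull f I \<Longrightarrow> (\<And>n. n \<in> I \<Longrightarrow> \<bar>f n x\<bar> \<le> e) \<Longrightarrow> \<bar>y x\<bar> \<le> e"
proof (induction rule: midhull.induct)
  case (mid y z)
  then have "\<bar>y x\<bar> \<le> e" "\<bar>z x\<bar> \<le> e" by auto
  then show ?case by simp
qed auto

lemma midhull_W: "y \<in> midhull f I \<Longrightarrow> (\<And>n. f n \<in> W) \<Longrightarrow> y \<in> W"
proof (induction rule: midhull.induct)
  case (mid y z)
  then have "(\<lambda>x. y x + z x) \<in> W" by (blast intro: W_add)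
  then show ?case by (rule W_scale)
qed auto

text \<open>
  Suppose \<open>\<Lambda> (f n) \<ge> \<delta>\<close> for infinitely many \<open>n\<close>.  By linearity \<open>\<Lambda> \<ge> \<delta>\<close> on the midpoint closures
  \<open>H m\<close> of the tails.  The infima of the energy over \<open>H m\<close> increase to a finite limit, so by uniform
  convexity almost minimal elements \<open>y m\<close> form a Cauchy sequence for the energy.  They tend to \<open>0\<close>
  almost everywhere, being bounded by the suprema of the tails; Fatou's lemma applied to \<open>y m - y k\<close>
  shows that \<open>E (y m)\<close> tends to \<open>0\<close>, which contradicts the continuity of \<open>\<Lambda>\<close>.
\<close>
lemma bounded_linear_null_limit:
  fixes f :: "nat \<Rightarrow> 'a \<Rightarrow> real" and K :: real
  assumes f: "\<And>n. f n \<in> W" and K: "\<And>n. E (f n) \<le> K"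
    and lim: "AE x in L. (\<lambda>n. f n x) \<longlonglongrightarrow> 0" and Lin: "W0_bounded_linear s p \<Omega> \<Lambda>"
    and \<delta>: "0 < \<delta>"
  shows "\<forall>\<^sub>F n in sequentially. \<Lambda> (f n) < \<delta>"
proof (rule ccontr)
  assume "\<not> ?thesis"
  then have freq: "\<exists>n\<ge>m. \<delta> \<le> \<Lambda> (f n)" for m
    unfolding eventually_sequentially by (meson not_le)
  have add: "\<And>u v. u \<in> W \<Longrightarrow> v \<in> W \<Longrightarrow> \<Lambda> (\<lambda>x. u x + v x) = \<Lambda> u + \<Lambda> v"
    and scl: "\<And>u a. u \<in> W \<Longrightarrow> \<Lambda> (\<lambda>x. a * u x) = a * \<Lambda> u"
    using Lin by (auto simp: W0_bounded_linear_def)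
  obtain C where C: "\<And>u. u \<in> W \<Longrightarrow> \<bar>\<Lambda> u\<bar> \<le> C * gagliardo s p u"
    using Lin unfolding W0_bounded_linear_def by blast
  define Im where "Im m = {n. m \<le> n \<and> \<delta> \<le> \<Lambda> (f n)}" for m
  define H where "H m = midhull f (Im m)" for m
  have Hne: "H m \<noteq> {}" for m using freq[of m] by (auto simp: H_def Im_def intro: midhull.base)
  have HW: "y \<in> W" if "y \<in> H m" for y m using that f midhull_W by (auto simp: H_def)
  have H\<delta>: "\<delta> \<le> \<Lambda> y" if "y \<in> H m" for y m
    using that unfolding H_def
  proof (induction rule: midhull.induct)
    case (mid y z)
    have "\<Lambda> (\<lambda>x. 1 / 2 * (y x + z x)) = 1 / 2 * (\<Lambda> y + \<Lambda> z)"
      using HW[of _ m] mid by (subst scl) (auto simp: add H_def intro: W_add)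
    then show ?case using mid by simp
  qed (auto simp: Im_def)
  have Hmono: "y \<in> H m" if "y \<in> H k" "m \<le> k" for y m k
    using that by (auto simp: H_def Im_def intro: midhull_mono)
  define dm where "dm m = Inf (E ` H m)" for m
  have bdd: "bdd_below (E ` H m)" for m by (intro bdd_belowI[of _ 0]) auto
  have dm_le: "dm m \<le> E y" if "y \<in> H m" for y m unfolding dm_def using that bdd by (intro cInf_lower) auto
  have dmK: "dm m \<le> K" for m
  proof -
    obtain n where "n \<in> Im m" using freq[of m] by (auto simp: Im_def)
    then have "dm m \<le> E (f n)" by (intro dm_le) (auto simp: H_def intro: midhull.base)
    then show ?thesis using K[of n] by linarith
  qed
  have "incseq dm" unfolding incseq_def dm_def
    using Hne bdd by (intro allI impI cInf_superset_mono) (auto intro: Hmono)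
  then obtain d where d: "dm \<longlonglongrightarrow> d" "\<And>m. dm m \<le> d"
    using incseq_convergent[of dm K] dmK by auto
  have "\<exists>y\<in>H m. E y < dm m + inverse (real (Suc m))" for m
  proof -
    have "Inf (E ` H m) < dm m + inverse (real (Suc m))" by (simp add: dm_def)
    then show ?thesis using cInf_lessD[of "E ` H m"] Hne by auto
  qed
  then obtain y where y: "\<And>m. y m \<in> H m" "\<And>m. E (y m) < dm m + inverse (real (Suc m))" by metis
  have yW: "y m \<in> W" for m using HW y by blast
  have ylim: "AE x in L. (\<lambda>m. y m x) \<longlonglongrightarrow> 0"
    using lim
  proof eventually_elim
    case (elim x)
    show ?case
    proof (rule LIMSEQ_I)
      fix e :: real assume "0 < e"
      then obtain N where N: "\<And>n. n \<ge> N \<Longrightarrow> \<bar>f n x\<bar> < e / 2"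
        using LIMSEQ_D[OF elim, of "e / 2"] by auto
      have "norm (y m x - 0) < e" if "m \<ge> N" for m
      proof -
        have "\<bar>y m x\<bar> \<le> e / 2"
        proof (rule midhull_bound[OF y(1)[of m, unfolded H_def]])
          fix n assume "n \<in> Im m"
          then have "n \<ge> N" using that by (auto simp: Im_def)
          then show "\<bar>f n x\<bar> \<le> e / 2" using N[of n] by simp
        qed
        then show ?thesis using \<open>0 < e\<close> by simp
      qed
      then show "\<exists>no. \<forall>n\<ge>no. norm (y n x - 0) < e" by blast
    qed
  qed
  define B where "B = d + 1"
  have yB: "E (y m) \<le> B" for m
  proof -
    have "inverse (real (Suc m)) \<le> 1" by (simp add: field_simps)
    then show ?thesis using y(2)[of m] d(2)[of m] by (simp add: B_def)
  qed
  define \<tau> where "\<tau> m = (d - dm m) / 2 + inverse (real (Suc m))" for m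
  have \<tau>0: "\<tau> \<longlonglongrightarrow> (d - d) / 2 + 0" unfolding \<tau>_def
    by (intro tendsto_add tendsto_divide tendsto_diff tendsto_const d LIMSEQ_inverse_real_of_nat) auto
  have gap: "(E (y m) + E (y k)) / 2 - E (\<lambda>x. 1 / 2 * (y m x + y k x)) \<le> \<tau> m" if "m \<le> k" for m k
  proof -
    have "(\<lambda>x. 1 / 2 * (y m x + y k x)) \<in> H m"
      using y(1)[of m] Hmono[OF y(1)[of k] that] unfolding H_def by (rule midhull.mid)
    then have 1: "dm m \<le> E (\<lambda>x. 1 / 2 * (y m x + y k x))" by (rule dm_le)
    have 2: "inverse (real (Suc k)) \<le> inverse (real (Suc m))" using that by (simp add: field_simps)
    have "E (y m) + E (y k) \<le> dm m + d + 2 * inverse (real (Suc m))"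
      using y(2)[of m] y(2)[of k] d(2)[of k] 2 by linarith
    then show ?thesis using 1 unfolding \<tau>_def by argo
  qed
  have "(\<lambda>m. E (y m)) \<longlonglongrightarrow> 0"
  proof (rule LIMSEQ_I)
    fix e :: real assume e: "0 < e"
    define \<eta> where "\<eta> = e / (4 * (\<bar>B\<bar> + 1))"
    have \<eta>0: "0 < \<eta>" using e by (simp add: \<eta>_def)
    have "\<eta> * (B + B) \<le> \<eta> * (2 * (\<bar>B\<bar> + 1))" using \<eta>0 by (intro mult_left_mono) auto
    also have "\<dots> = e / 2" unfolding \<eta>_def by (simp add: divide_simps)
    finally have \<eta>: "0 < \<eta>" "\<eta> * (B + B) \<le> e / 2" using \<eta>0 by auto
    obtain C' where C': "C' \<ge> 0" "\<And>u v. u \<in> Lr pairs p \<Longrightarrow> v \<in> Lr pairs p \<Longrightarrow>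
      modular pairs p (\<lambda>x. u x - v x) \<le> \<eta> * (modular pairs p u + modular pairs p v)
      + C' * ((modular pairs p u + modular pairs p v) / 2 - modular pairs p (\<lambda>x :: 'a \<times> 'a. (u x + v x) / 2))"
      using modular_uniform_convexity[OF p1 \<eta>(1), of "pairs :: ('a \<times> 'a) measure"] by blast
    have "(\<lambda>m. C' * \<tau> m) \<longlonglongrightarrow> C' * ((d - d) / 2 + 0)" by (intro tendsto_mult tendsto_const \<tau>0)
    then have "\<forall>\<^sub>F m in sequentially. C' * \<tau> m < e / 2" using e by (intro order_tendstoD) auto
    then obtain N where N: "\<And>m. m \<ge> N \<Longrightarrow> C' * \<tau> m < e / 2" by (auto simp: eventually_sequentially)
    have "norm (E (y m) - 0) < e" if "m \<ge> N" for m
    proof -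
      have diff: "E (\<lambda>x. y m x - y k x) \<le> \<eta> * (B + B) + C' * \<tau> m" if "m \<le> k" for k
      proof -
        have "E (\<lambda>x. y m x - y k x) \<le> \<eta> * (E (y m) + E (y k))
          + C' * ((E (y m) + E (y k)) / 2 - E (\<lambda>x. 1 / 2 * (y m x + y k x)))"
          unfolding hquot_diff hquot_scale hquot_add using C'(2)[OF W_D(3)[OF yW[of m]] W_D(3)[OF yW[of k]]] by simp
        also have "\<dots> \<le> \<eta> * (B + B) + C' * \<tau> m"
          using yB gap[OF that] \<eta>(1) C'(1) by (intro add_mono mult_left_mono) auto
        finally show ?thesis .
      qed
      have "E (y m) \<le> \<eta> * (B + B) + C' * \<tau> m"
      proof (rule Lr_fatou(2))
        show "hq (\<lambda>x. y m x - y k x) \<in> Lr pairs p" for k using yW by (intro W_D W_diff)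
        show "\<forall>\<^sub>F k in sequentially. E (\<lambda>x. y m x - y k x) \<le> \<eta> * (B + B) + C' * \<tau> m"
          using diff by (auto simp: eventually_sequentially)
        show "hq (y m) \<in> borel_measurable pairs" using W_D(3)[OF yW] by (rule Lr_measurable)
        have "AE x in L. (\<lambda>k. y m x - y k x) \<longlonglongrightarrow> y m x"
          using ylim
        proof eventually_elim
          case (elim x)
          show ?case using tendsto_diff[OF tendsto_const elim, of "y m x"] by simp
        qed
        then show "AE z in pairs. (\<lambda>k. hq (\<lambda>x. y m x - y k x) z) \<longlonglongrightarrow> hq (y m) z" by (rule AE_hquot_tendsto)
      qed (use p1 in auto)
      then show ?thesis using N[OF that] \<eta>(2) by simp
    qed
    then show "\<exists>no. \<forall>n\<ge>no. norm (E (y n) - 0) < e" by blast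
  qed
  then have "(\<lambda>m. E (y m) powr (1 / p)) \<longlonglongrightarrow> 0 powr (1 / p)" using p1 by (intro tendsto_powr') auto
  then have "(\<lambda>m. C * gagliardo s p (y m)) \<longlonglongrightarrow> C * 0" unfolding gagliardo_eq by (intro tendsto_mult tendsto_const) simp
  then have "\<forall>\<^sub>F m in sequentially. C * gagliardo s p (y m) < \<delta>" using \<delta> by (intro order_tendstoD) auto
  then obtain m where "C * gagliardo s p (y m) < \<delta>" by (auto simp: eventually_sequentially)
  moreover have "\<delta> \<le> C * gagliardo s p (y m)" using H\<delta>[OF y(1)[of m]] C[OF yW[of m]] by linarith
  ultimately show False by simp
qed

lemma weak_convergence_of_AE:
  fixes f :: "nat \<Rightarrow> 'a \<Rightarrow> real" and K :: real
  assumes f: "\<And>n. f n \<in> W" and K: "\<And>n. E (f n) \<le> K" and v: "v \<in> W"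
    and lim: "AE x in L. (\<lambda>n. f n x) \<longlonglongrightarrow> v x"
  shows "W0_weak_tendsto s p \<Omega> f v"
  unfolding W0_weak_tendsto_def
proof (intro allI impI)
  fix \<Lambda> assume Lin: "W0_bounded_linear s p \<Omega> \<Lambda>"
  define w where "w n x = f n x - v x" for n x
  have wW: "w n \<in> W" for n unfolding w_def by (intro W_diff f v)
  have wK: "E (w n) \<le> 2 powr p * (K + E v)" for n
  proof -
    have "E (w n) \<le> 2 powr p * (E (f n) + E v)"
      unfolding w_def hquot_diff using Lr_diff(2)[OF W_D(3)[OF f] W_D(3)[OF v]] p1 by simp
    also have "\<dots> \<le> 2 powr p * (K + E v)" using K by (intro mult_left_mono) auto
    finally show ?thesis .
  qed
  have wlim: "AE x in L. (\<lambda>n. w n x) \<longlonglongrightarrow> 0"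
    using lim by eventually_elim (simp add: w_def LIM_zero)
  have add: "\<And>u v. u \<in> W \<Longrightarrow> v \<in> W \<Longrightarrow> \<Lambda> (\<lambda>x. u x + v x) = \<Lambda> u + \<Lambda> v"
    using Lin by (auto simp: W0_bounded_linear_def)
  have Lw: "\<Lambda> (w n) = \<Lambda> (f n) - \<Lambda> v" for n using add[OF wW[of n] v] by (simp add: w_def)
  have neg: "W0_bounded_linear s p \<Omega> (\<lambda>u. - \<Lambda> u)"
    using Lin by (auto simp: W0_bounded_linear_def)
  show "(\<lambda>n. \<Lambda> (f n)) \<longlonglongrightarrow> \<Lambda> v"
  proof (rule tendstoI)
    fix e :: real assume e: "0 < e"
    show "\<forall>\<^sub>F n in sequentially. dist (\<Lambda> (f n)) (\<Lambda> v) < e"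
      using bounded_linear_null_limit[OF wW wK wlim Lin e] bounded_linear_null_limit[OF wW wK wlim neg e]
      by eventually_elim (auto simp: dist_real_def Lw)
  qed
qed

end

section \<open>Weak solutions: sign and positivity\<close>

context frac_sobolev
begin

text \<open>
  The pairing of the fractional \<open>p\<close>-Laplacian of \<open>u\<close> with \<open>\<phi>\<close>.
\<close>
definition plap :: "('a \<Rightarrow> real) \<Rightarrow> ('a \<Rightarrow> real) \<Rightarrow> real" where
  "plap u \<phi> = (LINT z|pairs. spow (p - 1) (hq u z) * hq \<phi> z)"

definition nonlin :: "real \<Rightarrow> ('a \<Rightarrow> real) \<Rightarrow> ('a \<Rightarrow> real) \<Rightarrow> real" where
  "nonlin q u \<phi> = (LINT x|L. spow (q - 1) (u x) * \<phi> x)"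

definition euler_lagrange :: "real \<Rightarrow> ('a \<Rightarrow> real) \<Rightarrow> bool" where
  "euler_lagrange q u \<longleftrightarrow> u \<in> W \<and> (\<forall>\<phi>\<in>W. plap u \<phi> = nonlin q u \<phi>)"

lemma energy_eq:
  assumes u: "u \<in> W"
  shows "energy s p \<Omega> \<epsilon> u = 1 / p * E u - 1 / (pst - \<epsilon>) * modular L (pst - \<epsilon>) u"
proof -
  have [measurable]: "u \<in> borel_measurable L" using u by (rule W_D)
  have "(LINT x:\<Omega>|L. \<bar>u x\<bar> powr (pst - \<epsilon>)) = modular L (pst - \<epsilon>) u"
    unfolding set_lebesgue_integral_def modular_def
  proof (rule integral_cong_AE)
    show "AE x in L. indicator \<Omega> x *\<^sub>R \<bar>u x\<bar> powr (pst - \<epsilon>) = \<bar>u x\<bar> powr (pst - \<epsilon>)"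
      using W_D(2)[OF u] by eventually_elim (auto simp: indicator_def)
  qed measurable
  then show ?thesis using p1 by (simp add: energy_def gagliardo_pow_eq_energy_pow pst_def)
qed

text \<open>
  The energy is a combination of a \<open>p\<close>-th power in \<open>L\<^sup>p\<close> of the product space and a \<open>q\<close>-th power in \<open>L\<^sup>q\<close>,
  and \<open>modular_first_order\<close> applies to both.
\<close>
lemma energy_expansion:
  assumes q: "1 < q" "q \<le> pst" and \<eta>: "0 < \<eta>"
  shows "\<exists>C\<ge>0. \<forall>u\<in>W. \<forall>\<phi>\<in>W.
    \<bar>energy s p \<Omega> (pst - q) (\<lambda>x. u x + \<phi> x) - energy s p \<Omega> (pst - q) u - (plap u \<phi> - nonlin q u \<phi>)\<bar>
    \<le> \<eta> * (E u powr (1 - 1 / p) * E \<phi> powr (1 / p) + modular L q u powr (1 - 1 / q) * modular L q \<phi> powr (1 / q))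
      + C * (E \<phi> + modular L q \<phi>)"
proof -
  obtain C1 where C1: "C1 \<ge> 0" "\<And>f g :: 'a \<times> 'a \<Rightarrow> real. f \<in> Lr pairs p \<Longrightarrow> g \<in> Lr pairs p \<Longrightarrow>
    \<bar>modular pairs p (\<lambda>x. f x + g x) - modular pairs p f - p * (LINT x|pairs. spow (p - 1) (f x) * g x)\<bar>
     \<le> \<eta> * (modular pairs p f powr (1 - 1 / p) * modular pairs p g powr (1 / p)) + C1 * modular pairs p g"
    using modular_first_order[OF p1 \<eta>, of "pairs :: ('a \<times> 'a) measure"] by blast
  obtain C2 where C2: "C2 \<ge> 0" "\<And>f g :: 'a \<Rightarrow> real. f \<in> Lr L q \<Longrightarrow> g \<in> Lr L q \<Longrightarrow>
    \<bar>modular L q (\<lambda>x. f x + g x) - modular L q f - q * (LINT x|L. spow (q - 1) (f x) * g x)\<bar>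
     \<le> \<eta> * (modular L q f powr (1 - 1 / q) * modular L q g powr (1 / q)) + C2 * modular L q g"
    using modular_first_order[OF q(1) \<eta>, of L] by blast
  have scaled: "\<bar>1 / r * a - 1 / r * b - d\<bar> \<le> X" if "1 < r" "\<bar>a - b - r * d\<bar> \<le> X" for r a b d X :: real
  proof -
    have "\<bar>1 / r * a - 1 / r * b - d\<bar> = \<bar>a - b - r * d\<bar> / r" using that(1) by (simp add: field_simps abs_if)
    also have "\<dots> \<le> \<bar>a - b - r * d\<bar>" using that(1) by (simp add: divide_le_eq mult_le_cancel_left1)
    finally show ?thesis using that(2) by linarith
  qed
  show ?thesis
  proof (intro exI[of _ "C1 + C2"] conjI ballI)
    show "0 \<le> C1 + C2" using C1 C2 by simp
    fix u \<phi> assume u: "u \<in> W" and \<phi>: "\<phi> \<in> W"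
    define X where "X = \<eta> * (E u powr (1 - 1 / p) * E \<phi> powr (1 / p))"
    define Y where "Y = \<eta> * (modular L q u powr (1 - 1 / q) * modular L q \<phi> powr (1 / q))"
    have 1: "\<bar>1 / p * E (\<lambda>x. u x + \<phi> x) - 1 / p * E u - plap u \<phi>\<bar> \<le> X + C1 * E \<phi>"
      using C1(2)[OF W_D(3)[OF u] W_D(3)[OF \<phi>]] p1 by (intro scaled) (auto simp: plap_def hquot_add X_def)
    have qL: "u \<in> Lr L q" "\<phi> \<in> Lr L q" using u \<phi> q by (auto intro: W_Lr)
    have 2: "\<bar>1 / q * modular L q (\<lambda>x. u x + \<phi> x) - 1 / q * modular L q u - nonlin q u \<phi>\<bar> \<le> Y + C2 * modular L q \<phi>"
      using C2(2)[OF qL] q by (intro scaled) (auto simp: nonlin_def Y_def)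
    have "\<bar>energy s p \<Omega> (pst - q) (\<lambda>x. u x + \<phi> x) - energy s p \<Omega> (pst - q) u - (plap u \<phi> - nonlin q u \<phi>)\<bar>
      \<le> (X + C1 * E \<phi>) + (Y + C2 * modular L q \<phi>)"
      using 1 2 unfolding energy_eq[OF u] energy_eq[OF W_add[OF u \<phi>]] by (simp add: abs_le_iff)
    also have "\<dots> \<le> X + Y + (C1 + C2) * (E \<phi> + modular L q \<phi>)"
      using C1(1) C2(1) by (simp add: algebra_simps)
    finally show "\<bar>energy s p \<Omega> (pst - q) (\<lambda>x. u x + \<phi> x) - energy s p \<Omega> (pst - q) u - (plap u \<phi> - nonlin q u \<phi>)\<bar>
      \<le> \<eta> * (E u powr (1 - 1 / p) * E \<phi> powr (1 / p) + modular L q u powr (1 - 1 / q) * modular L q \<phi> powr (1 / q))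
      + (C1 + C2) * (E \<phi> + modular L q \<phi>)"
      by (simp add: X_def Y_def distrib_left)
  qed
qed

lemma plap_scale: "plap u (\<lambda>x. a * \<phi> x) = a * plap u \<phi>"
  by (simp add: plap_def hquot_scale mult.left_commute)

lemma nonlin_scale: "nonlin q u (\<lambda>x. a * \<phi> x) = a * nonlin q u \<phi>"
  by (simp add: nonlin_def mult.left_commute)

text \<open>
  Differentiate along \<open>t \<phi>\<close>: after division by \<open>t\<close> the remainder of \<open>energy_expansion\<close> is a small
  multiple of a constant plus terms of order \<open>t^(p - 1)\<close> and \<open>t^(q - 1)\<close>.
\<close>
lemma euler_lagrange_of_weak_solution:
  assumes sol: "weak_solution s p \<Omega> \<epsilon> u" and \<epsilon>: "0 \<le> \<epsilon>" "p < pst - \<epsilon>"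
  shows "euler_lagrange (pst - \<epsilon>) u"
proof -
  define q where "q = pst - \<epsilon>"
  have q: "1 < q" "q \<le> pst" "\<epsilon> = pst - q" using \<epsilon> p1 by (auto simp: q_def)
  have u: "u \<in> W" and der: "\<And>e. e > 0 \<Longrightarrow> \<exists>d>0. \<forall>v\<in>W. gagliardo s p v < d \<longrightarrow>
        \<bar>energy s p \<Omega> \<epsilon> (\<lambda>x. u x + v x) - energy s p \<Omega> \<epsilon> u\<bar> \<le> e * gagliardo s p v"
    using sol by (auto simp: weak_solution_def critical_point_def W0_has_derivative_def)
  have "plap u \<phi> - nonlin q u \<phi> = 0" if \<phi>: "\<phi> \<in> W" for \<phi>
  proof -
    define D where "D = plap u \<phi> - nonlin q u \<phi>"
    define g where "g = gagliardo s p \<phi>"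
    define K where "K = g + E u powr (1 - 1 / p) * g + modular L q u powr (1 - 1 / q) * modular L q \<phi> powr (1 / q)"
    have g0: "0 \<le> g" by (simp add: g_def gagliardo_eq)
    have K0: "0 \<le> K" using g0 by (simp add: K_def)
    have qL: "\<phi> \<in> Lr L q" using \<phi> q by (auto intro: W_Lr)
    have main: "\<bar>D\<bar> \<le> \<eta> * K" if \<eta>: "0 < \<eta>" for \<eta>
    proof -
      obtain d where d: "0 < d" "\<And>v. v \<in> W \<Longrightarrow> gagliardo s p v < d \<Longrightarrow>
        \<bar>energy s p \<Omega> \<epsilon> (\<lambda>x. u x + v x) - energy s p \<Omega> \<epsilon> u\<bar> \<le> \<eta> * gagliardo s p v"
        using der[OF \<eta>] by blast
      obtain C where C: "0 \<le> C" "\<And>v. v \<in> W \<Longrightarrow>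
        \<bar>energy s p \<Omega> \<epsilon> (\<lambda>x. u x + v x) - energy s p \<Omega> \<epsilon> u - (plap u v - nonlin q u v)\<bar>
        \<le> \<eta> * (E u powr (1 - 1 / p) * E v powr (1 / p) + modular L q u powr (1 - 1 / q) * modular L q v powr (1 / q))
          + C * (E v + modular L q v)"
        using energy_expansion[OF q(1,2) \<eta>] u q(3) by blast
      define h where "h t = \<eta> * K + C * (t powr (p - 1) * E \<phi> + t powr (q - 1) * modular L q \<phi>)" for t :: real
      have bound: "\<bar>D\<bar> \<le> h t" if t: "0 < t" "t * g < d" for t
      proof -
        let ?v = "\<lambda>x. t * \<phi> x"
        have v: "?v \<in> W" using \<phi> by (rule W_scale)
        have Ev: "E ?v = t powr p * E \<phi>" using E_scale[OF \<phi>, of t] t by simp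
        have gv: "gagliardo s p ?v = t * g"
          using t p1 by (simp add: gagliardo_eq Ev g_def powr_mult powr_powr)
        have mv: "modular L q ?v = t powr q * modular L q \<phi>" using Lr_scale(2)[OF qL, of t] t by simp
        have mv1: "modular L q ?v powr (1 / q) = t * modular L q \<phi> powr (1 / q)"
          using t q by (simp add: mv powr_mult powr_powr)
        have Ev1: "E ?v powr (1 / p) = t * g" using gv by (simp add: gagliardo_eq)
        have "\<bar>t * D\<bar> \<le> \<bar>energy s p \<Omega> \<epsilon> (\<lambda>x. u x + ?v x) - energy s p \<Omega> \<epsilon> u\<bar>
          + \<bar>energy s p \<Omega> \<epsilon> (\<lambda>x. u x + ?v x) - energy s p \<Omega> \<epsilon> u - t * D\<bar>" by linarith
        also have "\<dots> \<le> \<eta> * (t * g) + (\<eta> * (E u powr (1 - 1 / p) * (t * g) + modular L q u powr (1 - 1 / q) * (t * modular L q \<phi> powr (1 / q)))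
          + C * (t powr p * E \<phi> + t powr q * modular L q \<phi>))"
        proof (rule add_mono)
          show "\<bar>energy s p \<Omega> \<epsilon> (\<lambda>x. u x + ?v x) - energy s p \<Omega> \<epsilon> u\<bar> \<le> \<eta> * (t * g)"
            using d(2)[OF v] t(2) unfolding gv by simp
          have tD: "plap u ?v - nonlin q u ?v = t * D"
            by (simp add: plap_scale nonlin_scale D_def right_diff_distrib)
          show "\<bar>energy s p \<Omega> \<epsilon> (\<lambda>x. u x + ?v x) - energy s p \<Omega> \<epsilon> u - t * D\<bar>
            \<le> \<eta> * (E u powr (1 - 1 / p) * (t * g) + modular L q u powr (1 - 1 / q) * (t * modular L q \<phi> powr (1 / q)))
              + C * (t powr p * E \<phi> + t powr q * modular L q \<phi>)"
            using C(2)[OF v] unfolding tD Ev1 mv1 unfolding Ev mv .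
        qed
        also have "\<dots> = t * h t"
        proof -
          have "t powr p = t * t powr (p - 1)" "t powr q = t * t powr (q - 1)"
            using t powr_mult_base[of t "p - 1"] powr_mult_base[of t "q - 1"] by auto
          then show ?thesis by (simp add: h_def K_def algebra_simps)
        qed
        finally show ?thesis using t by (simp add: abs_mult)
      qed
      have "(h \<longlongrightarrow> \<eta> * K + C * (0 powr (p - 1) * E \<phi> + 0 powr (q - 1) * modular L q \<phi>)) (at_right 0)"
        unfolding h_def using p1 q(1)
        by (intro tendsto_intros tendsto_powr' ) (auto simp: eventually_at_right_less intro: eventually_mono[OF eventually_at_right_less])
      then have lim: "(h \<longlongrightarrow> \<eta> * K) (at_right 0)" by simp
      have ev: "\<forall>\<^sub>F t in at_right 0. \<bar>D\<bar> \<le> h t"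
      proof -
        have "0 < d / (g + 1)" using d(1) g0 by simp
        then have "\<forall>\<^sub>F t in at_right (0::real). 0 < t \<and> t < d / (g + 1)"
          by (intro eventually_conj eventually_at_right_less) (auto simp: eventually_at_right_field)
        then show ?thesis
        proof eventually_elim
          case (elim t)
          then have "t * (g + 1) < d" using g0 by (simp add: pos_less_divide_eq)
          then have "t * g < d" using elim by (simp add: distrib_left)
          then show ?case using bound elim by simp
        qed
      qed
      show ?thesis by (rule tendsto_lowerbound[OF lim ev]) simp
    qed
    have "\<bar>D\<bar> \<le> 0"
    proof (rule field_le_epsilon)
      fix e :: real assume e: "0 < e"
      have "\<bar>D\<bar> \<le> e / (K + 1) * K" using K0 e by (intro main) simp
      also have "\<dots> \<le> e" using K0 e by (simp add: field_simps)
      finally show "\<bar>D\<bar> \<le> 0 + e" by simp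
    qed
    then show ?thesis by (simp add: D_def)
  qed
  then show ?thesis using u by (auto simp: euler_lagrange_def q_def)
qed

text \<open>
  Once the first-order terms cancel, the remainder of \<open>energy_expansion\<close> is \<open>o(gagliardo s p \<phi>)\<close>,
  because the Sobolev inequality bounds the critical norm of \<open>\<phi>\<close> by its seminorm.
\<close>
lemma weak_solution_of_euler_lagrange:
  assumes EL: "euler_lagrange pst v" and S: "0 < S"
  shows "weak_solution s p \<Omega> 0 v"
proof -
  have v: "v \<in> W" and D0: "\<And>\<phi>. \<phi> \<in> W \<Longrightarrow> plap v \<phi> - nonlin pst v \<phi> = 0"
    using EL by (auto simp: euler_lagrange_def)
  have q: "1 < pst" "pst \<le> pst" using p1 pst_gt_p by auto
  have bl: "W0_bounded_linear s p \<Omega> (\<lambda>_. 0)"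
    by (auto simp: W0_bounded_linear_def intro!: exI[of _ 0])
  have "\<exists>d>0. \<forall>\<phi>\<in>W. gagliardo s p \<phi> < d \<longrightarrow>
        \<bar>energy s p \<Omega> 0 (\<lambda>x. v x + \<phi> x) - energy s p \<Omega> 0 v - 0\<bar> \<le> e * gagliardo s p \<phi>" if e: "0 < e" for e
  proof -
    define a b c where "a = E v powr (1 - 1 / p)" and "b = modular L pst v powr (1 - 1 / pst)"
      and "c = S powr (- 1 / p)"
    have abc: "0 \<le> a" "0 \<le> b" "0 \<le> c" by (auto simp: a_def b_def c_def)
    define \<eta> where "\<eta> = e / (2 * (a + b * c + 1))"
    have ab1: "0 < a + b * c + 1" using abc by (simp add: add_nonneg_pos)
    have \<eta>: "0 < \<eta>" using e ab1 by (simp add: \<eta>_def)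
    have "\<eta> * (a + b * c) \<le> \<eta> * (a + b * c + 1)" using \<eta> by (intro mult_left_mono) auto
    also have "\<dots> = e / 2" using ab1 by (simp add: \<eta>_def field_simps)
    finally have \<eta>e: "\<eta> * (a + b * c) \<le> e / 2" .
    obtain C where C: "0 \<le> C" "\<And>\<phi>. \<phi> \<in> W \<Longrightarrow>
        \<bar>energy s p \<Omega> (pst - pst) (\<lambda>x. v x + \<phi> x) - energy s p \<Omega> (pst - pst) v - (plap v \<phi> - nonlin pst v \<phi>)\<bar>
        \<le> \<eta> * (a * E \<phi> powr (1 / p) + b * modular L pst \<phi> powr (1 / pst)) + C * (E \<phi> + modular L pst \<phi>)"
      using energy_expansion[OF q \<eta>] v unfolding a_def b_def by blast
    define h where "h t = C * (t powr (p - 1) + c powr pst * t powr (pst - 1))" for t :: real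
    have "(h \<longlongrightarrow> C * (0 powr (p - 1) + c powr pst * 0 powr (pst - 1))) (at_right 0)"
      unfolding h_def using p1 q(1)
      by (intro tendsto_intros tendsto_powr') (auto simp: eventually_at_right_less intro: eventually_mono[OF eventually_at_right_less])
    then have "(h \<longlongrightarrow> 0) (at_right 0)" by simp
    then have "\<forall>\<^sub>F t in at_right 0. h t < e / 2" using e by (intro order_tendstoD) auto
    then obtain d where d: "0 < d" "\<And>t. 0 < t \<Longrightarrow> t < d \<Longrightarrow> h t < e / 2"
      by (auto simp: eventually_at_right_field)
    show ?thesis
    proof (intro exI[of _ d] conjI ballI impI d(1))
      fix \<phi> assume \<phi>: "\<phi> \<in> W" and lt: "gagliardo s p \<phi> < d"
      define g where "g = gagliardo s p \<phi>"
      have g0: "0 \<le> g" by (simp add: g_def gagliardo_eq)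
      have Eg: "E \<phi> powr (1 / p) = g" "E \<phi> = g powr p" using p1 by (auto simp: g_def gagliardo_eq powr_powr)
      have "modular L pst \<phi> \<le> (E \<phi> / S) powr (pst / p)"
        using subcritical_sobolev[OF \<phi> _ _ S, of pst] q vol_pos by simp
      also have "\<dots> = (c * g) powr pst"
      proof -
        have "(c * g) powr pst = S powr (- pst / p) * g powr pst"
          using g0 by (simp add: powr_mult c_def powr_powr)
        moreover have "(E \<phi> / S) powr (pst / p) = g powr pst / S powr (pst / p)"
          using S p1 g0 unfolding Eg(2) by (simp add: powr_divide powr_powr)
        ultimately show ?thesis using powr_minus_divide[of S "pst / p"] by simp
      qed
      finally have m: "modular L pst \<phi> \<le> (c * g) powr pst" .
      then have "modular L pst \<phi> powr (1 / pst) \<le> ((c * g) powr pst) powr (1 / pst)"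
        using q by (intro powr_mono2) auto
      also have "\<dots> = c * g" using q abc g0 by (simp add: powr_powr)
      finally have m1: "modular L pst \<phi> powr (1 / pst) \<le> c * g" .
      have "\<bar>energy s p \<Omega> 0 (\<lambda>x. v x + \<phi> x) - energy s p \<Omega> 0 v - 0\<bar>
        \<le> \<eta> * (a * g + b * modular L pst \<phi> powr (1 / pst)) + C * (g powr p + modular L pst \<phi>)"
        using C(2)[OF \<phi>] unfolding D0[OF \<phi>] Eg(1) unfolding Eg(2) by simp
      also have "\<dots> \<le> \<eta> * (a * g + b * (c * g)) + C * (g powr p + (c * g) powr pst)"
        using \<eta> abc C(1) m m1 by (intro add_mono mult_left_mono) auto
      also have "\<dots> = \<eta> * (a + b * c) * g + h g * g"
        using g0 abc powr_mult_base[of g "p - 1"] powr_mult_base[of g "pst - 1"]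
        by (simp add: h_def algebra_simps powr_mult)
      also have "\<dots> \<le> e / 2 * g + e / 2 * g"
      proof (cases "g = 0")
        case False
        then have "h g < e / 2" using d(2)[of g] g0 lt by (simp add: g_def)
        then show ?thesis using \<eta>e g0 by (intro add_mono mult_right_mono) auto
      qed simp
      finally show "\<bar>energy s p \<Omega> 0 (\<lambda>x. v x + \<phi> x) - energy s p \<Omega> 0 v - 0\<bar> \<le> e * gagliardo s p \<phi>"
        by (simp add: g_def)
    qed
  qed
  then show ?thesis using v bl by (auto simp: weak_solution_def critical_point_def W0_has_derivative_def)
qed

lemma euler_lagrange_self:
  assumes "euler_lagrange q u"
  shows "E u = modular L q u"
proof -
  have "plap u u = nonlin q u u" using assms by (auto simp: euler_lagrange_def)
  then show ?thesis by (simp add: plap_def nonlin_def spow_mult_self modular_def)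
qed

text \<open>
  The exponent \<open>pst / p\<close> exceeds \<open>1\<close>, so the inequality bounds \<open>X\<close> from below;
  \<open>(pst / p) / (pst / p - 1) = N / (p s)\<close> is the exponent in the definition of \<open>kap\<close>.
\<close>
lemma threshold:
  assumes S: "0 < S" and X: "0 < X" "X \<le> (X / S) powr (pst / p)"
  shows "kap \<le> X"
proof -
  define t where "t = pst / p"
  have t: "1 < t" using pst_gt_p p1 by (simp add: t_def)
  have N: "0 < real DIM('a) - p * s" "0 < p * s" using psN s0 p1 by auto
  have eq: "t = (t - 1) * (real DIM('a) / (p * s))"
    unfolding t_def pst_ratio using N s0 p1 by (simp add: field_simps)
  have "X * S powr t \<le> X powr t"
    using X S by (simp add: t_def powr_divide field_simps)
  also have "\<dots> = X * X powr (t - 1)" using X by (simp add: powr_mult_base)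
  finally have "S powr t \<le> X powr (t - 1)" using X by simp
  then have "(S powr t) powr (1 / (t - 1)) \<le> (X powr (t - 1)) powr (1 / (t - 1))"
    using t by (intro powr_mono2) auto
  then have "S powr (t * (1 / (t - 1))) \<le> X" using t X by (simp add: powr_powr)
  moreover have "t * (1 / (t - 1)) = real DIM('a) / (p * s)"
    using eq t by (metis mult.assoc mult.commute mult_1 nonzero_mult_div_cancel_left times_divide_eq_right
        less_irrefl right_minus_eq)
  ultimately show ?thesis by (simp add: kap_def)
qed

lemma pos_part_W:
  assumes v: "v \<in> W"
  shows "(\<lambda>x. max (v x) 0) \<in> W"
proof -
  have [measurable]: "v \<in> borel_measurable L" using v by (rule W_D)
  have "(\<lambda>x. max (v x) 0) \<in> Lr L pst"
    by (rule Lr_bound[OF W_D(1)[OF v]]) (use p1 pst_gt_p in auto)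
  moreover have "hq (\<lambda>x. max (v x) 0) \<in> Lr pairs p"
    by (rule Lr_bound[OF W_D(3)[OF v]]) (use p1 in \<open>auto intro!: AE_I2 abs_hquot_mono\<close>)
  moreover have "AE x in L. x \<notin> \<Omega> \<longrightarrow> max (v x) 0 = 0"
    using W_D(2)[OF v] by eventually_elim auto
  ultimately show ?thesis by (simp add: W_iff)
qed

text \<open>
  Testing the equation with the positive part \<open>w\<close> gives \<open>E w \<le> modular L pst w\<close> by
  \<open>spow_diff_pos_part\<close>, and \<open>threshold\<close> applies to \<open>w\<close>.
\<close>
lemma pos_part_energy:
  assumes EL: "euler_lagrange pst v" and S: "0 < S" and nz: "\<not> (AE x in L. v x \<le> 0)"
  shows "kap \<le> modular L pst (\<lambda>x. max (v x) 0)"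
proof -
  define w where "w x = max (v x) 0" for x
  have v: "v \<in> W" using EL by (simp add: euler_lagrange_def)
  have w: "w \<in> W" unfolding w_def by (rule pos_part_W[OF v])
  have pt: "\<bar>hq w z\<bar> powr p \<le> spow (p - 1) (hq v z) * hq w z" for z
  proof -
    define d where "d = norm (fst z - snd z) powr ((real DIM('a) + p * s) / p)"
    have d: "0 \<le> d" by (simp add: d_def)
    have m: "max (t / d) 0 = max t 0 / d" for t using d by (auto simp: max_def divide_le_0_iff zero_le_divide_iff)
    have "hq v z = v (fst z) / d - v (snd z) / d" "hq w z = max (v (fst z) / d) 0 - max (v (snd z) / d) 0"
      by (auto simp: hquot_def d_def[symmetric] w_def m diff_divide_distrib)
    then show ?thesis using spow_diff_pos_part[OF p1] by simp
  qed
  have "E w \<le> plap v w"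
    unfolding modular_def plap_def using pt
    by (intro integral_mono Lr_integrable[OF W_D(3)[OF w]] integrable_spow_mult[OF W_D(3)[OF v] W_D(3)[OF w] p1])
  also have "\<dots> = nonlin pst v w" using EL w by (auto simp: euler_lagrange_def)
  also have "\<dots> = modular L pst w"
  proof -
    have "spow (pst - 1) (v x) * w x = \<bar>w x\<bar> powr pst" for x
      using spow_mult_self[of pst "v x"] by (cases "v x \<le> 0") (auto simp: w_def max_def)
    then show ?thesis by (simp add: nonlin_def modular_def)
  qed
  finally have Ew: "E w \<le> modular L pst w" .
  have mE: "modular L pst w \<le> (E w / S) powr (pst / p)"
    using subcritical_sobolev[OF w _ _ S, of pst] pst_gt_p p1 vol_pos by simp
  have "modular L pst w \<noteq> 0"
  proof
    assume "modular L pst w = 0"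
    then have "AE x in L. w x = 0" using modular_eq_0_iff[OF W_D(1)[OF w]] by simp
    then have "AE x in L. v x \<le> 0" by eventually_elim (auto simp: w_def max_def split: if_splits)
    then show False using nz by simp
  qed
  then have "E w \<noteq> 0" using mE modular_nonneg[of L pst w] by (auto simp: order_antisym)
  then have "0 < E w" using modular_nonneg[of pairs p "hq w"] by linarith
  then have "kap \<le> E w" using Ew mE by (intro threshold[OF S]) auto
  then have "kap \<le> modular L pst w" using Ew by linarith
  moreover have "w = (\<lambda>x. max (v x) 0)" by (simp add: w_def fun_eq_iff)
  ultimately show ?thesis by simp
qed

lemma euler_lagrange_minus:
  assumes "euler_lagrange q v"
  shows "euler_lagrange q (\<lambda>x. - v x)"
proof -
  have "hq (\<lambda>x. - v x) z = - hq v z" for z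
    by (simp add: hquot_def minus_divide_left)
  then show ?thesis using assms W_scale[of v "-1"]
    by (auto simp: euler_lagrange_def plap_def nonlin_def spow_minus)
qed

text \<open>
  Otherwise both the positive and the negative part have mass at least \<open>kap\<close>, and the total mass equals
  \<open>E v\<close>.
\<close>
lemma low_energy_sign:
  assumes EL: "euler_lagrange pst v" and S: "0 < S" and low: "E v < 2 * kap"
  shows "(AE x in L. 0 \<le> v x) \<or> (AE x in L. v x \<le> 0)"
proof (rule ccontr)
  assume neg: "\<not> ?thesis"
  have v: "v \<in> W" using EL by (simp add: euler_lagrange_def)
  have w: "(\<lambda>x. - v x) \<in> W" using W_scale[OF v, of "-1"] by simp
  have 1: "kap \<le> modular L pst (\<lambda>x. max (v x) 0)" using pos_part_energy[OF EL S] neg by simp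
  have 2: "kap \<le> modular L pst (\<lambda>x. max (- v x) 0)"
    using pos_part_energy[OF euler_lagrange_minus[OF EL] S] neg by simp
  have "modular L pst v = (LINT x|L. \<bar>max (v x) 0\<bar> powr pst + \<bar>max (- v x) 0\<bar> powr pst)"
    unfolding modular_def by (intro Bochner_Integration.integral_cong) (auto simp: max_def)
  also have "\<dots> = modular L pst (\<lambda>x. max (v x) 0) + modular L pst (\<lambda>x. max (- v x) 0)"
    unfolding modular_def
    by (intro Bochner_Integration.integral_add Lr_integrable W_D(1) pos_part_W v w)
  finally show False using 1 2 low euler_lagrange_self[OF EL] by simp
qed

text \<open>
  A strong maximum principle, which uses the nonlocality of the operator.  Let \<open>\<eta>\<close> be the distance to the
  complement of \<open>\<Omega>\<close> and test with \<open>\<phi> k = \<eta> \<psi> ((k + 1) v)\<close>, where \<open>\<psi>\<close> decreases from \<open>1\<close> to \<open>0\<close> on the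
  unit interval; these functions tend to \<open>\<zeta>\<close>, which is \<open>\<eta>\<close> on \<open>{v \<le> 0}\<close> and \<open>0\<close> elsewhere.  The right-hand side of the equation is
  nonnegative.  Since \<open>\<psi>\<close> is decreasing, the integrand \<open>T k\<close> on the left is bounded above by the integrable
  function \<open>|hq v|^(p - 1) |hq \<eta>|\<close>, and by Fatou's lemma the limit integrand \<open>T0\<close> has a nonnegative
  integral.  But \<open>T0 \<le> 0\<close>, with strict inequality at \<open>(x, y)\<close> if \<open>x \<in> \<Omega>\<close> and \<open>v x = 0 < v y\<close>.  So the
  product of \<open>{x \<in> \<Omega>. v x = 0}\<close> and \<open>{v > 0}\<close> is a null set, and the second factor is not.
\<close>
lemma strong_positivity:
  assumes EL: "euler_lagrange q v" and nn: "AE x in L. 0 \<le> v x" and nz: "\<not> (AE x in L. v x = 0)"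
  shows "AE x in L. x \<in> \<Omega> \<longrightarrow> 0 < v x"
proof -
  have v: "v \<in> W" using EL by (simp add: euler_lagrange_def)
  have [measurable]: "v \<in> borel_measurable L" using v by (rule W_D)
  define \<eta> where "\<eta> x = infdist x (- \<Omega>)" for x
  have \<Omega>ne: "- \<Omega> \<noteq> {}"
  proof
    assume "- \<Omega> = {}"
    then have "\<Omega> = UNIV" by auto
    then show False using \<Omega>_bounded not_bounded_UNIV[where 'a='a] by simp
  qed
  have \<eta>0: "\<eta> x = 0" if "x \<notin> \<Omega>" for x using that by (simp add: \<eta>_def)
  have \<eta>pos: "0 < \<eta> x" if "x \<in> \<Omega>" for x
    using in_closed_iff_infdist_zero[of "- \<Omega>" x] that \<Omega>_open \<Omega>ne infdist_nonneg[of x "- \<Omega>"]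
    by (auto simp: \<eta>_def closed_def less_le)
  have \<eta>nn: "0 \<le> \<eta> x" for x by (simp add: \<eta>_def infdist_nonneg)
  have \<eta>L: "\<bar>\<eta> x - \<eta> y\<bar> \<le> 1 * norm (x - y)" for x y
    using infdist_triangle_abs[of x "- \<Omega>" y] by (simp add: \<eta>_def dist_norm)
  have [measurable]: "\<eta> \<in> borel_measurable lborel"
    unfolding \<eta>_def using borel_measurable_continuous_onI[OF continuous_on_infdist[OF continuous_on_id]] by simp
  obtain z0 where z0: "z0 \<notin> \<Omega>" using \<Omega>ne by auto
  obtain R where R: "\<And>x. x \<in> \<Omega> \<Longrightarrow> norm x \<le> R" using \<Omega>_bounded by (auto simp: bounded_iff)
  define B where "B = \<bar>R\<bar> + norm z0"
  have \<eta>B: "\<bar>\<eta> x\<bar> \<le> B" for x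
  proof (cases "x \<in> \<Omega>")
    case True
    have "\<eta> x \<le> dist x z0" unfolding \<eta>_def using z0 by (intro infdist_le) auto
    also have "\<dots> \<le> norm x + norm z0" by (simp add: dist_norm norm_triangle_ineq4)
    finally show ?thesis using R[OF True] \<eta>nn[of x] by (auto simp: B_def)
  qed (simp add: \<eta>0 B_def)
  have \<eta>W: "\<eta> \<in> W" by (rule lipschitz_W[OF \<eta>L \<eta>B _ \<eta>0]) auto
  define \<psi> where "\<psi> t = max 0 (min 1 (1 - t))" for t :: real
  have \<psi>: "0 \<le> \<psi> t" "\<psi> t \<le> 1" for t by (auto simp: \<psi>_def)
  have \<psi>L: "\<bar>\<psi> a - \<psi> b\<bar> \<le> \<bar>a - b\<bar>" for a b by (auto simp: \<psi>_def)
  have \<psi>mono: "\<psi> b \<le> \<psi> a" if "a \<le> b" for a b using that by (auto simp: \<psi>_def)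
  define \<phi> where "\<phi> k x = \<eta> x * \<psi> (real (Suc k) * v x)" for k x
  define \<zeta> where "\<zeta> x = \<eta> x * (if v x \<le> 0 then 1 else 0)" for x
  have [measurable]: "\<phi> k \<in> borel_measurable lborel" for k unfolding \<phi>_def \<psi>_def by measurable
  have [measurable]: "\<zeta> \<in> borel_measurable lborel" unfolding \<zeta>_def by measurable
  have \<phi>W: "\<phi> k \<in> W" for k
  proof -
    have "\<bar>\<phi> k x\<bar> \<le> \<bar>\<eta> x\<bar>" for x
      using \<psi> \<eta>nn by (auto simp: \<phi>_def abs_mult mult_left_le)
    then have "\<phi> k \<in> Lr L pst"
      by (intro Lr_bound(1)[OF W_D(1)[OF \<eta>W]]) (use p1 pst_gt_p in auto)
    moreover have "hq (\<phi> k) \<in> Lr pairs p"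
    proof (rule Lr_bound)
      show "(\<lambda>z. \<bar>hq \<eta> z\<bar> + \<bar>B * real (Suc k) * hq v z\<bar>) \<in> Lr pairs p"
        using W_D(3)[OF \<eta>W] Lr_scale(1)[OF W_D(3)[OF v], of "B * real (Suc k)"] p1
        by (intro Lr_add) (auto simp: Lr_def)
      have "\<bar>hq (\<phi> k) z\<bar> \<le> \<bar>\<bar>hq \<eta> z\<bar> + \<bar>B * real (Suc k) * hq v z\<bar>\<bar>" for z
      proof -
        let ?x = "fst z" and ?y = "snd z" and ?K = "real (Suc k)"
        have B0: "0 \<le> B" by (simp add: B_def)
        have "\<bar>\<phi> k ?x - \<phi> k ?y\<bar> \<le> \<bar>\<eta> ?x - \<eta> ?y\<bar> + \<bar>B * ?K * (v ?x - v ?y)\<bar>"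
        proof -
          have "\<phi> k ?x - \<phi> k ?y = (\<eta> ?x - \<eta> ?y) * \<psi> (?K * v ?x) + \<eta> ?y * (\<psi> (?K * v ?x) - \<psi> (?K * v ?y))"
            by (simp add: \<phi>_def algebra_simps)
          then have "\<bar>\<phi> k ?x - \<phi> k ?y\<bar> \<le> \<bar>\<eta> ?x - \<eta> ?y\<bar> * \<bar>\<psi> (?K * v ?x)\<bar> + \<bar>\<eta> ?y\<bar> * \<bar>\<psi> (?K * v ?x) - \<psi> (?K * v ?y)\<bar>"
            by (metis abs_mult abs_triangle_ineq)
          also have "\<dots> \<le> \<bar>\<eta> ?x - \<eta> ?y\<bar> * 1 + B * \<bar>?K * v ?x - ?K * v ?y\<bar>"
            using \<psi> \<psi>L \<eta>B B0 by (intro add_mono mult_mono) (auto simp del: of_nat_Suc)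
          also have "B * \<bar>?K * v ?x - ?K * v ?y\<bar> = \<bar>B * ?K * (v ?x - v ?y)\<bar>"
            using B0 by (simp add: abs_mult right_diff_distrib[symmetric] del: of_nat_Suc)
          finally show ?thesis by simp
        qed
        then have "\<bar>\<phi> k ?x - \<phi> k ?y\<bar> / norm (?x - ?y) powr ((real DIM('a) + p * s) / p)
          \<le> (\<bar>\<eta> ?x - \<eta> ?y\<bar> + \<bar>B * ?K * (v ?x - v ?y)\<bar>) / norm (?x - ?y) powr ((real DIM('a) + p * s) / p)"
          by (intro divide_right_mono) auto
        then show ?thesis by (simp add: hquot_def abs_divide add_divide_distrib abs_mult del: of_nat_Suc)
      qed
      then show "AE z in pairs. \<bar>hq (\<phi> k) z\<bar> \<le> \<bar>\<bar>hq \<eta> z\<bar> + \<bar>B * real (Suc k) * hq v z\<bar>\<bar>" by simp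
    qed (use p1 in auto)
    ultimately show ?thesis by (auto simp: W_iff \<phi>_def \<eta>0)
  qed
  define T where "T k z = spow (p - 1) (hq v z) * hq (\<phi> k) z" for k z
  define T0 where "T0 z = spow (p - 1) (hq v z) * hq \<zeta> z" for z
  define G where "G z = \<bar>hq v z\<bar> powr (p - 1) * \<bar>hq \<eta> z\<bar>" for z
  have [measurable]: "T k \<in> borel_measurable pairs" "T0 \<in> borel_measurable pairs" "G \<in> borel_measurable pairs" for k
    unfolding T_def T0_def G_def by measurable
  have Gint: "integrable pairs G" unfolding G_def by (rule holder_dual(1)[OF W_D(3)[OF v] W_D(3)[OF \<eta>W] p1])
  have Tint: "integrable pairs (T k)" for k
    unfolding T_def by (rule integrable_spow_mult[OF W_D(3)[OF v] W_D(3)[OF \<phi>W] p1])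
  have TG: "T k z \<le> G z" for k z
  proof -
    let ?K = "real (Suc k)"
    define d where "d = norm (fst z - snd z) powr ((real DIM('a) + p * s) / p)"
    have d: "0 \<le> d" by (simp add: d_def)
    have key: "\<phi> k x - \<phi> k y \<le> \<bar>\<eta> x - \<eta> y\<bar>" if "v y \<le> v x" for x y
    proof -
      have "\<eta> x * \<psi> (?K * v x) \<le> \<eta> x * \<psi> (?K * v y)"
        using \<eta>nn that by (intro mult_left_mono \<psi>mono) (auto intro: mult_left_mono)
      then have "\<phi> k x - \<phi> k y \<le> (\<eta> x - \<eta> y) * \<psi> (?K * v y)" unfolding \<phi>_def by (simp add: algebra_simps)
      also have "\<dots> \<le> \<bar>\<eta> x - \<eta> y\<bar> * 1" using \<psi> by (intro mult_mono) auto
      finally show ?thesis by simp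
    qed
    show ?thesis
    proof (cases "v (snd z) \<le> v (fst z)")
      case True
      then have s': "spow (p - 1) (hq v z) = \<bar>hq v z\<bar> powr (p - 1)"
        using d by (simp add: spow_def hquot_def d_def[symmetric] sgn_if zero_le_divide_iff) 
      have "hq (\<phi> k) z \<le> \<bar>hq \<eta> z\<bar>"
        using key[OF True] d by (simp add: hquot_def d_def[symmetric] abs_divide divide_right_mono)
      then show ?thesis unfolding T_def G_def s' by (intro mult_left_mono) auto
    next
      case False
      then have s': "spow (p - 1) (hq v z) = - (\<bar>hq v z\<bar> powr (p - 1))"
        using d by (simp add: spow_def hquot_def d_def[symmetric] sgn_if divide_less_0_iff zero_less_divide_iff)
      have "- hq (\<phi> k) z \<le> \<bar>hq \<eta> z\<bar>"
        using key[of "fst z" "snd z"] False d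
        by (simp add: hquot_def d_def[symmetric] abs_divide divide_right_mono abs_minus_commute minus_divide_left)
      then have "\<bar>hq v z\<bar> powr (p - 1) * (- hq (\<phi> k) z) \<le> \<bar>hq v z\<bar> powr (p - 1) * \<bar>hq \<eta> z\<bar>"
        by (intro mult_left_mono) auto
      then show ?thesis unfolding T_def G_def s' by simp
    qed
  qed
  have Tnn: "0 \<le> (LINT z|pairs. T k z)" for k
  proof -
    have "(LINT z|pairs. T k z) = nonlin q v (\<phi> k)"
      using EL \<phi>W[of k] by (auto simp: euler_lagrange_def plap_def T_def)
    also have "0 \<le> \<dots>" unfolding nonlin_def
    proof (rule integral_nonneg_AE)
      show "AE x in L. 0 \<le> spow (q - 1) (v x) * \<phi> k x"
        using nn by eventually_elim (use \<psi> \<eta>nn in \<open>auto simp: spow_def \<phi>_def sgn_if\<close>)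
    qed
    finally show ?thesis .
  qed
  have \<phi>lim: "(\<lambda>k. \<phi> k x) \<longlonglongrightarrow> \<zeta> x" for x
  proof (cases "v x \<le> 0")
    case True
    then have "real (Suc k) * v x \<le> 0" for k by (simp add: mult_nonneg_nonpos del: of_nat_Suc)
    then have "\<psi> (real (Suc k) * v x) = 1" for k by (simp add: \<psi>_def del: of_nat_Suc)
    then show ?thesis using True by (simp add: \<phi>_def \<zeta>_def)
  next
    case False
    then obtain n where n: "1 < real n * v x" using ex_less_of_nat_mult[of "v x" 1] by auto
    have "\<psi> (real (Suc k) * v x) = 0" if "k \<ge> n" for k
    proof -
      have "real n * v x \<le> real (Suc k) * v x" using that False by (intro mult_right_mono) auto
      then show ?thesis using n by (simp add: \<psi>_def del: of_nat_Suc)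
    qed
    then have "\<forall>\<^sub>F k in sequentially. \<phi> k x = \<zeta> x"
      using False by (auto simp: eventually_sequentially \<phi>_def \<zeta>_def simp del: of_nat_Suc)
    then show ?thesis by (rule tendsto_eventually)
  qed
  have Tlim: "(\<lambda>k. T k z) \<longlonglongrightarrow> T0 z" for z
  proof (cases "fst z = snd z")
    case True
    then show ?thesis by (simp add: T_def T0_def hquot_def)
  next
    case False
    then show ?thesis unfolding T_def T0_def hquot_def
      by (intro tendsto_mult tendsto_const tendsto_divide tendsto_diff \<phi>lim) auto
  qed
  have T0neg: "AE z in pairs. T0 z \<le> 0"
    using AE_pairs_fst_snd[OF nn]
  proof eventually_elim
    case (elim z)
    define d where "d = norm (fst z - snd z) powr ((real DIM('a) + p * s) / p)"
    have d: "0 \<le> d" by (simp add: d_def)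
    let ?x = "fst z" and ?y = "snd z"
    consider "v ?x = 0" "v ?y = 0" | "0 < v ?x" "0 < v ?y" | "v ?x = 0" "0 < v ?y" | "0 < v ?x" "v ?y = 0"
      using elim by linarith
    then show ?case
    proof cases
      case 3
      then have "hq v z \<le> 0" "0 \<le> hq \<zeta> z"
        using d \<eta>nn by (auto simp: hquot_def d_def[symmetric] \<zeta>_def divide_le_0_iff)
      then show ?thesis unfolding T0_def spow_def by (auto simp: sgn_if mult_le_0_iff zero_le_mult_iff)
    next
      case 4
      then have "0 \<le> hq v z" "hq \<zeta> z \<le> 0"
        using d \<eta>nn by (auto simp: hquot_def d_def[symmetric] \<zeta>_def divide_le_0_iff)
      then show ?thesis unfolding T0_def spow_def by (auto simp: sgn_if mult_le_0_iff zero_le_mult_iff)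
    qed (auto simp: T0_def hquot_def \<zeta>_def spow_def)
  qed
  have "AE z in pairs. T0 z = 0"
  proof -
    have "(\<integral>\<^sup>+z. ennreal (G z - T0 z) \<partial>pairs) = (\<integral>\<^sup>+z. liminf (\<lambda>k. ennreal (G z - T k z)) \<partial>pairs)"
    proof (rule nn_integral_cong)
      fix z
      have "(\<lambda>k. ennreal (G z - T k z)) \<longlonglongrightarrow> ennreal (G z - T0 z)"
        by (intro tendsto_ennrealI tendsto_diff tendsto_const Tlim)
      then show "ennreal (G z - T0 z) = liminf (\<lambda>k. ennreal (G z - T k z))"
        by (rule lim_imp_Liminf[symmetric, rotated]) simp
    qed
    also have "\<dots> \<le> liminf (\<lambda>k. \<integral>\<^sup>+z. ennreal (G z - T k z) \<partial>pairs)"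
      by (rule nn_integral_liminf) simp
    also have "\<dots> \<le> liminf (\<lambda>k. ennreal (LINT z|pairs. G z))"
    proof (intro Liminf_mono always_eventually allI)
      fix k
      have "(\<integral>\<^sup>+z. ennreal (G z - T k z) \<partial>pairs) = ennreal (LINT z|pairs. G z - T k z)"
        using Gint Tint TG by (intro nn_integral_eq_integral) auto
      also have "\<dots> \<le> ennreal (LINT z|pairs. G z)"
        using Gint Tint Tnn[of k] by (intro ennreal_leI) simp
      finally show "(\<integral>\<^sup>+z. ennreal (G z - T k z) \<partial>pairs) \<le> ennreal (LINT z|pairs. G z)" .
    qed
    also have "\<dots> = ennreal (LINT z|pairs. G z)" by (simp add: Liminf_const)
    also have "\<dots> = (\<integral>\<^sup>+z. ennreal (G z) \<partial>pairs)"
      by (rule nn_integral_eq_integral[OF Gint, symmetric]) (simp add: G_def)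
    finally have le: "(\<integral>\<^sup>+z. ennreal (G z - T0 z) \<partial>pairs) \<le> (\<integral>\<^sup>+z. ennreal (G z) \<partial>pairs)" .
    have "(\<integral>\<^sup>+z. ennreal (G z - T0 z) \<partial>pairs) = (\<integral>\<^sup>+z. ennreal (G z) + ennreal (- T0 z) \<partial>pairs)"
      by (rule nn_integral_cong_AE)
        (use T0neg in \<open>eventually_elim, auto simp: G_def ennreal_plus[symmetric] simp del: ennreal_plus\<close>)
    also have "\<dots> = (\<integral>\<^sup>+z. ennreal (G z) \<partial>pairs) + (\<integral>\<^sup>+z. ennreal (- T0 z) \<partial>pairs)"
      by (intro nn_integral_add) auto
    finally have "(\<integral>\<^sup>+z. ennreal (G z) \<partial>pairs) + (\<integral>\<^sup>+z. ennreal (- T0 z) \<partial>pairs) \<le> (\<integral>\<^sup>+z. ennreal (G z) \<partial>pairs) + 0"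
      using le by simp
    moreover have "(\<integral>\<^sup>+z. ennreal (G z) \<partial>pairs) \<noteq> \<infinity>"
      using nn_integral_eq_integral[OF Gint] by (auto simp: G_def)
    ultimately have "(\<integral>\<^sup>+z. ennreal (- T0 z) \<partial>pairs) = 0"
      by (subst (asm) ennreal_add_left_cancel_le) auto
    then have "AE z in pairs. ennreal (- T0 z) = 0" by (subst (asm) nn_integral_0_iff_AE) auto
    with T0neg show ?thesis by eventually_elim (auto simp: ennreal_eq_0_iff)
  qed
  then have AEz: "AE z in pairs. \<not> (fst z \<in> \<Omega> \<and> v (fst z) = 0 \<and> 0 < v (snd z))"
  proof eventually_elim
    case (elim z)
    show ?case
    proof
      assume a: "fst z \<in> \<Omega> \<and> v (fst z) = 0 \<and> 0 < v (snd z)"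
      then have ne: "fst z \<noteq> snd z" by auto
      then have "hq v z < 0" "0 < hq \<zeta> z"
        using a \<eta>pos[of "fst z"] by (auto simp: hquot_def \<zeta>_def divide_less_0_iff)
      then have "T0 z < 0" by (simp add: T0_def spow_def mult_less_0_iff)
      then show False using elim by simp
    qed
  qed
  define Z where "Z = {x. x \<in> \<Omega> \<and> v x = 0}"
  define P where "P = {x. 0 < v x}"
  have ZP[measurable]: "Z \<in> sets lborel" "P \<in> sets lborel" unfolding Z_def P_def by measurable
  have "emeasure pairs (Z \<times> P) = 0"
  proof -
    have "AE z in pairs. z \<notin> Z \<times> P" using AEz by eventually_elim (auto simp: Z_def P_def)
    moreover have "Z \<times> P \<in> sets (pairs :: ('a \<times> 'a) measure)" by (intro pair_measureI ZP)
    ultimately have "Z \<times> P \<in> null_sets (pairs :: ('a \<times> 'a) measure)" by (simp only: AE_iff_null_sets)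
    then show ?thesis by auto
  qed
  then have "emeasure L Z * emeasure L P = 0" using lborel.emeasure_pair_measure_Times[OF ZP] by simp
  moreover have "emeasure L P \<noteq> 0"
  proof
    assume "emeasure L P = 0"
    then have "P \<in> null_sets L" using ZP(2) by (rule null_setsI)
    then have "AE x in L. x \<notin> P" by (rule AE_not_in)
    with nn have "AE x in L. v x = 0" by eventually_elim (auto simp: P_def)
    then show False using nz by simp
  qed
  ultimately have "emeasure L Z = 0" by simp
  then have "Z \<in> null_sets L" using ZP(1) by (rule null_setsI)
  then have "AE x in L. x \<notin> Z" by (rule AE_not_in)
  with nn show ?thesis by eventually_elim (auto simp: Z_def)
qed

end

section \<open>Strong convergence or concentration\<close>

lemma lipschitz_cutoff:
  fixes a :: "'a::real_normed_vector" and r l :: real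
  assumes "0 < r"
  shows "\<And>x y. \<bar>max 0 (min 1 (l - dist x a / r)) - max 0 (min 1 (l - dist y a / r))\<bar> \<le> 1 / r * norm (x - y)"
    "\<And>x y. \<bar>max 0 (min 1 (dist x a / r - l)) - max 0 (min 1 (dist y a / r - l))\<bar> \<le> 1 / r * norm (x - y)"
proof -
  have "\<bar>dist x a / r - dist y a / r\<bar> \<le> 1 / r * norm (x - y)" for x y
  proof -
    have "\<bar>dist x a - dist y a\<bar> \<le> dist x y" by (metis abs_dist_diff_le dist_commute)
    then have "\<bar>dist x a - dist y a\<bar> / r \<le> dist x y / r" using assms by (intro divide_right_mono) auto
    then show ?thesis using assms by (simp add: dist_norm diff_divide_distrib[symmetric])
  qed
  note * = this
  show "\<bar>max 0 (min 1 (l - dist x a / r)) - max 0 (min 1 (l - dist y a / r))\<bar> \<le> 1 / r * norm (x - y)" for x y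
    using *[of x y] by linarith
  show "\<bar>max 0 (min 1 (dist x a / r - l)) - max 0 (min 1 (dist y a / r - l))\<bar> \<le> 1 / r * norm (x - y)" for x y
    using *[of x y] by linarith
qed

lemma C0_bounded:
  fixes \<phi> :: "'a::euclidean_space \<Rightarrow> real"
  assumes c: "continuous_on UNIV \<phi>" and lim: "(\<phi> \<longlongrightarrow> 0) at_infinity"
  shows "\<exists>B. \<forall>x. \<bar>\<phi> x\<bar> \<le> B"
proof -
  have "\<forall>\<^sub>F x in at_infinity. dist (\<phi> x) 0 < 1" using lim by (rule tendstoD) simp
  then obtain R where R: "\<And>x. R \<le> norm x \<Longrightarrow> \<bar>\<phi> x\<bar> < 1" by (auto simp: eventually_at_infinity)
  have "compact (\<phi> ` cball 0 R)" using c by (intro compact_continuous_image continuous_on_subset[OF c]) auto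
  then have "bounded (\<phi> ` cball 0 R)" by (rule compact_imp_bounded)
  then obtain B where "\<forall>y\<in>\<phi> ` cball 0 R. norm y \<le> B" by (auto simp: bounded_iff)
  then have B: "\<bar>\<phi> x\<bar> \<le> B" if "norm x \<le> R" for x using that by auto
  have "\<bar>\<phi> x\<bar> \<le> max B 1" for x using R[of x] B[of x] by (cases "R \<le> norm x") auto
  then show ?thesis by blast
qed

context frac_sobolev
begin

definition nl_mass :: "real \<Rightarrow> ('a \<Rightarrow> real) \<Rightarrow> 'a set \<Rightarrow> real" where
  "nl_mass q u A = (LINT x|L. indicator A x * \<bar>u x\<bar> powr q)"

lemma nl_mass_integrable:
  assumes "u \<in> W" "0 < q" "q \<le> pst" and [measurable]: "A \<in> sets borel"
  shows "integrable L (\<lambda>x. indicator A x * \<bar>u x\<bar> powr q)"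
  by (rule integrable_bounded_mult[OF Lr_integrable[OF W_Lr[OF assms(1-3)]], where B = 1])
    (auto simp: indicator_def)

lemma nl_mass_le_integral:
  assumes u: "u \<in> W" and q: "0 < q" "q \<le> pst" and [measurable]: "A \<in> sets borel" "\<eta> \<in> borel_measurable borel"
    and \<eta>: "\<And>x. 0 \<le> \<eta> x" "\<And>x. \<eta> x \<le> 1" "\<And>x. x \<in> A \<Longrightarrow> \<eta> x = 1"
  shows "nl_mass q u A \<le> (LINT x|L. \<eta> x powr p * \<bar>u x\<bar> powr q)"
  unfolding nl_mass_def
proof (rule integral_mono[OF nl_mass_integrable[OF u q]])
  show "integrable L (\<lambda>x. \<eta> x powr p * \<bar>u x\<bar> powr q)"
    by (rule integrable_bounded_mult[OF Lr_integrable[OF W_Lr[OF u q]], where B = 1])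
      (use \<eta> p1 powr_mono2[of p _ 1] in auto)
  show "indicator A x * \<bar>u x\<bar> powr q \<le> \<eta> x powr p * \<bar>u x\<bar> powr q" for x
    using \<eta>(3)[of x] by (intro mult_right_mono) (auto simp: indicator_def)
qed simp

text \<open>
  Fubini's theorem; the density is finite almost everywhere because the energy is.
\<close>
lemma integral_Ds_density:
  assumes u: "u \<in> W" and [measurable]: "\<phi> \<in> borel_measurable borel" and B: "\<And>x. \<bar>\<phi> x\<bar> \<le> B"
  shows "(LINT x|density L (Ds_pow s p u). \<phi> x) = (LINT z|pairs. \<phi> (fst z) * \<bar>hq u z\<bar> powr p)"
proof -
  note [measurable] = W_D(4)[OF u]
  define d where "d x = (LINT y|L. \<bar>hq u (x, y)\<bar> powr p)" for x
  have d: "d x = enn2real (Ds_pow s p u x)" for x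
    unfolding d_def using p1 by (subst integral_eq_nn_integral) (auto simp: Ds_pow_def gagliardo_kernel_eq_hquot)
  have [measurable]: "d \<in> borel_measurable L" unfolding d[abs_def] by measurable
  have fin: "AE x in L. Ds_pow s p u x \<noteq> \<infinity>"
    by (rule nn_integral_PInf_AE) (use integral_Ds_pow[OF u] in auto)
  have "density L (Ds_pow s p u) = density L (\<lambda>x. ennreal (d x))"
    by (rule density_cong) (use fin in \<open>auto elim!: eventually_mono simp: d less_top\<close>)
  then have "(LINT x|density L (Ds_pow s p u). \<phi> x) = (LINT x|L. d x *\<^sub>R \<phi> x)"
    by (simp add: integral_density d)
  also have "\<dots> = (LINT x|L. LINT y|L. \<phi> x * \<bar>hq u (x, y)\<bar> powr p)"
    by (simp add: d_def mult.commute)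
  also have "\<dots> = (LINT x|L. LINT y|L. \<phi> (fst (x, y)) * \<bar>hq u (x, y)\<bar> powr p)" by simp
  also have "\<dots> = (LINT z|pairs. \<phi> (fst z) * \<bar>hq u z\<bar> powr p)"
    by (rule lborel_pair.integral_fst'[of "\<lambda>z. \<phi> (fst z) * \<bar>hq u z\<bar> powr p"])
      (rule integrable_bounded_mult[OF Lr_integrable[OF W_D(3)[OF u]], where B = B]; use B in auto)
  finally show ?thesis .
qed

end

text \<open>
  A sequence of solutions whose exponents tend to the critical one from below and whose energies converge
  to a limit below \<open>2 * kap\<close>.  The hypotheses pass to subsequences.
\<close>
locale almost_critical = frac_sobolev s p \<Omega>
  for s p and \<Omega> :: "'a::euclidean_space set" +
  fixes u :: "nat \<Rightarrow> 'a \<Rightarrow> real" and q :: "nat \<Rightarrow> real" and K M :: real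
  assumes EL: "\<And>n. euler_lagrange (q n) (u n)"
    and q: "\<And>n. p < q n" "\<And>n. q n \<le> pst" "q \<longlonglongrightarrow> pst"
    and K: "\<And>n. E (u n) \<le> K" "\<And>n. modular L pst (u n) \<le> K"
    and S: "0 < S"
    and M: "(\<lambda>n. E (u n)) \<longlonglongrightarrow> M" "0 < M" "M < 2 * kap"
begin

lemma u_in_W: "u n \<in> W"
  using EL by (simp add: euler_lagrange_def)

lemma pst_gt_1: "1 < pst"
  using p1 pst_gt_p by simp

lemma q_pos: "0 < q n"
  using q(1)[of n] p1 by simp

lemma total_mass: "E (u n) = modular L (q n) (u n)"
  by (rule euler_lagrange_self[OF EL])

lemma subsequence:
  assumes "strict_mono r"
  shows "almost_critical s p \<Omega> (\<lambda>n. u (r n)) (\<lambda>n. q (r n)) K M"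
  using EL q(1,2) K S M(2,3) LIMSEQ_subseq_LIMSEQ[OF q(3) assms] LIMSEQ_subseq_LIMSEQ[OF M(1) assms]
  by unfold_locales (auto simp: o_def)

text \<open>
  Both sides of the equation are pairings of a bounded sequence with a fixed function, so almost
  everywhere convergence suffices.  The subcritical power is at most the critical one plus \<open>1\<close>, whence
  the additional majorant \<open>\<bar>\<phi>\<bar>\<close>.
\<close>
lemma euler_lagrange_limit:
  assumes v: "v \<in> W" and lim: "AE x in L. (\<lambda>n. u n x) \<longlonglongrightarrow> v x"
  shows "euler_lagrange pst v"
proof -
  note [measurable] = W_D(4)[OF u_in_W] W_D(4)[OF v]
  have "plap v \<phi> = nonlin pst v \<phi>" if \<phi>: "\<phi> \<in> W" for \<phi>
  proof -
    have [measurable]: "\<phi> \<in> borel_measurable L" using \<phi> by (rule W_D)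
    have 1: "(\<lambda>n. plap (u n) \<phi>) \<longlonglongrightarrow> plap v \<phi>"
      unfolding plap_def
    proof (rule integral_tendsto_holder_dominated[where f = "\<lambda>n. hq (u n)" and K = K and r = p and g = "hq \<phi>" and G = "\<lambda>_. 0"])
      show "AE z in pairs. (\<lambda>n. spow (p - 1) (hq (u n) z) * hq \<phi> z) \<longlonglongrightarrow> spow (p - 1) (hq v z) * hq \<phi> z"
        using AE_hquot_tendsto[OF lim, of s p]
        by eventually_elim (use p1 in \<open>auto intro!: tendsto_mult tendsto_spow tendsto_const\<close>)
      show "AE z in pairs. \<bar>spow (p - 1) (hq (u n) z) * hq \<phi> z\<bar> \<le> \<bar>hq (u n) z\<bar> powr (p - 1) * \<bar>hq \<phi> z\<bar> + 0" for n
        by (simp add: abs_mult abs_spow)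
    qed (use W_D(3)[OF u_in_W] W_D(3)[OF \<phi>] K p1 integrable_spow_mult[OF W_D(3)[OF v] W_D(3)[OF \<phi>] p1] in auto)
    have 2: "(\<lambda>n. nonlin (q n) (u n) \<phi>) \<longlonglongrightarrow> nonlin pst v \<phi>"
      unfolding nonlin_def
    proof (rule integral_tendsto_holder_dominated[where f = u and K = K and r = pst and g = \<phi> and G = "\<lambda>x. \<bar>\<phi> x\<bar>"])
      show "AE x in L. (\<lambda>n. spow (q n - 1) (u n x) * \<phi> x) \<longlonglongrightarrow> spow (pst - 1) (v x) * \<phi> x"
        using lim by eventually_elim (use p1 pst_gt_1 q(3) in \<open>auto intro!: tendsto_mult tendsto_spow tendsto_const tendsto_diff\<close>)
      have "\<bar>spow (q n - 1) (u n x) * \<phi> x\<bar> \<le> \<bar>u n x\<bar> powr (pst - 1) * \<bar>\<phi> x\<bar> + \<bar>\<phi> x\<bar>" for n x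
      proof -
        have "\<bar>u n x\<bar> powr (q n - 1) \<le> \<bar>u n x\<bar> powr (pst - 1) + 1"
        proof (cases "\<bar>u n x\<bar> \<le> 1")
          case True
          then have "\<bar>u n x\<bar> powr (q n - 1) \<le> 1 powr (q n - 1)" using q(1)[of n] p1 by (intro powr_mono2) auto
          then show ?thesis by (simp add: add_increasing)
        next
          case False
          then have "\<bar>u n x\<bar> powr (q n - 1) \<le> \<bar>u n x\<bar> powr (pst - 1)" using q(2)[of n] by (intro powr_mono) auto
          then show ?thesis by simp
        qed
        then have "\<bar>u n x\<bar> powr (q n - 1) * \<bar>\<phi> x\<bar> \<le> (\<bar>u n x\<bar> powr (pst - 1) + 1) * \<bar>\<phi> x\<bar>" by (intro mult_right_mono) auto
        then show ?thesis by (simp add: abs_mult abs_spow distrib_right)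
      qed
      then show "AE x in L. \<bar>spow (q n - 1) (u n x) * \<phi> x\<bar> \<le> \<bar>u n x\<bar> powr (pst - 1) * \<bar>\<phi> x\<bar> + \<bar>\<phi> x\<bar>" for n by simp
      show "integrable L (\<lambda>x. \<bar>\<phi> x\<bar>)" using W_integrable[OF \<phi>] by simp
    qed (use W_D(1)[OF u_in_W] W_D(1)[OF \<phi>] K pst_gt_1 integrable_spow_mult[OF W_D(1)[OF v] W_D(1)[OF \<phi>] pst_gt_1] in auto)
    have "plap (u n) \<phi> = nonlin (q n) (u n) \<phi>" for n using EL \<phi> by (auto simp: euler_lagrange_def)
    then show ?thesis using LIMSEQ_unique[OF 1] 2 by simp
  qed
  then show ?thesis using v by (simp add: euler_lagrange_def)
qed

text \<open>
  By \<open>brezis_lieb\<close>, in \<open>L\<^sup>p\<close> of the product space and in \<open>L\<^sup>q\<close> with \<open>q = q n\<close>, the energy and the mass of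
  \<open>u n - v\<close> have the same limit \<open>M - E v\<close>.  It satisfies the inequality of \<open>threshold\<close> and lies below \<open>kap\<close>,
  as \<open>E v \<ge> kap\<close>; so it is \<open>0\<close>.
\<close>
lemma strong_convergence:
  assumes v: "v \<in> W" and lim: "AE x in L. (\<lambda>n. u n x) \<longlonglongrightarrow> v x"
    and nz: "\<not> (AE x in L. v x = 0)"
  shows "W0_tendsto s p u v" "E v \<le> M"
proof -
  have ELv: "euler_lagrange pst v" by (rule euler_lagrange_limit[OF v lim])
  define w where "w n x = u n x - v x" for n x
  have wW: "w n \<in> W" for n unfolding w_def by (intro W_diff u_in_W v)
  have Ew: "E (w n) = modular pairs p (\<lambda>z. hq (u n) z - hq v z)" for n
    unfolding w_def hquot_diff ..
  have Ev: "E v = modular L pst v" by (rule euler_lagrange_self[OF ELv])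
  have kapE: "kap \<le> E v"
  proof (rule threshold[OF S])
    have "modular L pst v \<noteq> 0" using modular_eq_0_iff[OF W_D(1)[OF v]] nz by simp
    then show "0 < E v" using Ev modular_nonneg[of L pst v] by linarith
    show "E v \<le> (E v / S) powr (pst / p)"
      using subcritical_sobolev[OF v _ _ S, of pst] pst_gt_1 vol_pos Ev by simp
  qed
  have Ewb: "E (w n) \<le> 2 powr p * (K + E v)" for n
  proof -
    have "E (w n) \<le> 2 powr p * (E (u n) + E v)"
      unfolding Ew using Lr_diff(2)[OF W_D(3)[OF u_in_W] W_D(3)[OF v]] p1 by simp
    also have "\<dots> \<le> 2 powr p * (K + E v)" using K by (intro mult_left_mono) auto
    finally show ?thesis .
  qed
  have "(\<lambda>n. E (u n) - E (w n) - E v) \<longlonglongrightarrow> 0"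
    unfolding Ew
    by (rule brezis_lieb[where Q = p and q = "\<lambda>_. p" and ?q0.0 = p and G = "\<lambda>z. \<bar>hq v z\<bar> powr p" and K = "2 powr p * (K + E v)"])
      (use p1 W_D(3)[OF u_in_W] W_D(3)[OF v] AE_hquot_tendsto[OF lim] Ewb Lr_integrable[OF W_D(3)[OF v]] in \<open>auto simp: Ew\<close>)
  from tendsto_diff[OF tendsto_diff[OF M(1) this] tendsto_const[of "E v"]]
  have Elim: "(\<lambda>n. E (w n)) \<longlonglongrightarrow> M - E v" by simp
  have a0: "0 \<le> M - E v" by (rule tendsto_lowerbound[OF Elim]) auto
  then show "E v \<le> M" by simp
  \<comment> \<open>An integrable majorant of \<open>|v|^q\<close> for all the exponents \<open>q n\<close>, which lie between \<open>1\<close> and \<open>pst\<close>.\<close>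
  have qbound: "t powr q n \<le> t + t powr pst" if "0 \<le> t" for t n
  proof (cases "t \<le> 1")
    case True
    then show ?thesis using powr_mono'[of 1 "q n" t] that q(1)[of n] p1 by (simp add: add_increasing2)
  next
    case False
    then have "t powr q n \<le> t powr pst" using q(2)[of n] by (intro powr_mono) auto
    then show ?thesis using that by linarith
  qed
  have Gint: "integrable L (\<lambda>x. \<bar>v x\<bar> + \<bar>v x\<bar> powr pst)"
    using W_integrable[OF v] Lr_integrable[OF W_D(1)[OF v]] by auto
  have mwb: "\<exists>B. \<forall>n. modular L (q n) (w n) \<le> B"
  proof -
    have "modular L (q n) (w n) \<le> vol * (1 + 2 powr p * (K + E v) / S) powr (pst / p)" for n
    proof -
      have "modular L (q n) (w n) \<le> vol powr (1 - q n / pst) * (E (w n) / S) powr (q n / p)"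
        by (rule subcritical_sobolev[OF wW q_pos q(2) S])
      also have "\<dots> \<le> vol powr 1 * (1 + 2 powr p * (K + E v) / S) powr (pst / p)"
      proof (rule mult_mono)
        show "vol powr (1 - q n / pst) \<le> vol powr 1"
          using vol_pos q_pos[of n] pst_gt_1 by (intro powr_mono) auto
        have "0 \<le> E (w n) / S" using S by simp
        moreover have le: "E (w n) / S \<le> 2 powr p * (K + E v) / S" using Ewb S by (intro divide_right_mono) auto
        ultimately have "(E (w n) / S) powr (q n / p) \<le> (1 + 2 powr p * (K + E v) / S) powr (q n / p)"
          using q_pos[of n] p1 by (intro powr_mono2) auto
        also have "\<dots> \<le> (1 + 2 powr p * (K + E v) / S) powr (pst / p)"
          using q(2)[of n] p1 le \<open>0 \<le> E (w n) / S\<close> by (intro powr_mono divide_right_mono) auto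
        finally show "(E (w n) / S) powr (q n / p) \<le> (1 + 2 powr p * (K + E v) / S) powr (pst / p)" .
      qed auto
      finally show ?thesis using vol_pos by simp
    qed
    then show ?thesis by blast
  qed
  then obtain B where B: "\<And>n. modular L (q n) (w n) \<le> B" by blast
  have BL: "(\<lambda>n. modular L (q n) (u n) - modular L (q n) (\<lambda>x. u n x - v x) - modular L (q n) v) \<longlonglongrightarrow> 0"
    by (rule brezis_lieb[where Q = pst and ?q0.0 = pst and K = B, OF q_pos q(2,3) _ _ _ lim _ Gint])
      (use pst_gt_1 W_Lr[OF u_in_W q_pos q(2)] W_Lr[OF v q_pos q(2)] B qbound in \<open>auto simp: w_def[abs_def]\<close>)
  have vlim: "(\<lambda>n. modular L (q n) v) \<longlonglongrightarrow> modular L pst v"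
    unfolding modular_def
  proof (rule integral_dominated_convergence[OF _ _ Gint])
    show "AE x in L. (\<lambda>n. \<bar>v x\<bar> powr q n) \<longlonglongrightarrow> \<bar>v x\<bar> powr pst"
      using q(3) pst_gt_1 by (intro AE_I2 tendsto_powr' tendsto_const) auto
  qed (use W_D(4)[OF v] qbound in auto)
  have Eu: "modular L (q n) (u n) = E (u n)" for n using total_mass[of n] by simp
  have mlim: "(\<lambda>n. modular L (q n) (w n)) \<longlonglongrightarrow> M - E v"
    using tendsto_diff[OF tendsto_diff[OF M(1) BL] vlim] by (simp add: Eu Ev w_def[abs_def])
  have "(\<lambda>n. vol powr (1 - q n / pst) * (E (w n) / S) powr (q n / p)) \<longlonglongrightarrow>
     vol powr (1 - pst / pst) * ((M - E v) / S) powr (pst / p)"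
    using S vol_pos p1 pst_gt_1 Elim q(3)
    by (intro tendsto_mult tendsto_powr tendsto_powr' tendsto_diff tendsto_divide tendsto_const) auto
  then have "M - E v \<le> vol powr (1 - pst / pst) * ((M - E v) / S) powr (pst / p)"
    by (rule LIMSEQ_le[OF mlim]) (use subcritical_sobolev[OF wW q_pos q(2) S] in auto)
  then have "M - E v \<le> ((M - E v) / S) powr (pst / p)" using vol_pos pst_gt_1 by simp
  then have "M - E v = 0"
    using threshold[OF S, of "M - E v"] kapE M(3) a0 by (cases "M - E v = 0") auto
  then have "(\<lambda>n. E (w n) powr (1 / p)) \<longlonglongrightarrow> 0 powr (1 / p)"
    using Elim p1 by (intro tendsto_powr') auto
  then show "W0_tendsto s p u v"
    by (simp add: W0_tendsto_def gagliardo_eq w_def[abs_def])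
qed

text \<open>
  On a bounded set, a bound in the critical space makes the lower power \<open>p\<close> uniformly integrable.
\<close>
lemma Lp_vanishing:
  assumes lim: "AE x in L. (\<lambda>n. u n x) \<longlonglongrightarrow> 0"
  shows "(\<lambda>n. modular L p (u n)) \<longlonglongrightarrow> 0"
  unfolding modular_def
proof (rule vanishing_integral[where A = "\<lambda>n x. \<bar>u n x\<bar> powr pst" and K = K])
  show "AE x in L. (\<lambda>n. \<bar>u n x\<bar> powr p) \<longlonglongrightarrow> 0"
    using lim
  proof eventually_elim
    case (elim x)
    have "(\<lambda>n. \<bar>u n x\<bar> powr p) \<longlonglongrightarrow> 0 powr p"
      using elim p1 by (intro tendsto_powr' tendsto_rabs_zero tendsto_const) auto
    then show ?case by simp
  qed
  show "(LINT x|L. \<bar>u n x\<bar> powr pst) \<le> K" for n using K(2)[of n] by (simp add: modular_def)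
  fix \<eta> :: real assume \<eta>: "0 < \<eta>"
  \<comment> \<open>For \<open>y > t\<close> the power \<open>y^p\<close> is at most \<open>\<eta> y^pst\<close>.\<close>
  define t where "t = \<eta> powr (1 / (p - pst))"
  have t: "0 < t" "t powr (p - pst) = \<eta>" using \<eta> pst_gt_p by (auto simp: t_def powr_powr)
  have bnd: "y powr p \<le> \<eta> * y powr pst + t powr p" if "0 \<le> y" for y
  proof (cases "y \<le> t")
    case True
    then have "y powr p \<le> t powr p" using that p1 by (intro powr_mono2) auto
    then show ?thesis using \<eta> by (simp add: add_increasing)
  next
    case False
    have "y powr p = y powr pst * y powr (p - pst)" using False t by (simp add: powr_add[symmetric])
    also have "\<dots> \<le> y powr pst * t powr (p - pst)"
      using False t pst_gt_p by (intro mult_left_mono powr_mono2') auto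
    finally show ?thesis using t by (simp add: mult.commute add_increasing2)
  qed
  show "\<exists>G. integrable L G \<and> (\<forall>n. AE x in L. \<bar>u n x\<bar> powr p \<le> \<eta> * \<bar>u n x\<bar> powr pst + G x)"
  proof (intro exI[of _ "\<lambda>x. t powr p * indicator \<Omega> x"] conjI allI)
    show "integrable L (\<lambda>x. t powr p * indicator \<Omega> x :: real)" using \<Omega>_emeasure by simp
    fix n
    show "AE x in L. \<bar>u n x\<bar> powr p \<le> \<eta> * \<bar>u n x\<bar> powr pst + t powr p * indicator \<Omega> x"
      using W_D(2)[OF u_in_W[of n]] by eventually_elim (use bnd in \<open>auto simp: indicator_def\<close>)
  qed
qed (use Lr_integrable[OF W_D(1)[OF u_in_W]] W_D(4)[OF u_in_W] in auto)

end

locale vanishing_almost_critical = almost_critical +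
  assumes m: "(\<lambda>n. modular L p (u n)) \<longlonglongrightarrow> 0"
begin

text \<open>
  Test the equation with \<open>\<eta> u n\<close>.  By the Leibniz rule the left-hand side differs from the first integral
  by a commutator, which is controlled by the norm of \<open>u n\<close> in \<open>L\<^sup>p\<close> and so tends to \<open>0\<close>.
\<close>
lemma localized_identity:
  fixes B C :: real
  assumes L: "\<And>x y. \<bar>\<eta> x - \<eta> y\<bar> \<le> C * norm (x - y)" and B: "\<And>x. \<bar>\<eta> x\<bar> \<le> B"
    and [measurable]: "\<eta> \<in> borel_measurable lborel"
  shows "(\<lambda>n. (LINT z|pairs. \<eta> (fst z) * \<bar>hq (u n) z\<bar> powr p) - (LINT x|L. \<eta> x * \<bar>u n x\<bar> powr q n)) \<longlonglongrightarrow> 0"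
proof -
  note [measurable] = W_D(4)[OF u_in_W]
  obtain Kc where Kc: "0 \<le> Kc" "\<And>v. v \<in> Lr lborel p \<Longrightarrow> (\<lambda>z. v (snd z) * hq \<eta> z) \<in> Lr pairs p"
    "\<And>v. v \<in> Lr lborel p \<Longrightarrow> modular pairs p (\<lambda>z. v (snd z) * hq \<eta> z) \<le> Kc * modular lborel p v"
    using cutoff_commutator[OF s0 s1 p1 L B] by auto
  have up: "u n \<in> Lr L p" for n using u_in_W p1 pst_gt_p by (intro W_Lr) auto
  define c where "c n z = u n (snd z) * hq \<eta> z" for n z
  have cL: "c n \<in> Lr pairs p" for n unfolding c_def by (rule Kc(2)[OF up])
  define R where "R n = (LINT z|pairs. spow (p - 1) (hq (u n) z) * c n z)" for n
  have eq: "(LINT z|pairs. \<eta> (fst z) * \<bar>hq (u n) z\<bar> powr p) - (LINT x|L. \<eta> x * \<bar>u n x\<bar> powr q n) = - R n" for n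
  proof -
    have w: "(\<lambda>x. \<eta> x * u n x) \<in> W" by (rule cutoff_mult_W[OF u_in_W L B]) simp
    have i1: "integrable pairs (\<lambda>z. \<eta> (fst z) * \<bar>hq (u n) z\<bar> powr p)"
      by (rule integrable_bounded_mult[OF Lr_integrable[OF W_D(3)[OF u_in_W]], where B = B]) (use B in auto)
    have i2: "integrable pairs (\<lambda>z. spow (p - 1) (hq (u n) z) * c n z)"
      by (rule integrable_spow_mult[OF W_D(3)[OF u_in_W] cL p1])
    have "spow (p - 1) (hq (u n) z) * hq (\<lambda>x. \<eta> x * u n x) z =
      \<eta> (fst z) * \<bar>hq (u n) z\<bar> powr p + spow (p - 1) (hq (u n) z) * c n z" for z
      using spow_mult_self[of p "hq (u n) z"] by (simp add: hquot_mult c_def algebra_simps)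
    then have "plap (u n) (\<lambda>x. \<eta> x * u n x) = (LINT z|pairs. \<eta> (fst z) * \<bar>hq (u n) z\<bar> powr p) + R n"
      unfolding plap_def R_def using i1 i2 by simp
    moreover have sp: "spow (q n - 1) (u n x) * (\<eta> x * u n x) = \<eta> x * \<bar>u n x\<bar> powr q n" for x
      using spow_mult_self[of "q n" "u n x"] by (simp add: mult.left_commute)
    have "nonlin (q n) (u n) (\<lambda>x. \<eta> x * u n x) = (LINT x|L. \<eta> x * \<bar>u n x\<bar> powr q n)"
      by (simp only: nonlin_def sp)
    ultimately show ?thesis using EL[of n] w by (simp add: euler_lagrange_def)
  qed
  have Rb: "\<bar>R n\<bar> \<le> K powr (1 - 1 / p) * (Kc * modular L p (u n)) powr (1 / p)" for n
  proof -
    have "\<bar>R n\<bar> \<le> (LINT z|pairs. \<bar>spow (p - 1) (hq (u n) z) * c n z\<bar>)" unfolding R_def by (rule integral_abs_bound)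
    also have "\<dots> = (LINT z|pairs. \<bar>hq (u n) z\<bar> powr (p - 1) * \<bar>c n z\<bar>)" by (simp add: abs_mult abs_spow)
    also have "\<dots> \<le> E (u n) powr (1 - 1 / p) * modular pairs p (c n) powr (1 / p)"
      by (rule holder_dual(2)[OF W_D(3)[OF u_in_W] cL p1])
    also have "\<dots> \<le> K powr (1 - 1 / p) * (Kc * modular L p (u n)) powr (1 / p)"
      using K(1) Kc(3)[OF up[of n]] p1 by (intro mult_mono powr_mono2) (auto simp: c_def[abs_def])
    finally show ?thesis .
  qed
  have "(\<lambda>n. K powr (1 - 1 / p) * (Kc * modular L p (u n)) powr (1 / p)) \<longlonglongrightarrow> K powr (1 - 1 / p) * (Kc * 0) powr (1 / p)"
    using p1 Kc(1) m by (intro tendsto_mult tendsto_powr' tendsto_const) auto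
  then have "(\<lambda>n. K powr (1 - 1 / p) * (Kc * modular L p (u n)) powr (1 / p)) \<longlonglongrightarrow> 0" by simp
  then have "R \<longlonglongrightarrow> 0" by (rule Lim_null_comparison[rotated]) (use Rb in auto)
  then show ?thesis unfolding eq using tendsto_minus[of R 0] by simp
qed

text \<open>
  Hoelder's inequality splits \<open>\<eta>^p |u|^q\<close> into \<open>|u|^(q - p)\<close> on \<open>{\<eta> > 0}\<close> and \<open>|\<eta> u|^p\<close>.  The second factor
  is bounded by the energy of \<open>\<eta> u\<close> divided by \<open>S\<close>, and this energy is asymptotically at most
  \<open>\<integral> \<eta>^p |u|^q\<close> again, by \<open>localized_identity\<close>.  The first factor is at most
  \<open>(kap - \<theta>)^(1 - p / q)\<close>, whose limit is less than \<open>kap^(1 - p / pst) = S\<close>.  Thus the integral is at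
  most a constant less than \<open>1\<close> times itself, up to terms that tend to \<open>0\<close>.
\<close>
lemma small_mass_vanishes:
  fixes C :: real
  assumes L: "\<And>x y. \<bar>\<eta> x - \<eta> y\<bar> \<le> C * norm (x - y)" and \<eta>01: "\<And>x. 0 \<le> \<eta> x" "\<And>x. \<eta> x \<le> 1"
    and [measurable]: "\<eta> \<in> borel_measurable lborel"
    and \<theta>: "0 < \<theta>" "\<theta> < kap" and \<tau>: "0 < \<tau>"
  shows "\<forall>\<^sub>F n in sequentially. nl_mass (q n) (u n) {x. 0 < \<eta> x} \<le> kap - \<theta> \<longrightarrow>
    (LINT x|L. \<eta> x powr p * \<bar>u n x\<bar> powr q n) \<le> \<tau>"
proof -
  note [measurable] = W_D(4)[OF u_in_W]
  have B: "\<bar>\<eta> x\<bar> \<le> 1" for x using \<eta>01 by simp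
  have up: "u n \<in> Lr L p" for n using u_in_W p1 pst_gt_p by (intro W_Lr) auto
  define X where "X n = (LINT x|L. \<eta> x powr p * \<bar>u n x\<bar> powr q n)" for n
  define A where "A n = (LINT z|pairs. \<eta> (fst z) powr p * \<bar>hq (u n) z\<bar> powr p)" for n
  have AX: "(\<lambda>n. A n - X n) \<longlonglongrightarrow> 0"
    unfolding A_def X_def
  proof (rule localized_identity[where C = "p * C" and B = 1])
    show "\<bar>\<eta> x powr p - \<eta> y powr p\<bar> \<le> p * C * norm (x - y)" for x y
    proof -
      have "\<bar>\<eta> x powr p - \<eta> y powr p\<bar> \<le> p * \<bar>\<eta> x - \<eta> y\<bar>" using p1 \<eta>01 by (intro powr_lipschitz_unit) auto
      also have "\<dots> \<le> p * (C * norm (x - y))" using L p1 by (intro mult_left_mono) auto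
      finally show ?thesis by simp
    qed
    show "\<bar>\<eta> x powr p\<bar> \<le> 1" for x using \<eta>01[of x] p1 powr_mono2[of p "\<eta> x" 1] by simp
  qed simp
  obtain Kc where Kc: "0 \<le> Kc" "\<And>v. v \<in> Lr lborel p \<Longrightarrow> (\<lambda>z. v (snd z) * hq \<eta> z) \<in> Lr pairs p"
    "\<And>v. v \<in> Lr lborel p \<Longrightarrow> modular pairs p (\<lambda>z. v (snd z) * hq \<eta> z) \<le> Kc * modular lborel p v"
    using cutoff_commutator[OF s0 s1 p1 L B] by auto
  define k where "k = (kap - \<theta>) powr (1 - p / pst) / S"
  have psN': "1 - p / pst = p * s / real DIM('a)"
    using pst_inverse p1 pst_gt_1 psN s0 by (simp add: field_simps)
  have kapS: "kap powr (1 - p / pst) = S"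
    using S s0 p1 unfolding psN' kap_def by (simp add: powr_powr)
  have ppst: "0 < 1 - p / pst" using pst_gt_p p1 by simp
  have k: "0 < k" "k < 1"
  proof -
    show "0 < k" using S \<theta> by (simp add: k_def)
    have "(kap - \<theta>) powr (1 - p / pst) < kap powr (1 - p / pst)" using \<theta> ppst by (intro powr_less_mono2) auto
    then show "k < 1" using kapS S by (simp add: k_def)
  qed
  \<comment> \<open>\<open>k\<close> is the limit of the factors in Hoelder's inequality; \<open>\<sigma>\<close> leaves room for the Leibniz rule, as
    \<open>k (1 + \<sigma>) < 1\<close> still.\<close>
  define \<sigma> where "\<sigma> = (1 - k) / 2"
  have \<sigma>: "0 < \<sigma>" using k by (simp add: \<sigma>_def)
  have k\<sigma>: "k * (1 + \<sigma>) < 1"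
  proof -
    have "k * \<sigma> \<le> 1 * \<sigma>" using k \<sigma> by (intro mult_right_mono) auto
    then have "k * (1 + \<sigma>) \<le> k + \<sigma>" by (simp add: distrib_left)
    also have "\<dots> < 1" using k unfolding \<sigma>_def by argo
    finally show ?thesis .
  qed
  obtain D where D: "0 \<le> D" "\<And>x y :: real. 0 \<le> x \<Longrightarrow> 0 \<le> y \<Longrightarrow> (x + y) powr p \<le> (1 + \<sigma>) * x powr p + D * y powr p"
    using powr_add_le_uniform[of p \<sigma>] p1 \<sigma> by force
  have wW: "(\<lambda>x. \<eta> x * u n x) \<in> W" for n by (rule cutoff_mult_W[OF u_in_W L B]) simp
  have Ew: "E (\<lambda>x. \<eta> x * u n x) \<le> (1 + \<sigma>) * A n + D * (Kc * modular L p (u n))" for n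
  proof -
    define c where "c z = u n (snd z) * hq \<eta> z" for z
    have cL: "c \<in> Lr pairs p" unfolding c_def by (rule Kc(2)[OF up])
    have i1: "integrable pairs (\<lambda>z. \<eta> (fst z) powr p * \<bar>hq (u n) z\<bar> powr p)"
      by (rule integrable_bounded_mult[OF Lr_integrable[OF W_D(3)[OF u_in_W]], where B = 1])
        (use \<eta>01 p1 powr_mono2[of p _ 1] in auto)
    have "\<bar>hq (\<lambda>x. \<eta> x * u n x) z\<bar> powr p \<le> (1 + \<sigma>) * (\<eta> (fst z) powr p * \<bar>hq (u n) z\<bar> powr p) + D * \<bar>c z\<bar> powr p" for z
    proof -
      have "\<bar>hq (\<lambda>x. \<eta> x * u n x) z\<bar> powr p \<le> (\<eta> (fst z) * \<bar>hq (u n) z\<bar> + \<bar>c z\<bar>) powr p"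
        using p1 \<eta>01(1)[of "fst z"] abs_triangle_ineq[of "\<eta> (fst z) * hq (u n) z" "c z"]
        by (intro powr_mono2) (auto simp: hquot_mult c_def abs_mult)
      also have "\<dots> \<le> (1 + \<sigma>) * (\<eta> (fst z) * \<bar>hq (u n) z\<bar>) powr p + D * \<bar>c z\<bar> powr p"
        using \<eta>01 by (intro D(2)) auto
      finally show ?thesis using \<eta>01 by (simp add: powr_mult)
    qed
    then have "E (\<lambda>x. \<eta> x * u n x) \<le> (LINT z|pairs. (1 + \<sigma>) * (\<eta> (fst z) powr p * \<bar>hq (u n) z\<bar> powr p) + D * \<bar>c z\<bar> powr p)"
      unfolding modular_def using Lr_integrable[OF W_D(3)[OF wW]] i1 Lr_integrable[OF cL] by (intro integral_mono) auto
    also have "\<dots> = (1 + \<sigma>) * A n + D * modular pairs p c"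
      using i1 Lr_integrable[OF cL] by (simp add: A_def modular_def)
    also have "\<dots> \<le> (1 + \<sigma>) * A n + D * (Kc * modular L p (u n))"
      using Kc(3)[OF up[of n]] D(1) by (intro add_left_mono mult_left_mono) (auto simp: c_def[abs_def])
    finally show ?thesis .
  qed
  define kn where "kn n = (kap - \<theta>) powr (1 - p / q n) * (vol powr (1 - q n / pst)) powr (p / q n) / S" for n
  have kn0: "0 \<le> kn n" for n using S by (simp add: kn_def)
  have knlim: "kn \<longlonglongrightarrow> k"
  proof -
    have "kn \<longlonglongrightarrow> (kap - \<theta>) powr (1 - p / pst) * (vol powr (1 - pst / pst)) powr (p / pst) / S"
      unfolding kn_def[abs_def] using S vol_pos p1 pst_gt_1 \<theta> q(3)
      by (intro tendsto_mult tendsto_powr tendsto_diff tendsto_divide tendsto_const) auto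
    then show ?thesis using pst_gt_1 vol_pos by (simp add: k_def)
  qed
  have hold: "X n \<le> kn n * E (\<lambda>x. \<eta> x * u n x)" if small: "nl_mass (q n) (u n) {x. 0 < \<eta> x} \<le> kap - \<theta>" for n
  proof -
    define \<alpha> where "\<alpha> = p / q n"
    have \<alpha>: "0 < \<alpha>" "\<alpha> < 1" using q(1)[of n] p1 by (auto simp: \<alpha>_def)
    let ?w = "\<lambda>x. \<eta> x * u n x"
    define f where "f x = indicator {x. 0 < \<eta> x} x * \<bar>u n x\<bar> powr q n" for x
    have fint: "integrable L f" unfolding f_def
      by (rule integrable_bounded_mult[OF Lr_integrable[OF W_Lr[OF u_in_W q_pos q(2)]], where B = 1]) (auto simp: indicator_def)
    have f0: "0 \<le> f x" for x by (simp add: f_def)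
    have pt: "f x powr (1 - \<alpha>) * (\<bar>?w x\<bar> powr q n) powr \<alpha> = \<eta> x powr p * \<bar>u n x\<bar> powr q n" for x
    proof (cases "\<eta> x = 0")
      case False
      then have pos: "0 < \<eta> x" using \<eta>01(1)[of x] by simp
      have e1: "q n * \<alpha> = p" using q_pos[of n] by (simp add: \<alpha>_def)
      have e2: "q n * (1 - \<alpha>) = q n - p" using e1 by (simp add: right_diff_distrib)
      have "f x powr (1 - \<alpha>) = \<bar>u n x\<bar> powr (q n - p)" using pos by (simp add: f_def powr_powr e2)
      moreover have "(\<bar>?w x\<bar> powr q n) powr \<alpha> = \<eta> x powr p * \<bar>u n x\<bar> powr p"
        using pos by (simp add: powr_powr e1 abs_mult powr_mult)
      moreover have "\<bar>u n x\<bar> powr (q n - p) * \<bar>u n x\<bar> powr p = \<bar>u n x\<bar> powr q n"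
        by (simp add: powr_add[symmetric])
      ultimately show ?thesis by (simp add: mult.left_commute mult.assoc)
    qed (use p1 q_pos[of n] in \<open>simp add: f_def\<close>)
    have wq: "?w \<in> Lr L (q n)" by (rule W_Lr[OF wW q_pos q(2)])
    have "X n = (LINT x|L. f x powr (1 - \<alpha>) * (\<bar>?w x\<bar> powr q n) powr \<alpha>)" by (simp add: X_def pt)
    also have "\<dots> \<le> (LINT x|L. f x) powr (1 - \<alpha>) * modular L (q n) ?w powr \<alpha>"
      unfolding modular_def by (rule holder_interpolation(2)[OF fint f0 Lr_integrable[OF wq] _ \<alpha>]) simp
    also have "\<dots> \<le> (kap - \<theta>) powr (1 - \<alpha>) * (vol powr (1 - q n / pst) * (E ?w / S) powr (q n / p)) powr \<alpha>"
    proof (intro mult_mono powr_mono2)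
      show "(LINT x|L. f x) \<le> kap - \<theta>" using small by (simp add: nl_mass_def f_def)
      show "modular L (q n) ?w \<le> vol powr (1 - q n / pst) * (E ?w / S) powr (q n / p)"
        by (rule subcritical_sobolev[OF wW q_pos q(2) S])
    qed (use \<alpha> fint f0 in auto)
    also have "\<dots> = kn n * E ?w"
    proof -
      have "((E ?w / S) powr (q n / p)) powr \<alpha> = E ?w / S"
        using S p1 q_pos[of n] by (simp add: powr_powr \<alpha>_def)
      then show ?thesis by (simp add: kn_def \<alpha>_def[symmetric] powr_mult)
    qed
    finally show ?thesis .
  qed
  define \<rho> where "\<rho> n = kn n * (1 + \<sigma>)" for n
  define err where "err n = \<rho> n * \<bar>A n - X n\<bar> + kn n * (D * (Kc * modular L p (u n)))" for n
  have \<rho>lim: "\<rho> \<longlonglongrightarrow> k * (1 + \<sigma>)" unfolding \<rho>_def[abs_def] by (intro tendsto_mult knlim tendsto_const)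
  have "err \<longlonglongrightarrow> (k * (1 + \<sigma>)) * 0 + k * (D * (Kc * 0))"
    unfolding err_def[abs_def]
    by (intro tendsto_add tendsto_mult \<rho>lim tendsto_rabs_zero AX knlim m tendsto_const)
  then have "(\<lambda>n. err n / (1 - \<rho> n)) \<longlonglongrightarrow> 0 / (1 - k * (1 + \<sigma>))"
    using k\<sigma> by (intro tendsto_divide tendsto_diff tendsto_const \<rho>lim) auto
  then have "\<forall>\<^sub>F n in sequentially. err n / (1 - \<rho> n) < \<tau>" using \<tau> by (intro order_tendstoD) auto
  moreover have "\<forall>\<^sub>F n in sequentially. \<rho> n < 1" using k\<sigma> \<rho>lim by (intro order_tendstoD) auto
  ultimately show ?thesis
  proof eventually_elim
    case (elim n)
    show ?case
    proof
      assume small: "nl_mass (q n) (u n) {x. 0 < \<eta> x} \<le> kap - \<theta>"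
      have "X n \<le> kn n * ((1 + \<sigma>) * A n + D * (Kc * modular L p (u n)))"
        using hold[OF small] mult_left_mono[OF Ew kn0, of n] by (rule order_trans)
      also have "\<dots> = \<rho> n * A n + kn n * (D * (Kc * modular L p (u n)))"
        by (simp add: \<rho>_def algebra_simps)
      also have "\<rho> n * A n \<le> \<rho> n * (X n + \<bar>A n - X n\<bar>)"
        using kn0 \<sigma> by (intro mult_left_mono) (auto simp: \<rho>_def)
      finally have "X n * (1 - \<rho> n) \<le> err n" by (simp add: err_def algebra_simps)
      then have "X n \<le> err n / (1 - \<rho> n)" using elim(2) by (simp add: pos_le_divide_eq)
      then show "(LINT x|L. \<eta> x powr p * \<bar>u n x\<bar> powr q n) \<le> \<tau>" using elim(1) by (simp add: X_def)
    qed
  qed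
qed

text \<open>
  Cover the closure of \<open>\<Omega>\<close> by finitely many balls of radius \<open>r\<close>.  One of them keeps a mass bounded below,
  so by \<open>small_mass_vanishes\<close> the ball with twice the radius has mass at least \<open>kap - \<theta>\<close>.  Its
  complement then has mass less than \<open>kap - \<theta>\<close>, since the total is less than \<open>2 kap - 2 \<theta>\<close>, and the
  same lemma removes the mass outside the ball with three times the radius.
\<close>
lemma concentration:
  assumes r: "0 < r" and \<delta>: "0 < \<delta>"
  shows "\<forall>\<^sub>F n in sequentially. \<exists>x\<in>closure \<Omega>. nl_mass (q n) (u n) {y. 3 * r \<le> dist y x} \<le> \<delta>"
proof -
  note mint = nl_mass_integrable[OF u_in_W q_pos q(2)]
  define \<theta> where "\<theta> = (2 * kap - M) / 4"
  have \<theta>: "0 < \<theta>" "\<theta> < kap" "M + 3 * \<theta> \<le> 2 * kap" using M unfolding \<theta>_def by argo+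
  have "compact (closure \<Omega>)" using \<Omega>_bounded by (simp add: compact_closure)
  then obtain F where F: "F \<subseteq> closure \<Omega>" "finite F" "closure \<Omega> \<subseteq> (\<Union>x\<in>F. ball x r)"
    by (rule compactE_image[of "closure \<Omega>" "closure \<Omega>" "\<lambda>x. ball x r"]) (use r in auto)
  \<comment> \<open>If each ball of the cover had mass at most \<open>\<tau>\<close>, the total mass would be less than \<open>M / 2\<close>.\<close>
  define \<tau> where "\<tau> = M / (4 * (real (card F) + 1))"
  have \<tau>: "0 < \<tau>" "real (card F) * \<tau> < M / 2"
  proof -
    show "0 < \<tau>" using M by (simp add: \<tau>_def)
    then have "real (card F) * \<tau> \<le> (real (card F) + 1) * \<tau>" by (intro mult_right_mono) auto
    also have "\<dots> = M / 4" by (simp add: \<tau>_def field_simps)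
    finally show "real (card F) * \<tau> < M / 2" using M(2) by argo
  qed
  define \<eta> where "\<eta> x y = max 0 (min 1 (2 - dist y x / r))" for x y :: 'a
  define \<zeta> where "\<zeta> x y = max 0 (min 1 (dist y x / r - 2))" for x y :: 'a
  have [measurable]: "\<eta> x \<in> borel_measurable borel" "\<zeta> x \<in> borel_measurable borel" for x
    unfolding \<eta>_def \<zeta>_def by measurable
  have pos_sets: "{y. 0 < \<eta> x y} = {y. dist y x < 2 * r}" "{y. 0 < \<zeta> x y} = {y. 2 * r < dist y x}" for x
    using r by (auto simp: \<eta>_def \<zeta>_def less_max_iff_disj pos_divide_less_eq pos_less_divide_eq)
  have ev1: "\<forall>\<^sub>F n in sequentially. \<forall>x\<in>F. nl_mass (q n) (u n) {y. 0 < \<eta> x y} \<le> kap - \<theta> \<longrightarrow>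
      (LINT y|L. \<eta> x y powr p * \<bar>u n y\<bar> powr q n) \<le> \<tau>"
  proof (intro eventually_ball_finite[OF F(2)] ballI)
    fix x
    show "\<forall>\<^sub>F n in sequentially. nl_mass (q n) (u n) {y. 0 < \<eta> x y} \<le> kap - \<theta> \<longrightarrow>
      (LINT y|L. \<eta> x y powr p * \<bar>u n y\<bar> powr q n) \<le> \<tau>"
      by (rule small_mass_vanishes[where C = "1 / r"])
        (use lipschitz_cutoff[OF r] \<theta> \<tau> in \<open>auto simp: \<eta>_def\<close>)
  qed
  have ev2: "\<forall>\<^sub>F n in sequentially. \<forall>x\<in>F. nl_mass (q n) (u n) {y. 0 < \<zeta> x y} \<le> kap - \<theta> \<longrightarrow>
      (LINT y|L. \<zeta> x y powr p * \<bar>u n y\<bar> powr q n) \<le> \<delta>"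
  proof (intro eventually_ball_finite[OF F(2)] ballI)
    fix x
    show "\<forall>\<^sub>F n in sequentially. nl_mass (q n) (u n) {y. 0 < \<zeta> x y} \<le> kap - \<theta> \<longrightarrow>
      (LINT y|L. \<zeta> x y powr p * \<bar>u n y\<bar> powr q n) \<le> \<delta>"
      by (rule small_mass_vanishes[where C = "1 / r"])
        (use lipschitz_cutoff[OF r] \<theta> \<delta> in \<open>auto simp: \<zeta>_def\<close>)
  qed
  have ev3: "\<forall>\<^sub>F n in sequentially. M / 2 < E (u n)" using M by (intro order_tendstoD(1)[OF M(1)]) auto
  have ev4: "\<forall>\<^sub>F n in sequentially. E (u n) < M + \<theta>" using \<theta> by (intro order_tendstoD(2)[OF M(1)]) auto
  from ev1 ev2 ev3 ev4 show ?thesis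
  proof eventually_elim
    case (elim n)
    have total: "E (u n) = (LINT y|L. \<bar>u n y\<bar> powr q n)"
      using total_mass[of n] by (simp add: modular_def)
    have "\<exists>x\<in>F. \<tau> < nl_mass (q n) (u n) (ball x r)"
    proof (rule ccontr)
      assume "\<not> ?thesis"
      then have le: "\<And>x. x \<in> F \<Longrightarrow> nl_mass (q n) (u n) (ball x r) \<le> \<tau>" by force
      have "E (u n) \<le> (LINT y|L. (\<Sum>x\<in>F. indicator (ball x r) y * \<bar>u n y\<bar> powr q n))"
        unfolding total
      proof (rule integral_mono_AE)
        show "integrable L (\<lambda>y. \<bar>u n y\<bar> powr q n)" by (rule Lr_integrable[OF W_Lr[OF u_in_W q_pos q(2)]])
        show "integrable L (\<lambda>y. \<Sum>x\<in>F. indicator (ball x r) y * \<bar>u n y\<bar> powr q n)"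
          by (intro Bochner_Integration.integrable_sum mint) simp
        show "AE y in L. \<bar>u n y\<bar> powr q n \<le> (\<Sum>x\<in>F. indicator (ball x r) y * \<bar>u n y\<bar> powr q n)"
          using W_D(2)[OF u_in_W[of n]]
        proof eventually_elim
          case (elim y)
          show ?case
          proof (cases "y \<in> \<Omega>")
            case True
            then obtain x where x: "x \<in> F" "y \<in> ball x r" using F(3) closure_subset by blast
            have "\<bar>u n y\<bar> powr q n = indicator (ball x r) y * \<bar>u n y\<bar> powr q n" using x by simp
            also have "\<dots> \<le> (\<Sum>x\<in>F. indicator (ball x r) y * \<bar>u n y\<bar> powr q n)"
              by (rule member_le_sum[OF x(1)]) (use F in auto)
            finally show ?thesis .
          qed (use elim in \<open>auto intro: sum_nonneg\<close>)
        qed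
      qed
      also have "\<dots> = (\<Sum>x\<in>F. nl_mass (q n) (u n) (ball x r))"
        unfolding nl_mass_def by (rule Bochner_Integration.integral_sum) (rule mint, simp)
      also have "\<dots> \<le> real (card F) * \<tau>" using sum_bounded_above[of F _ \<tau>] le by simp
      finally show False using \<tau>(2) elim(3) by linarith
    qed
    then obtain x where x: "x \<in> F" "\<tau> < nl_mass (q n) (u n) (ball x r)" by blast
    have "nl_mass (q n) (u n) (ball x r) \<le> (LINT y|L. \<eta> x y powr p * \<bar>u n y\<bar> powr q n)"
      by (rule nl_mass_le_integral[OF u_in_W q_pos q(2)]) (use r in \<open>auto simp: \<eta>_def dist_commute field_simps\<close>)
    then have big: "kap - \<theta> < nl_mass (q n) (u n) {y. dist y x < 2 * r}"
      using elim(1) x by (force simp: pos_sets)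
    have mball: "{y. dist y x < 2 * r} \<in> sets borel" "{y. 2 * r < dist y x} \<in> sets borel" "{y. 3 * r \<le> dist y x} \<in> sets borel"
      by measurable
    have "nl_mass (q n) (u n) {y. dist y x < 2 * r} + nl_mass (q n) (u n) {y. 2 * r < dist y x}
      = (LINT y|L. indicator {y. dist y x < 2 * r} y * \<bar>u n y\<bar> powr q n + indicator {y. 2 * r < dist y x} y * \<bar>u n y\<bar> powr q n)"
      unfolding nl_mass_def using mint[OF mball(1)] mint[OF mball(2)] by simp
    also have "\<dots> \<le> E (u n)" unfolding total
      using mint[OF mball(1)] mint[OF mball(2)]
      by (intro integral_mono Lr_integrable[OF W_Lr[OF u_in_W q_pos q(2)]]) (auto simp: indicator_def)
    finally have "nl_mass (q n) (u n) {y. 0 < \<zeta> x y} \<le> kap - \<theta>"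
      using big \<theta>(3) elim(4) unfolding pos_sets by linarith
    then have "(LINT y|L. \<zeta> x y powr p * \<bar>u n y\<bar> powr q n) \<le> \<delta>" using elim(2) x(1) by blast
    moreover have "nl_mass (q n) (u n) {y. 3 * r \<le> dist y x} \<le> (LINT y|L. \<zeta> x y powr p * \<bar>u n y\<bar> powr q n)"
      by (rule nl_mass_le_integral[OF u_in_W q_pos q(2) mball(3)]) (use r in \<open>auto simp: \<zeta>_def field_simps\<close>)
    ultimately show ?case using x(1) F(1) by (intro bexI[of _ x]) auto
  qed
qed

text \<open>
  Choose \<open>r k\<close> so that almost all the mass lies in a ball of radius \<open>3 / (k + 1)\<close>; the centres of these
  balls have a convergent subsequence.
\<close>
lemma concentration_point:
  shows "\<exists>r a. strict_mono r \<and> a \<in> closure \<Omega> \<and>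
    (\<forall>\<rho>>0. (\<lambda>n. nl_mass (q (r n)) (u (r n)) {y. \<rho> \<le> dist y a}) \<longlonglongrightarrow> 0)"
proof -
  define i where "i k = inverse (real (Suc k))" for k
  have i: "0 < i k" "i \<longlonglongrightarrow> 0" for k using LIMSEQ_inverse_real_of_nat by (auto simp: i_def[abs_def])
  obtain r where r: "strict_mono r" "\<And>k. \<exists>x\<in>closure \<Omega>. nl_mass (q (r k)) (u (r k)) {y. 3 * i k \<le> dist y x} \<le> i k"
    using diagonal_eventually[of "\<lambda>k n. \<exists>x\<in>closure \<Omega>. nl_mass (q n) (u n) {y. 3 * i k \<le> dist y x} \<le> i k"]
      concentration[OF i(1) i(1)] by blast
  then obtain x where x: "\<And>k. x k \<in> closure \<Omega>" "\<And>k. nl_mass (q (r k)) (u (r k)) {y. 3 * i k \<le> dist y (x k)} \<le> i k"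
    by metis
  have "compact (closure \<Omega>)" using \<Omega>_bounded by (simp add: compact_closure)
  then obtain a l where a: "a \<in> closure \<Omega>" "strict_mono l" "(x \<circ> l) \<longlonglongrightarrow> a"
    using x(1) unfolding compact_def by blast
  have il: "(\<lambda>j. i (l j)) \<longlonglongrightarrow> 0" using LIMSEQ_subseq_LIMSEQ[OF i(2) a(2)] by (simp add: o_def)
  have "(\<lambda>j. nl_mass (q (r (l j))) (u (r (l j))) {y. \<rho> \<le> dist y a}) \<longlonglongrightarrow> 0" if \<rho>: "0 < \<rho>" for \<rho>
  proof (rule tendsto_sandwich[OF _ _ tendsto_const il])
    show "\<forall>\<^sub>F j in sequentially. 0 \<le> nl_mass (q (r (l j))) (u (r (l j))) {y. \<rho> \<le> dist y a}"
      by (intro always_eventually allI) (simp add: nl_mass_def)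
    have "\<forall>\<^sub>F j in sequentially. i (l j) < \<rho> / 6" using \<rho> by (intro order_tendstoD(2)[OF il]) simp
    moreover have "\<forall>\<^sub>F j in sequentially. dist (x (l j)) a < \<rho> / 2"
      using tendstoD[OF a(3), of "\<rho> / 2"] \<rho> by (simp add: o_def)
    ultimately show "\<forall>\<^sub>F j in sequentially. nl_mass (q (r (l j))) (u (r (l j))) {y. \<rho> \<le> dist y a} \<le> i (l j)"
    proof eventually_elim
      case (elim j)
      have sub: "{y. \<rho> \<le> dist y a} \<subseteq> {y. 3 * i (l j) \<le> dist y (x (l j))}"
      proof
        fix y assume "y \<in> {y. \<rho> \<le> dist y a}"
        then show "y \<in> {y. 3 * i (l j) \<le> dist y (x (l j))}"
          using elim dist_triangle[of y a "x (l j)"] by simp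
      qed
      have [measurable]: "{y. \<rho> \<le> dist y a} \<in> sets borel" "{y. 3 * i (l j) \<le> dist y (x (l j))} \<in> sets borel"
        by measurable
      have "nl_mass (q (r (l j))) (u (r (l j))) {y. \<rho> \<le> dist y a}
        \<le> nl_mass (q (r (l j))) (u (r (l j))) {y. 3 * i (l j) \<le> dist y (x (l j))}"
        unfolding nl_mass_def using sub
        by (intro integral_mono nl_mass_integrable[OF u_in_W q_pos q(2)] mult_right_mono) (auto simp: indicator_def)
      then show ?case using x(2)[of "l j"] by linarith
    qed
  qed
  moreover have "strict_mono (r \<circ> l)" using r(1) a(2) by (rule strict_mono_o)
  ultimately show ?thesis using a(1) by (intro exI[of _ "r \<circ> l"] exI[of _ a]) auto
qed

text \<open>
  Near \<open>a\<close> the test function is almost constant.  Away from \<open>a\<close> the measures have vanishing mass by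
  \<open>localized_identity\<close>, applied to a cut-off that vanishes near \<open>a\<close>.
\<close>
lemma measure_concentration:
  assumes conc: "\<And>\<rho>. 0 < \<rho> \<Longrightarrow> (\<lambda>n. nl_mass (q n) (u n) {y. \<rho> \<le> dist y a}) \<longlonglongrightarrow> 0"
  shows "measure_weak_tendsto (\<lambda>n. density L (Ds_pow s p (u n))) (scale_measure (ennreal M) (return borel a))"
  unfolding measure_weak_tendsto_def
proof (intro allI impI, elim conjE)
  fix \<phi> :: "'a \<Rightarrow> real" assume c: "continuous_on UNIV \<phi>" and lim0: "(\<phi> \<longlongrightarrow> 0) at_infinity"
  note [measurable] = W_D(4)[OF u_in_W]
  have [measurable]: "\<phi> \<in> borel_measurable borel" using c by (rule borel_measurable_continuous_onI)
  obtain B where B: "\<And>x. \<bar>\<phi> x\<bar> \<le> B" using C0_bounded[OF c lim0] by blast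
  have "scale_measure (ennreal M) (return borel a) = density (return borel a) (\<lambda>_. ennreal M)"
    by (rule measure_eqI) (auto simp: emeasure_density nn_integral_cmult_indicator)
  then have rhs: "(LINT x|scale_measure (ennreal M) (return borel a). \<phi> x) = M * \<phi> a"
    using M(2) by (simp add: integral_density integral_return)
  define I where "I n = (LINT z|pairs. \<phi> (fst z) * \<bar>hq (u n) z\<bar> powr p)" for n
  have K0: "0 \<le> K" using K(1)[of 0] modular_nonneg[of pairs p "hq (u 0)"] by linarith
  have "(\<lambda>n. I n - \<phi> a * E (u n)) \<longlonglongrightarrow> 0"
  proof (rule LIMSEQ_I)
    fix e :: real assume e: "0 < e"
    define e1 where "e1 = e / (2 * (K + 1))"
    have e1: "0 < e1" "e1 * K \<le> e / 2"
    proof -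
      show "0 < e1" using e K0 by (simp add: e1_def)
      then have "e1 * K \<le> e1 * (K + 1)" by (intro mult_left_mono) auto
      also have "\<dots> = e / 2" using K0 by (simp add: e1_def field_simps)
      finally show "e1 * K \<le> e / 2" .
    qed
    have "\<exists>d>0. \<forall>x. dist x a < d \<longrightarrow> dist (\<phi> x) (\<phi> a) < e1"
      using c e1(1) unfolding continuous_on_iff by blast
    then obtain d where d: "0 < d" "\<And>x. dist x a < d \<Longrightarrow> \<bar>\<phi> x - \<phi> a\<bar> < e1"
      unfolding dist_real_def by blast
    define r where "r = d / 2"
    have r: "0 < r" using d by (simp add: r_def)
    define \<zeta> where "\<zeta> y = max 0 (min 1 (dist y a / r - 1))" for y
    have \<zeta>: "0 \<le> \<zeta> y" "\<zeta> y \<le> 1" for y by (auto simp: \<zeta>_def)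
    have [measurable]: "\<zeta> \<in> borel_measurable borel" unfolding \<zeta>_def by measurable
    have pt: "\<bar>\<phi> y - \<phi> a\<bar> \<le> e1 + 2 * B * \<zeta> y" for y
    proof (cases "dist y a < d")
      case True
      have "0 \<le> B" using B[of a] by linarith
      then have "0 \<le> 2 * B * \<zeta> y" using \<zeta>(1)[of y] by simp
      then show ?thesis using d(2)[OF True] by linarith
    next
      case False
      then have "\<zeta> y = 1" using r d by (simp add: \<zeta>_def r_def field_simps)
      then show ?thesis using B[of y] B[of a] e1 by simp
    qed
    define Z where "Z n = (LINT z|pairs. \<zeta> (fst z) * \<bar>hq (u n) z\<bar> powr p)" for n
    define Y where "Y n = (LINT x|L. \<zeta> x * \<bar>u n x\<bar> powr q n)" for n
    have ZY: "(\<lambda>n. Z n - Y n) \<longlonglongrightarrow> 0" unfolding Z_def Y_def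
      by (rule localized_identity[where C = "1 / r" and B = 1])
        (use lipschitz_cutoff(2)[OF r] \<zeta> in \<open>auto simp: \<zeta>_def\<close>)
    have "Y \<longlonglongrightarrow> 0"
    proof (rule tendsto_sandwich[OF _ _ tendsto_const conc[OF r]])
      show "\<forall>\<^sub>F n in sequentially. 0 \<le> Y n"
        unfolding Y_def using \<zeta> by (intro always_eventually allI Bochner_Integration.integral_nonneg) auto
      have [measurable]: "{y. r \<le> dist y a} \<in> sets borel" by measurable
      have "Y n \<le> nl_mass (q n) (u n) {y. r \<le> dist y a}" for n
        unfolding Y_def nl_mass_def
      proof (rule integral_mono)
        show "integrable L (\<lambda>x. \<zeta> x * \<bar>u n x\<bar> powr q n)"
          by (rule integrable_bounded_mult[OF Lr_integrable[OF W_Lr[OF u_in_W q_pos q(2)]], where B = 1]) (use \<zeta> in auto)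
        show "integrable L (\<lambda>x. indicator {y. r \<le> dist y a} x * \<bar>u n x\<bar> powr q n)"
          by (rule nl_mass_integrable[OF u_in_W q_pos q(2)]) simp
        show "\<zeta> x * \<bar>u n x\<bar> powr q n \<le> indicator {y. r \<le> dist y a} x * \<bar>u n x\<bar> powr q n" for x
          using r by (intro mult_right_mono) (auto simp: \<zeta>_def indicator_def field_simps)
      qed
      then show "\<forall>\<^sub>F n in sequentially. Y n \<le> nl_mass (q n) (u n) {y. r \<le> dist y a}" by simp
    qed
    then have "(\<lambda>n. (Z n - Y n) + Y n) \<longlonglongrightarrow> 0 + 0" using ZY by (intro tendsto_add)
    then have "(\<lambda>n. 2 * B * Z n) \<longlonglongrightarrow> 2 * B * 0" by (intro tendsto_mult tendsto_const) simp
    then have "\<forall>\<^sub>F n in sequentially. 2 * B * Z n < e / 2" using e by (intro order_tendstoD) auto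
    then obtain N where N: "\<And>n. n \<ge> N \<Longrightarrow> 2 * B * Z n < e / 2" by (auto simp: eventually_sequentially)
    have "norm (I n - \<phi> a * E (u n) - 0) < e" if "n \<ge> N" for n
    proof -
      have iE: "integrable pairs (\<lambda>z. \<bar>hq (u n) z\<bar> powr p)" by (rule Lr_integrable[OF W_D(3)[OF u_in_W]])
      have i\<phi>: "integrable pairs (\<lambda>z. \<phi> (fst z) * \<bar>hq (u n) z\<bar> powr p)"
        by (rule integrable_bounded_mult[OF iE, where B = B]) (use B in auto)
      have i\<zeta>: "integrable pairs (\<lambda>z. \<zeta> (fst z) * \<bar>hq (u n) z\<bar> powr p)"
        by (rule integrable_bounded_mult[OF iE, where B = 1]) (use \<zeta> in auto)
      have eq: "I n - \<phi> a * E (u n) = (LINT z|pairs. \<phi> (fst z) * \<bar>hq (u n) z\<bar> powr p - \<phi> a * \<bar>hq (u n) z\<bar> powr p)"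
        using iE i\<phi> by (simp add: I_def modular_def)
      have "\<bar>I n - \<phi> a * E (u n)\<bar> \<le> (LINT z|pairs. \<bar>\<phi> (fst z) * \<bar>hq (u n) z\<bar> powr p - \<phi> a * \<bar>hq (u n) z\<bar> powr p\<bar>)"
        unfolding eq by (rule integral_abs_bound)
      also have "\<dots> \<le> (LINT z|pairs. e1 * \<bar>hq (u n) z\<bar> powr p + 2 * B * (\<zeta> (fst z) * \<bar>hq (u n) z\<bar> powr p))"
      proof (rule integral_mono)
        fix z :: "'a \<times> 'a"
        have "\<bar>\<phi> (fst z) * \<bar>hq (u n) z\<bar> powr p - \<phi> a * \<bar>hq (u n) z\<bar> powr p\<bar> = \<bar>\<phi> (fst z) - \<phi> a\<bar> * \<bar>hq (u n) z\<bar> powr p"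
          by (simp add: left_diff_distrib[symmetric] abs_mult)
        also have "\<dots> \<le> (e1 + 2 * B * \<zeta> (fst z)) * \<bar>hq (u n) z\<bar> powr p" using pt by (intro mult_right_mono) auto
        finally show "\<bar>\<phi> (fst z) * \<bar>hq (u n) z\<bar> powr p - \<phi> a * \<bar>hq (u n) z\<bar> powr p\<bar>
          \<le> e1 * \<bar>hq (u n) z\<bar> powr p + 2 * B * (\<zeta> (fst z) * \<bar>hq (u n) z\<bar> powr p)"
          by (simp add: distrib_right mult.assoc)
      qed (use iE i\<phi> i\<zeta> in auto)
      also have "\<dots> = e1 * E (u n) + 2 * B * Z n" using iE i\<zeta> by (simp add: modular_def Z_def)
      also have "\<dots> \<le> e1 * K + 2 * B * Z n" using K(1) e1 by (intro add_right_mono mult_left_mono) auto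
      finally show ?thesis using N[OF that] e1(2) by simp
    qed
    then show "\<exists>no. \<forall>n\<ge>no. norm (I n - \<phi> a * E (u n) - 0) < e" by blast
  qed
  then have "(\<lambda>n. (I n - \<phi> a * E (u n)) + \<phi> a * E (u n)) \<longlonglongrightarrow> 0 + \<phi> a * M"
    by (intro tendsto_add tendsto_mult tendsto_const M(1))
  then have "I \<longlonglongrightarrow> M * \<phi> a" by (simp add: mult.commute)
  then show "(\<lambda>n. LINT x|density L (Ds_pow s p (u n)). \<phi> x) \<longlonglongrightarrow> (LINT x|scale_measure (ennreal M) (return borel a). \<phi> x)"
    unfolding rhs by (simp add: integral_Ds_density[OF u_in_W _ B] I_def[abs_def])
qed

end

section \<open>The dichotomy\<close>

context frac_sobolev
begin

lemma sobolev_const_nonneg: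
  assumes "u \<in> W" "\<not> (AE x in L. u x = 0)"
  shows "0 \<le> S"
  unfolding S_def sobolev_const_def
proof (rule cInf_greatest)
  have "u \<in> W0 s p UNIV" using assms(1) by (auto simp: W0_def)
  with assms(2) show "{gagliardo_pow s p u / Lq_norm (crit_exp (real DIM('a)) s p) u powr p | u :: 'a \<Rightarrow> real.
      u \<in> W0 s p UNIV \<and> \<not> (AE x in lborel. u x = 0)} \<noteq> {}" by blast
qed (use p1 in \<open>auto simp: gagliardo_pow_eq_energy_pow\<close>)

end

lemma (in almost_critical) compactness_dichotomy:
  shows "\<exists>r. strict_mono r \<and> (\<exists>v\<in>W. W0_weak_tendsto s p \<Omega> (\<lambda>n. u (r n)) v \<and>
      ((W0_tendsto s p (\<lambda>n. u (r n)) v \<and> weak_solution s p \<Omega> 0 v \<and>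
        ((AE x in lborel. x \<in> \<Omega> \<longrightarrow> v x > 0) \<or> (AE x in lborel. x \<in> \<Omega> \<longrightarrow> v x < 0)))
      \<or> ((AE x in lborel. v x = 0) \<and>
        (\<exists>a \<in> closure \<Omega>. measure_weak_tendsto (\<lambda>n. density lborel (Ds_pow s p (u (r n))))
           (scale_measure (ennreal M) (return borel a))))))"
proof -
  obtain r v where r: "strict_mono r" and v: "v \<in> W" and lim: "AE x in L. (\<lambda>n. u (r n) x) \<longlonglongrightarrow> v x"
    using compact_embedding_AE[of u K, OF u_in_W K] by blast
  interpret sub: almost_critical s p \<Omega> "\<lambda>n. u (r n)" "\<lambda>n. q (r n)" K M by (rule subsequence[OF r])
  show ?thesis
  proof (cases "AE x in L. v x = 0")
    case False
    note strong = sub.strong_convergence[OF v lim False]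
    have ELv: "euler_lagrange pst v" by (rule sub.euler_lagrange_limit[OF v lim])
    have "(AE x in L. 0 \<le> v x) \<or> (AE x in L. v x \<le> 0)"
      using low_energy_sign[OF ELv S] strong(2) M(3) by simp
    then have sign: "(AE x in L. x \<in> \<Omega> \<longrightarrow> 0 < v x) \<or> (AE x in L. x \<in> \<Omega> \<longrightarrow> v x < 0)"
    proof
      assume "AE x in L. 0 \<le> v x"
      then show ?thesis using strong_positivity[OF ELv _ False] by blast
    next
      assume "AE x in L. v x \<le> 0"
      then have "AE x in L. x \<in> \<Omega> \<longrightarrow> 0 < - v x"
        using False by (intro strong_positivity[OF euler_lagrange_minus[OF ELv]]) auto
      then show ?thesis by simp
    qed
    have "W0_weak_tendsto s p \<Omega> (\<lambda>n. u (r n)) v" by (rule weak_convergence_of_AE[OF u_in_W K(1) v lim])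
    then show ?thesis
      using r v strong(1) weak_solution_of_euler_lagrange[OF ELv S] sign by blast
  next
    case True
    have lim0: "AE x in L. (\<lambda>n. u (r n) x) \<longlonglongrightarrow> 0" using lim True by eventually_elim simp
    interpret van: vanishing_almost_critical s p \<Omega> "\<lambda>n. u (r n)" "\<lambda>n. q (r n)" K M
      by unfold_locales (rule sub.Lp_vanishing[OF lim0])
    obtain l a where l: "strict_mono l" "a \<in> closure \<Omega>"
      and conc: "\<And>\<rho>. 0 < \<rho> \<Longrightarrow> (\<lambda>n. nl_mass (q (r (l n))) (u (r (l n))) {y. \<rho> \<le> dist y a}) \<longlonglongrightarrow> 0"
      using van.concentration_point by blast
    have rl: "strict_mono (\<lambda>n. r (l n))" using strict_mono_o[OF r l(1)] by (simp add: o_def)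
    interpret van': almost_critical s p \<Omega> "\<lambda>n. u (r (l n))" "\<lambda>n. q (r (l n))" K M by (rule subsequence[OF rl])
    interpret van': vanishing_almost_critical s p \<Omega> "\<lambda>n. u (r (l n))" "\<lambda>n. q (r (l n))" K M
      by unfold_locales (use LIMSEQ_subseq_LIMSEQ[OF van.m l(1)] in \<open>simp add: o_def\<close>)
    have "measure_weak_tendsto (\<lambda>n. density L (Ds_pow s p (u (r (l n))))) (scale_measure (ennreal M) (return borel a))"
      by (rule van'.measure_concentration[OF conc])
    moreover have "AE x in L. (\<lambda>n. u (r (l n)) x) \<longlonglongrightarrow> v x"
      using lim by eventually_elim (use LIMSEQ_subseq_LIMSEQ[OF _ l(1)] in \<open>force simp: o_def\<close>)
    then have "W0_weak_tendsto s p \<Omega> (\<lambda>n. u (r (l n))) v" by (rule weak_convergence_of_AE[OF u_in_W K(1) v])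
    ultimately show ?thesis using v True l(2) rl by (intro exI[of _ "\<lambda>n. r (l n)"] conjI bexI[of _ v]) auto
  qed
qed

theorem theorem1p2:
  fixes s p c :: real
    and \<Omega> :: "'a::euclidean_space set"
    and \<epsilon> :: "nat \<Rightarrow> real"
    and u :: "nat \<Rightarrow> 'a \<Rightarrow> real"
  assumes "0 < s" and "s < 1" and "1 < p" and "p * s < real DIM('a)"
    and "open \<Omega>" and "connected \<Omega>" and "\<Omega> \<noteq> {}" and "bounded \<Omega>"
    and "decseq \<epsilon>" and "\<epsilon> \<longlonglongrightarrow> 0"
    and "\<And>n. p < crit_exp (real DIM('a)) s p - \<epsilon> n"
    and "\<And>n. weak_solution s p \<Omega> (\<epsilon> n) (u n)"
    and "(\<lambda>n. energy s p \<Omega> (\<epsilon> n) (u n)) \<longlonglongrightarrow> c"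
    and "c \<in> {s / real DIM('a) * sobolev_const TYPE('a) s p powr (real DIM('a) / (p * s)) <..<
              2 * (s / real DIM('a)) * sobolev_const TYPE('a) s p powr (real DIM('a) / (p * s))}"
  shows "\<exists>r :: nat \<Rightarrow> nat. strict_mono r \<and>
    (\<exists>v \<in> W0 s p \<Omega>. W0_weak_tendsto s p \<Omega> (\<lambda>n. u (r n)) v \<and>
      ((W0_tendsto s p (\<lambda>n. u (r n)) v \<and>
        weak_solution s p \<Omega> 0 v \<and>
        ((AE x in lborel. x \<in> \<Omega> \<longrightarrow> v x > 0) \<or> (AE x in lborel. x \<in> \<Omega> \<longrightarrow> v x < 0)))
      \<or>
       ((AE x in lborel. v x = 0) \<and>
        (\<exists>a \<in> closure \<Omega>. measure_weak_tendsto
           (\<lambda>n. density lborel (Ds_pow s p (u (r n))))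
           (scale_measure (ennreal (c * real DIM('a) / s)) (return borel a))))))"
proof -
  interpret frac_sobolev s p \<Omega> using assms by unfold_locales auto
  define q where "q n = pst - \<epsilon> n" for n
  have \<epsilon>0: "0 \<le> \<epsilon> n" for n using decseq_ge[OF assms(9,10)] .
  have q: "p < q n" "q n \<le> pst" for n using assms(11)[of n] \<epsilon>0[of n] by (auto simp: q_def pst_def)
  have qlim: "q \<longlonglongrightarrow> pst" using tendsto_diff[OF tendsto_const assms(10), of pst] by (simp add: q_def[abs_def])
  have EL: "euler_lagrange (q n) (u n)" for n
    unfolding q_def using assms(12) \<epsilon>0 q(1)[of n] by (intro euler_lagrange_of_weak_solution) (auto simp: q_def)
  have u: "u n \<in> W" for n using EL by (auto simp: euler_lagrange_def)
  define N where "N = real DIM('a)"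
  have sN: "0 < s / N" using s0 by (simp add: N_def)
  have c: "s / N * kap < c" "c < 2 * (s / N) * kap"
    using assms(14) by (auto simp: kap_def S_def N_def)
  \<comment> \<open>The interval that contains \<open>c\<close> is nonempty only if \<open>kap > 0\<close>; together with \<open>S \<ge> 0\<close> this gives
    the Sobolev inequality with \<open>S > 0\<close>.\<close>
  have kap0: "0 < kap"
  proof -
    have "s / N * kap < 2 * (s / N * kap)" using c by (simp only: mult.assoc)
    then have "0 < s / N * kap" by argo
    then show ?thesis using sN zero_less_mult_pos by blast
  qed
  have c0: "0 < c" using c(1) mult_pos_pos[OF sN kap0] by linarith
  \<comment> \<open>On solutions the energy is a multiple of \<open>E\<close>, and the factor tends to \<open>s / N\<close>.\<close>
  have en: "energy s p \<Omega> (\<epsilon> n) (u n) = (1 / p - 1 / q n) * E (u n)" for n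
    using energy_eq[OF u, of "\<epsilon> n" n] euler_lagrange_self[OF EL[of n]]
    by (simp add: q_def left_diff_distrib)
  have "\<exists>n. \<not> (AE x in L. u n x = 0)"
  proof (rule ccontr)
    assume "\<not> ?thesis"
    then have "modular L (q n) (u n) = 0" for n
      using modular_eq_0_iff[OF W_Lr[OF u _ q(2)]] q(1)[of n] p1 by auto
    then have "energy s p \<Omega> (\<epsilon> n) (u n) = 0" for n using euler_lagrange_self[OF EL[of n]] by (simp add: en)
    then have "c = 0" using assms(13) by (simp add: LIMSEQ_const_iff)
    then show False using c0 by simp
  qed
  then have "0 \<le> S" using sobolev_const_nonneg[OF u] by blast
  moreover have "S \<noteq> 0" using kap0 by (auto simp: kap_def)
  ultimately have S: "0 < S" by simp
  have d: "1 / p - 1 / q n \<noteq> 0" for n using q(1)[of n] p1 by (simp add: field_simps)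
  have "(\<lambda>n. 1 / p - 1 / q n) \<longlonglongrightarrow> 1 / p - 1 / pst"
    using pst_gt_p p1 by (intro tendsto_diff tendsto_divide tendsto_const qlim) auto
  then have "(\<lambda>n. energy s p \<Omega> (\<epsilon> n) (u n) / (1 / p - 1 / q n)) \<longlonglongrightarrow> c / (s / N)"
    using sN unfolding pst_inverse N_def by (intro tendsto_divide assms(13)) auto
  moreover have "energy s p \<Omega> (\<epsilon> n) (u n) / (1 / p - 1 / q n) = E (u n)" for n
    unfolding en using d[of n] by (simp del: divide_eq_0_iff)
  ultimately have M: "(\<lambda>n. E (u n)) \<longlonglongrightarrow> c * N / s" by simp
  have "0 < c * N / s" using c0 s0 by (simp add: N_def)
  moreover have "c * N / s < 2 * kap" using c(2) s0 by (simp add: N_def field_simps)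
  moreover obtain K0 where K0: "\<And>n. E (u n) \<le> K0"
  proof -
    have "Bseq (\<lambda>n. E (u n))" using M by (intro convergent_imp_Bseq convergentI)
    then obtain K0 where "\<forall>n. norm (E (u n)) \<le> K0" by (rule BseqE)
    then show thesis by (intro that[of K0]) simp
  qed
  define K where "K = max K0 ((K0 / S) powr (pst / p))"
  have K: "E (u n) \<le> K" "modular L pst (u n) \<le> K" for n
  proof -
    show "E (u n) \<le> K" using K0[of n] by (simp add: K_def)
    have "modular L pst (u n) \<le> (E (u n) / S) powr (pst / p)"
      using subcritical_sobolev[OF u _ _ S, of pst] p1 pst_gt_p vol_pos by simp
    also have "\<dots> \<le> (K0 / S) powr (pst / p)"
      using K0[of n] S p1 pst_gt_p by (intro powr_mono2 divide_right_mono) auto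
    finally show "modular L pst (u n) \<le> K" by (simp add: K_def)
  qed
  ultimately interpret almost_critical s p \<Omega> u q K "c * N / s"
    using EL q qlim S M by unfold_locales auto
  show ?thesis using compactness_dichotomy unfolding N_def .
qed

end
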